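(* Let $\mathcal V$ and $\mathcal W$ be symmetric monoidal categories, let $(M,\mu,\eta,\nabla)$ be a symmetric monoidal monad on $\mathcal W$, let $F\colon \mathcal V\to\mathcal W$ be a (lax) symmetric monoidal functor with comparison maps $F_\epsilon\colon I_{\mathcal W}\to F I_{\mathcal V}$ and $\widetilde F_{A,B}\colon FA\otimes FB\to F(A\otimes B)$, and let $i\colon\mathcal U\hookrightarrow\mathcal W$ be a full strict monoidal subcategory. Write $$(\mathcal U/MF)\colon\ \mathcal V\xrightarrow{\ F\ }\mathcal W\xrightarrow{\ L_M\ }\mathrm{Kl}_M\xrightarrow{\ \mathcal U/(-)\ }\mathsf{cat}.$$ Then for any $\mathcal V$-category $\mathcal C$, change of base along $(\mathcal U/MF)$ yields a (strict) 2-category $(\mathcal U/MF)_*\mathcal C$. If $\mathcal C$ is a monoidal (respectively symmetric monoidal) $\mathcal V$-category, with product $\boxtimes_{\mathcal C}$ and unit $I_{\mathcal C}$, then $(\mathcal U/MF)_*\mathcal C$ is a nearly strict monoidal (respectively nearly strict symmetric monoidal) 2-category. Explicitly: (i) The 0-cells are the objects of $\mathcal C$. (ii) The 1-cells from $X$ to $Y$ are the $\mathrm{Kl}_M$-arrows $f\colon U\to F\mathcal C(X,Y)$ with $U$ an object of $\mathcal U$. (iii) The 2-cells from $f\colon U\to F\mathcal C(X,Y)$ to $g\colon V\to F\mathcal C(X,Y)$ are the $\mathrm{Kl}_M$-arrows $\varphi\colon U\to V$ with $f=\varphi\,;g$ in $\mathrm{Kl}_M$. They compose vertically by composition in $\mathrm{Kl}_M$.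 (iv) The horizontal composite of $f_1\colon U_1\to F\mathcal C(X,Y)$ and $f_2\colon U_2\to F\mathcal C(Y,Z)$ is the $\mathrm{Kl}_M$-composite $$U_1\otimes U_2\xrightarrow{f_1\otimes f_2}F\mathcal C(X,Y)\otimes F\mathcal C(Y,Z)\xrightarrow{( * )}F\mathcal C(X,Z),$$ where $( * )=\widetilde F\,;F(;_{\mathcal C})\,;\eta$. The horizontal composite of 2-cells $\varphi_1\colon f_1\Rightarrow g_1$, $\varphi_2\colon f_2\Rightarrow g_2$ is $\varphi_1\otimes\varphi_2$. The identity 1-cell on $X$ is $F_\epsilon\,;F(\mathrm{id}_X)\,;\eta\colon I_{\mathcal W}\to F\mathcal C(X,X)$. (v) If $\mathcal C$ is monoidal, the monoidal product of 1-cells $f_1\colon U_1\to F\mathcal C(X_1,Y_1)$ and $f_2\colon U_2\to F\mathcal C(X_2,Y_2)$ is the $\mathrm{Kl}_M$-composite $$U_1\otimes U_2\xrightarrow{f_1\otimes f_2}F\mathcal C(X_1,Y_1)\otimes F\mathcal C(X_2,Y_2)\xrightarrow{\widetilde F\,;F(\boxtimes_{\mathcal C})\,;\eta}F\mathcal C(X_1\boxtimes X_2,Y_1\boxtimes Y_2),$$ the monoidal product of 2-cells $\varphi_1,\varphi_2$ is $\varphi_1\otimes\varphi_2$, and the unit is $I_{\mathcal C}$. Interchange holds up to natural invertible 2-cells (tensorators) $\vartheta_{f_1,f_2,g_1,g_2}\colon (f_1\boxtimes f_2);(g_1\boxtimes g_2)\Rightarrow(f_1;g_1)\boxtimes(f_2;g_2)$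 given by the coherence isomorphism $m\colon (U_1\otimes U_2)\otimes(V_1\otimes V_2)\to(U_1\otimes V_1)\otimes(U_2\otimes V_2)$ rearranging the parameter objects, where $U_i$, $V_i$ are the parameter objects of $f_i$, $g_i$. The coherence 1-cells are lifted from those of $\mathcal C$; e.g. the left unitor has components $l_X=F_\epsilon\,;F(l^{\mathcal C}_X)\,;\eta\colon I_{\mathcal W}\to F\mathcal C(I_{\mathcal C}\boxtimes X,X)$, and similarly for the associator, the right unitor and (in the symmetric case) the symmetry. In the symmetric case, the symmetry is natural up to an invertible 2-cell that swaps the parameter objects.
   Context: Notation: $f;g$ denotes composition in diagrammatic order ($f$ first). 2-categories are strict. $\mathsf{cat}$ is the category of small categories and functors with the Cartesian monoidal structure. Symmetric monoidal monad: a monad $(M,\mu,\eta)$ on a symmetric monoidal category $\mathcal W$ with morphisms $\nabla_{X,Y}\colon MX\otimes MY\to M(X\otimes Y)$, natural in $X,Y$, making $M$ a lax symmetric monoidal functor with unit comparison $\eta_I$, and making $\mu$ and $\eta$ monoidal transformations. Its Kleisli category $\mathrm{Kl}_M$ is symmetric monoidal: on objects the product is that of $\mathcal W$, and the product of $f\colon A\to MX$ and $g\colon B\to MY$ is $(f\otimes g);\nabla_{X,Y}\colon A\otimes B\to M(X\otimes Y)$. The identity-on-objects functor $L_M\colon\mathcal W\to\mathrm{Kl}_M$, $f\mapsto f;\eta$, is strict symmetric monoidal. An arrow written $A\to B$ in $\mathrm{Kl}_M$ is a $\mathcal W$-arrow $A\to MB$; expressions of the form $h;\eta$ with $h$ a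 $\mathcal W$-arrow denote the Kleisli arrow $L_M(h)$. Full strict monoidal subcategory $\mathcal U\hookrightarrow\mathcal W$: a full subcategory containing $I_{\mathcal W}$ and closed under $\otimes$, with strict monoidal inclusion, such that $\mathcal U$ is a strict monoidal category (the associators and unitors on objects of $\mathcal U$ are identities). $\mathcal U$ is small. When slicing in $\mathrm{Kl}_M$, $\mathcal U$ is regarded as the full monoidal subcategory of $\mathrm{Kl}_M$ on the objects of $\mathcal U$. Partial slice functor: for a subcategory $\mathcal U$ of a category $\mathcal K$, $\mathcal U/(-)\colon\mathcal K\to\mathsf{cat}$ sends $A$ to the category whose objects are pairs $(U,f\colon U\to A)$ with $U\in\mathcal U$, and whose arrows $(U,f)\to(V,g)$ are $\mathcal U$-arrows $\varphi\colon U\to V$ with $f=\varphi;g$; it sends $f\colon A\to B$ to post-composition with $f$. For $\mathcal K$ monoidal and $\mathcal U$ a full strict monoidal subcategory, it is lax monoidal via $*\mapsto\mathrm{id}_{I}$ and $(f_1,f_2)\mapsto f_1\otimes f_2$, $(\varphi,\psi)\mapsto\varphi\otimes\psi$. Change of base: for a lax monoidal functor $N\colon\mathcal V\to\mathcal W$ and a $\mathcal V$-category $\mathcal C$, the $\mathcal W$-category $N_*\mathcal C$ has the objects of $\mathcal C$, hom-objects $N\mathcal C(A,B)$, composition $\widetilde N;N(;_{\mathcal C})$ and identities $N_\epsilon;N(\mathrm{id}_A)$. A $\mathsf{cat}$-category is a (strict) 2-category. Underlying category: for a $\mathcal V$-category $\mathcal C$, $\mathcal C_0$ has the same objects and arrows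 $A\to B$ the $\mathcal V$-arrows $I\to\mathcal C(A,B)$. The product $\mathcal C\otimes\mathcal D$ of $\mathcal V$-categories has objects $\mathrm{Ob}(\mathcal C)\times\mathrm{Ob}(\mathcal D)$ and hom-objects $\mathcal C(A_1,B_1)\otimes\mathcal D(A_2,B_2)$, with composition $m;(;_{\mathcal C}\otimes;_{\mathcal D})$, where $m\colon(W\otimes X)\otimes(Y\otimes Z)\to(W\otimes Y)\otimes(X\otimes Z)$ is the canonical coherence isomorphism built from associators and the symmetry. Monoidal $\mathcal V$-category: a $\mathcal V$-category $\mathcal C$ with a $\mathcal V$-functor $\boxtimes\colon\mathcal C\otimes\mathcal C\to\mathcal C$, a unit object $J$, and $\mathcal V$-natural isomorphisms $a_{A,B,C}\colon I\to\mathcal C((A\boxtimes B)\boxtimes C,A\boxtimes(B\boxtimes C))$, $r_A\colon I\to\mathcal C(A\boxtimes J,A)$, $l_A\colon I\to\mathcal C(J\boxtimes A,A)$ making $\mathcal C_0$ (with the induced product, $f_1,f_2\mapsto (I\cong I\otimes I\xrightarrow{f_1\otimes f_2}\mathcal C(A_1,B_1)\otimes\mathcal C(A_2,B_2)\xrightarrow{\boxtimes}\mathcal C(A_1\boxtimes A_2,B_1\boxtimes B_2))$) a monoidal category. It is symmetric if it also has a $\mathcal V$-natural isomorphism $s_{A,B}\colon I\to\mathcal C(A\boxtimes B,B\boxtimes A)$ making $\mathcal C_0$ symmetric monoidal. Nearly strict monoidal 2-category: a (strict) 2-category $\mathbb C$ with a pseudofunctor $\boxtimes\colon\mathbb C\times\mathbb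 C\to\mathbb C$, a unit object $J$, and invertible 1-cells $a_{A,B,C}\colon(A\boxtimes B)\boxtimes C\to A\boxtimes(B\boxtimes C)$, $r_A\colon A\boxtimes J\to A$, $l_A\colon J\boxtimes A\to A$ that are strictly (2-)natural and satisfy the pentagon and triangle identities as equations of 1-cells. In particular interchange holds only up to coherent invertible 2-cells $\vartheta_{f_1,f_2,g_1,g_2}\colon(f_1\boxtimes f_2);(g_1\boxtimes g_2)\Rightarrow(f_1;g_1)\boxtimes(f_2;g_2)$ (tensorators). It is nearly strict symmetric monoidal if additionally equipped with a strong 2-natural transformation (a pseudonatural transformation, natural up to coherent invertible 2-cells) with 1-cell components $s_{A,B}\colon A\boxtimes B\to B\boxtimes A$ satisfying $s_{A,B};s_{B,A}=\mathrm{id}$ and the coherence axioms of symmetric monoidal categories as equations of 1-cells. *)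

theory Defs
  imports Main
begin

section \<open>Categories, functors, natural transformations\<close>

text \<open>
  Composition is written in diagrammatic order throughout: f \<Zsemi> g is "first f, then g".
  Objects and arrows are drawn from HOL types, so every category is small relative to the
  ambient type universe and no separate smallness condition appears.
\<close>

record ('o, 'a) cat =
  Ob :: "'o set"
  Arr :: "'a set"
  Dom :: "'a \<Rightarrow> 'o"
  Cod :: "'a \<Rightarrow> 'o"
  Ide :: "'o \<Rightarrow> 'a"
  Cmp :: "'a \<Rightarrow> 'a \<Rightarrow> 'a" (infixl "\<Zsemi>\<index>" 70)

definition Hom :: "('o, 'a, 'z) cat_scheme \<Rightarrow> 'o \<Rightarrow> 'o \<Rightarrow> 'a set" where
  "Hom C A B = {f \<in> Arr C. Dom C f = A \<and> Cod C f = B}"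

locale category =
  fixes C :: "('o, 'a, 'z) cat_scheme" (structure)
  assumes dom_ob: "f \<in> Arr C \<Longrightarrow> Dom C f \<in> Ob C"
    and cod_ob: "f \<in> Arr C \<Longrightarrow> Cod C f \<in> Ob C"
    and ide_hom: "A \<in> Ob C \<Longrightarrow> Ide C A \<in> Hom C A A"
    and cmp_hom: "f \<in> Hom C A B \<Longrightarrow> g \<in> Hom C B D \<Longrightarrow> f \<Zsemi> g \<in> Hom C A D"
    and ide_cmp: "f \<in> Hom C A B \<Longrightarrow> Ide C A \<Zsemi> f = f"
    and cmp_ide: "f \<in> Hom C A B \<Longrightarrow> f \<Zsemi> Ide C B = f"
    and cmp_assoc: "f \<in> Hom C A B \<Longrightarrow> g \<in> Hom C B D \<Longrightarrow> h \<in> Hom C D E \<Longrightarrow>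
      (f \<Zsemi> g) \<Zsemi> h = f \<Zsemi> (g \<Zsemi> h)"

definition inverse_arrows :: "('o, 'a, 'z) cat_scheme \<Rightarrow> 'a \<Rightarrow> 'a \<Rightarrow> bool" where
  "inverse_arrows C f g \<longleftrightarrow> f \<in> Arr C \<and> g \<in> Hom C (Cod C f) (Dom C f) \<and>
     f \<Zsemi>\<^bsub>C\<^esub> g = Ide C (Dom C f) \<and> g \<Zsemi>\<^bsub>C\<^esub> f = Ide C (Cod C f)"

definition iso :: "('o, 'a, 'z) cat_scheme \<Rightarrow> 'a \<Rightarrow> bool" where
  "iso C f \<longleftrightarrow> (\<exists>g. inverse_arrows C f g)"

definition inverse_of :: "('o, 'a, 'z) cat_scheme \<Rightarrow> 'a \<Rightarrow> 'a" where
  "inverse_of C f = (THE g. inverse_arrows C f g)"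

text \<open>
  Arrows tagged with source and target. They serve as the arrows of categories whose homs are
  given by elements that do not determine their endpoints: Kleisli categories, slice categories,
  and underlying categories of enriched categories.
\<close>

datatype ('o, 'a) arrow = Arrow (Src: 'o) (Val: 'a) (Tgt: 'o)

record ('o, 'a, 'p, 'b) funct =
  fob :: "'o \<Rightarrow> 'p"
  far :: "'a \<Rightarrow> 'b"

locale category_functor = C: category C + D: category D
  for C :: "('o, 'a, 'y) cat_scheme" and D :: "('p, 'b, 'z) cat_scheme" +
  fixes F :: "('o, 'a, 'p, 'b, 'w) funct_scheme"
  assumes fob_ob: "A \<in> Ob C \<Longrightarrow> fob F A \<in> Ob D"
    and far_hom: "f \<in> Hom C A B \<Longrightarrow> far F f \<in> Hom D (fob F A) (fob F B)"
    and far_ide: "A \<in> Ob C \<Longrightarrow> far F (Ide C A) = Ide D (fob F A)"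
    and far_cmp: "f \<in> Hom C A B \<Longrightarrow> g \<in> Hom C B E \<Longrightarrow>
      far F (f \<Zsemi>\<^bsub>C\<^esub> g) = far F f \<Zsemi>\<^bsub>D\<^esub> far F g"

definition functor_eq ::
    "('o, 'a, 'z) cat_scheme \<Rightarrow> ('o, 'a, 'p, 'b) funct \<Rightarrow> ('o, 'a, 'p, 'b) funct \<Rightarrow> bool" where
  "functor_eq C F G \<longleftrightarrow> (\<forall>A\<in>Ob C. fob F A = fob G A) \<and> (\<forall>f\<in>Arr C. far F f = far G f)"

definition id_funct :: "('o, 'a, 'o, 'a) funct" where
  "id_funct = \<lparr>fob = (\<lambda>A. A), far = (\<lambda>f. f)\<rparr>"

definition comp_funct ::
    "('o, 'a, 'p, 'b, 'y) funct_scheme \<Rightarrow> ('p, 'b, 'q, 'c, 'z) funct_scheme \<Rightarrow> ('o, 'a, 'q, 'c) funct" where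
  "comp_funct F G = \<lparr>fob = (\<lambda>A. fob G (fob F A)), far = (\<lambda>f. far G (far F f))\<rparr>"

definition prod_funct ::
    "('o, 'a, 'p, 'b, 'y) funct_scheme \<Rightarrow> ('q, 'c, 'r, 'd, 'z) funct_scheme \<Rightarrow>
     ('o \<times> 'q, 'a \<times> 'c, 'p \<times> 'r, 'b \<times> 'd) funct" where
  "prod_funct F G =
     \<lparr>fob = (\<lambda>(A, B). (fob F A, fob G B)), far = (\<lambda>(f, g). (far F f, far G g))\<rparr>"

definition prod_cat ::
    "('o, 'a, 'y) cat_scheme \<Rightarrow> ('p, 'b, 'z) cat_scheme \<Rightarrow> ('o \<times> 'p, 'a \<times> 'b) cat" where
  "prod_cat C D =
     \<lparr>Ob = Ob C \<times> Ob D, Arr = Arr C \<times> Arr D,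
      Dom = (\<lambda>(f, g). (Dom C f, Dom D g)), Cod = (\<lambda>(f, g). (Cod C f, Cod D g)),
      Ide = (\<lambda>(A, B). (Ide C A, Ide D B)),
      Cmp = (\<lambda>(f, g) (f', g'). (f \<Zsemi>\<^bsub>C\<^esub> f', g \<Zsemi>\<^bsub>D\<^esub> g'))\<rparr>"

locale natural_transformation =
  F: category_functor C D F + G: category_functor C D G
  for C :: "('o, 'a, 'y) cat_scheme" and D :: "('p, 'b, 'z) cat_scheme"
    and F :: "('o, 'a, 'p, 'b, 'u) funct_scheme" and G :: "('o, 'a, 'p, 'b, 'v) funct_scheme" +
  fixes t :: "'o \<Rightarrow> 'b"
  assumes component_hom: "A \<in> Ob C \<Longrightarrow> t A \<in> Hom D (fob F A) (fob G A)"
    and naturality: "f \<in> Hom C A B \<Longrightarrow> far F f \<Zsemi>\<^bsub>D\<^esub> t B = t A \<Zsemi>\<^bsub>D\<^esub> far G f"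


section \<open>Monoidal categories, lax monoidal functors, symmetric monoidal monads\<close>

record ('o, 'a) moncat = "('o, 'a) cat" +
  Tens0 :: "'o \<Rightarrow> 'o \<Rightarrow> 'o" (infixl "\<odot>\<index>" 75)
  Tens1 :: "'a \<Rightarrow> 'a \<Rightarrow> 'a" (infixl "\<otimes>\<index>" 75)
  Unt :: "'o"
  Asc :: "'o \<Rightarrow> 'o \<Rightarrow> 'o \<Rightarrow> 'a"
  Lun :: "'o \<Rightarrow> 'a"
  Run :: "'o \<Rightarrow> 'a"

locale monoidal_category = category C
  for C :: "('o, 'a, 'z) moncat_scheme" (structure) +
  assumes unt_ob: "Unt C \<in> Ob C"
    and tens_functor: "category_functor (prod_cat C C) C
      \<lparr>fob = (\<lambda>(A, B). A \<odot> B), far = (\<lambda>(f, g). f \<otimes> g)\<rparr>"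
    and asc_hom: "A \<in> Ob C \<Longrightarrow> B \<in> Ob C \<Longrightarrow> D \<in> Ob C \<Longrightarrow>
      Asc C A B D \<in> Hom C ((A \<odot> B) \<odot> D) (A \<odot> (B \<odot> D))"
    and asc_iso: "A \<in> Ob C \<Longrightarrow> B \<in> Ob C \<Longrightarrow> D \<in> Ob C \<Longrightarrow> iso C (Asc C A B D)"
    and asc_natural: "f \<in> Hom C A A' \<Longrightarrow> g \<in> Hom C B B' \<Longrightarrow> h \<in> Hom C D D' \<Longrightarrow>
      ((f \<otimes> g) \<otimes> h) \<Zsemi> Asc C A' B' D' = Asc C A B D \<Zsemi> (f \<otimes> (g \<otimes> h))"
    and lun_hom: "A \<in> Ob C \<Longrightarrow> Lun C A \<in> Hom C (Unt C \<odot> A) A"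
    and lun_iso: "A \<in> Ob C \<Longrightarrow> iso C (Lun C A)"
    and lun_natural: "f \<in> Hom C A B \<Longrightarrow> (Ide C (Unt C) \<otimes> f) \<Zsemi> Lun C B = Lun C A \<Zsemi> f"
    and run_hom: "A \<in> Ob C \<Longrightarrow> Run C A \<in> Hom C (A \<odot> Unt C) A"
    and run_iso: "A \<in> Ob C \<Longrightarrow> iso C (Run C A)"
    and run_natural: "f \<in> Hom C A B \<Longrightarrow> (f \<otimes> Ide C (Unt C)) \<Zsemi> Run C B = Run C A \<Zsemi> f"
    and pentagon: "A \<in> Ob C \<Longrightarrow> B \<in> Ob C \<Longrightarrow> D \<in> Ob C \<Longrightarrow> E \<in> Ob C \<Longrightarrow>
      Asc C (A \<odot> B) D E \<Zsemi> Asc C A B (D \<odot> E) =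
      (Asc C A B D \<otimes> Ide C E) \<Zsemi> Asc C A (B \<odot> D) E \<Zsemi> (Ide C A \<otimes> Asc C B D E)"
    and triangle: "A \<in> Ob C \<Longrightarrow> B \<in> Ob C \<Longrightarrow>
      Asc C A (Unt C) B \<Zsemi> (Ide C A \<otimes> Lun C B) = Run C A \<otimes> Ide C B"

locale symmetry = monoidal_category C
  for C :: "('o, 'a, 'z) moncat_scheme" (structure) +
  fixes s :: "'o \<Rightarrow> 'o \<Rightarrow> 'a"
  assumes sym_hom: "A \<in> Ob C \<Longrightarrow> B \<in> Ob C \<Longrightarrow> s A B \<in> Hom C (A \<odot> B) (B \<odot> A)"
    and sym_natural: "f \<in> Hom C A A' \<Longrightarrow> g \<in> Hom C B B' \<Longrightarrow>
      (f \<otimes> g) \<Zsemi> s A' B' = s A B \<Zsemi> (g \<otimes> f)"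
    and sym_sym: "A \<in> Ob C \<Longrightarrow> B \<in> Ob C \<Longrightarrow> s A B \<Zsemi> s B A = Ide C (A \<odot> B)"
    and sym_unit: "A \<in> Ob C \<Longrightarrow> s A (Unt C) \<Zsemi> Lun C A = Run C A"
    and hexagon: "A \<in> Ob C \<Longrightarrow> B \<in> Ob C \<Longrightarrow> D \<in> Ob C \<Longrightarrow>
      Asc C A B D \<Zsemi> s A (B \<odot> D) \<Zsemi> Asc C B D A =
      (s A B \<otimes> Ide C D) \<Zsemi> Asc C B A D \<Zsemi> (Ide C B \<otimes> s A D)"

record ('o, 'a) smoncat = "('o, 'a) moncat" +
  Sym :: "'o \<Rightarrow> 'o \<Rightarrow> 'a"

locale symmetric_monoidal_category = symmetry C "Sym C"
  for C :: "('o, 'a, 'z) smoncat_scheme" (structure)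

definition middle_swap ::
    "('o, 'a, 'z) smoncat_scheme \<Rightarrow> 'o \<Rightarrow> 'o \<Rightarrow> 'o \<Rightarrow> 'o \<Rightarrow> 'a" where
  \<comment> \<open>the coherence isomorphism \<open>m : (A \<odot> B) \<odot> (D \<odot> E) \<rightarrow> (A \<odot> D) \<odot> (B \<odot> E)\<close>\<close>
  "middle_swap C A B D E =
     Asc C A B (D \<odot>\<^bsub>C\<^esub> E)
     \<Zsemi>\<^bsub>C\<^esub> (Ide C A \<otimes>\<^bsub>C\<^esub> inverse_of C (Asc C B D E))
     \<Zsemi>\<^bsub>C\<^esub> (Ide C A \<otimes>\<^bsub>C\<^esub> (Sym C B D \<otimes>\<^bsub>C\<^esub> Ide C E))
     \<Zsemi>\<^bsub>C\<^esub> (Ide C A \<otimes>\<^bsub>C\<^esub> Asc C D B E)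
     \<Zsemi>\<^bsub>C\<^esub> inverse_of C (Asc C A D (B \<odot>\<^bsub>C\<^esub> E))"

record ('o, 'a, 'p, 'b) laxfun = "('o, 'a, 'p, 'b) funct" +
  eps :: "'b"
  tld :: "'o \<Rightarrow> 'o \<Rightarrow> 'b"

locale lax_monoidal_functor =
  V: monoidal_category V + W: monoidal_category W + category_functor V W F
  for V :: "('o, 'a, 'y) moncat_scheme" and W :: "('p, 'b, 'z) moncat_scheme"
    and F :: "('o, 'a, 'p, 'b, 'w) laxfun_scheme" +
  assumes eps_hom: "eps F \<in> Hom W (Unt W) (fob F (Unt V))"
    and tld_hom: "A \<in> Ob V \<Longrightarrow> B \<in> Ob V \<Longrightarrow>
      tld F A B \<in> Hom W (fob F A \<odot>\<^bsub>W\<^esub> fob F B) (fob F (A \<odot>\<^bsub>V\<^esub> B))"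
    and tld_natural: "f \<in> Hom V A A' \<Longrightarrow> g \<in> Hom V B B' \<Longrightarrow>
      (far F f \<otimes>\<^bsub>W\<^esub> far F g) \<Zsemi>\<^bsub>W\<^esub> tld F A' B' = tld F A B \<Zsemi>\<^bsub>W\<^esub> far F (f \<otimes>\<^bsub>V\<^esub> g)"
    and tld_assoc: "A \<in> Ob V \<Longrightarrow> B \<in> Ob V \<Longrightarrow> D \<in> Ob V \<Longrightarrow>
      (tld F A B \<otimes>\<^bsub>W\<^esub> Ide W (fob F D)) \<Zsemi>\<^bsub>W\<^esub> tld F (A \<odot>\<^bsub>V\<^esub> B) D \<Zsemi>\<^bsub>W\<^esub> far F (Asc V A B D) =
      Asc W (fob F A) (fob F B) (fob F D) \<Zsemi>\<^bsub>W\<^esub> (Ide W (fob F A) \<otimes>\<^bsub>W\<^esub> tld F B D) \<Zsemi>\<^bsub>W\<^esub> tld F A (B \<odot>\<^bsub>V\<^esub> D)"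
    and tld_lun: "A \<in> Ob V \<Longrightarrow>
      (eps F \<otimes>\<^bsub>W\<^esub> Ide W (fob F A)) \<Zsemi>\<^bsub>W\<^esub> tld F (Unt V) A \<Zsemi>\<^bsub>W\<^esub> far F (Lun V A) = Lun W (fob F A)"
    and tld_run: "A \<in> Ob V \<Longrightarrow>
      (Ide W (fob F A) \<otimes>\<^bsub>W\<^esub> eps F) \<Zsemi>\<^bsub>W\<^esub> tld F A (Unt V) \<Zsemi>\<^bsub>W\<^esub> far F (Run V A) = Run W (fob F A)"

locale lax_symmetric_monoidal_functor =
  lax_monoidal_functor V W F + V: symmetric_monoidal_category V + W: symmetric_monoidal_category W
  for V :: "('o, 'a, 'y) smoncat_scheme" and W :: "('p, 'b, 'z) smoncat_scheme"
    and F :: "('o, 'a, 'p, 'b, 'w) laxfun_scheme" +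
  assumes tld_sym: "A \<in> Ob V \<Longrightarrow> B \<in> Ob V \<Longrightarrow>
      tld F A B \<Zsemi>\<^bsub>W\<^esub> far F (Sym V A B) = Sym W (fob F A) (fob F B) \<Zsemi>\<^bsub>W\<^esub> tld F B A"

definition id_laxfun :: "('o, 'a, 'z) moncat_scheme \<Rightarrow> ('o, 'a, 'o, 'a) laxfun" where
  "id_laxfun V = \<lparr>fob = (\<lambda>A. A), far = (\<lambda>f. f), eps = Ide V (Unt V),
                  tld = (\<lambda>A B. Ide V (A \<odot>\<^bsub>V\<^esub> B))\<rparr>"

text \<open>The argument \<open>W\<close> is the codomain of the second functor, where the comparisons are composed.\<close>

definition comp_laxfun ::
    "('q, 'c, 'z) moncat_scheme \<Rightarrow> ('o, 'a, 'p, 'b, 'x) laxfun_scheme \<Rightarrow>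
     ('p, 'b, 'q, 'c, 'y) laxfun_scheme \<Rightarrow> ('o, 'a, 'q, 'c) laxfun" where
  "comp_laxfun W F G =
     \<lparr>fob = (\<lambda>A. fob G (fob F A)), far = (\<lambda>f. far G (far F f)),
      eps = eps G \<Zsemi>\<^bsub>W\<^esub> far G (eps F),
      tld = (\<lambda>A B. tld G (fob F A) (fob F B) \<Zsemi>\<^bsub>W\<^esub> far G (tld F A B))\<rparr>"

locale monoidal_transformation =
  F: lax_monoidal_functor V W F + G: lax_monoidal_functor V W G + natural_transformation V W F G t
  for V :: "('o, 'a, 'y) moncat_scheme" and W :: "('p, 'b, 'z) moncat_scheme"
    and F :: "('o, 'a, 'p, 'b, 'u) laxfun_scheme" and G :: "('o, 'a, 'p, 'b, 'v) laxfun_scheme"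
    and t :: "'o \<Rightarrow> 'b" +
  assumes component_eps: "eps F \<Zsemi>\<^bsub>W\<^esub> t (Unt V) = eps G"
    and component_tld: "A \<in> Ob V \<Longrightarrow> B \<in> Ob V \<Longrightarrow>
      tld F A B \<Zsemi>\<^bsub>W\<^esub> t (A \<odot>\<^bsub>V\<^esub> B) = (t A \<otimes>\<^bsub>W\<^esub> t B) \<Zsemi>\<^bsub>W\<^esub> tld G A B"

record ('o, 'a) monmonad = "('o, 'a, 'o, 'a) funct" +
  Mu :: "'o \<Rightarrow> 'a"
  Eta :: "'o \<Rightarrow> 'a"
  Nabla :: "'o \<Rightarrow> 'o \<Rightarrow> 'a"

definition monad_laxfun ::
    "('o, 'a, 'y) moncat_scheme \<Rightarrow> ('o, 'a, 'z) monmonad_scheme \<Rightarrow> ('o, 'a, 'o, 'a) laxfun" where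
  "monad_laxfun W M = \<lparr>fob = fob M, far = far M, eps = Eta M (Unt W), tld = Nabla M\<rparr>"

locale symmetric_monoidal_monad = symmetric_monoidal_category W
  for W :: "('o, 'a, 'y) smoncat_scheme" (structure) +
  fixes M :: "('o, 'a, 'z) monmonad_scheme"
  assumes monad_lax: "lax_symmetric_monoidal_functor W W (monad_laxfun W M)"
    and mu_monoidal: "monoidal_transformation W W
      (comp_laxfun W (monad_laxfun W M) (monad_laxfun W M)) (monad_laxfun W M) (Mu M)"
    and eta_monoidal: "monoidal_transformation W W (id_laxfun W) (monad_laxfun W M) (Eta M)"
    and mu_mu: "A \<in> Ob W \<Longrightarrow> far M (Mu M A) \<Zsemi> Mu M A = Mu M (fob M A) \<Zsemi> Mu M A"
    and eta_mu: "A \<in> Ob W \<Longrightarrow> Eta M (fob M A) \<Zsemi> Mu M A = Ide W (fob M A)"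
    and M_eta_mu: "A \<in> Ob W \<Longrightarrow> far M (Eta M A) \<Zsemi> Mu M A = Ide W (fob M A)"


subsection \<open>The monoidal Kleisli category\<close>

definition kleisli_lift ::
    "('o, 'a, 'y) cat_scheme \<Rightarrow> ('o, 'a, 'z) monmonad_scheme \<Rightarrow> 'a \<Rightarrow> ('o, 'a) arrow" where
  "kleisli_lift W M h = Arrow (Dom W h) (h \<Zsemi>\<^bsub>W\<^esub> Eta M (Cod W h)) (Cod W h)"

text \<open>
  A Kleisli arrow from \<open>A\<close> to \<open>B\<close> is \<open>Arrow A f B\<close> with \<open>f\<close> an arrow from \<open>A\<close> to \<open>M B\<close>;
  the tag is needed because \<open>M B\<close> does not determine \<open>B\<close>.
\<close>

definition kleisli ::
    "('o, 'a, 'y) smoncat_scheme \<Rightarrow> ('o, 'a, 'z) monmonad_scheme \<Rightarrow> ('o, ('o, 'a) arrow) smoncat" where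
  "kleisli W M =
     \<lparr>Ob = Ob W,
      Arr = {Arrow A f B | A f B. A \<in> Ob W \<and> B \<in> Ob W \<and> f \<in> Hom W A (fob M B)},
      Dom = Src, Cod = Tgt,
      Ide = (\<lambda>A. Arrow A (Eta M A) A),
      Cmp = (\<lambda>f g. Arrow (Src f) (Val f \<Zsemi>\<^bsub>W\<^esub> far M (Val g) \<Zsemi>\<^bsub>W\<^esub> Mu M (Tgt g)) (Tgt g)),
      Tens0 = (\<lambda>A B. A \<odot>\<^bsub>W\<^esub> B),
      Tens1 = (\<lambda>f g. Arrow (Src f \<odot>\<^bsub>W\<^esub> Src g)
                           ((Val f \<otimes>\<^bsub>W\<^esub> Val g) \<Zsemi>\<^bsub>W\<^esub> Nabla M (Tgt f) (Tgt g))
                           (Tgt f \<odot>\<^bsub>W\<^esub> Tgt g)),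
      Unt = Unt W,
      Asc = (\<lambda>A B D. kleisli_lift W M (Asc W A B D)),
      Lun = (\<lambda>A. kleisli_lift W M (Lun W A)),
      Run = (\<lambda>A. kleisli_lift W M (Run W A)),
      Sym = (\<lambda>A B. kleisli_lift W M (Sym W A B))\<rparr>"

definition kleisli_incl ::
    "('o, 'a, 'y) smoncat_scheme \<Rightarrow> ('o, 'a, 'z) monmonad_scheme \<Rightarrow>
     ('o, 'a, 'o, ('o, 'a) arrow) laxfun" where
  "kleisli_incl W M =
     \<lparr>fob = (\<lambda>A. A), far = kleisli_lift W M,
      eps = Ide (kleisli W M) (Unt W),
      tld = (\<lambda>A B. Ide (kleisli W M) (A \<odot>\<^bsub>W\<^esub> B))\<rparr>"


subsection \<open>Full strict monoidal subcategories, partial slices, change of base to categories\<close>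

definition full_subcategory :: "('o, 'a, 'z) cat_scheme \<Rightarrow> 'o set \<Rightarrow> ('o, 'a, 'z) cat_scheme" where
  "full_subcategory C U = C\<lparr>Ob := U, Arr := {f \<in> Arr C. Dom C f \<in> U \<and> Cod C f \<in> U}\<rparr>"

text \<open>A full subcategory is given by its set \<open>U\<close> of objects.\<close>

locale full_strict_monoidal_subcategory = monoidal_category W
  for W :: "('o, 'a, 'z) moncat_scheme" (structure) +
  fixes U :: "'o set"
  assumes sub_ob: "U \<subseteq> Ob W"
    and sub_unt: "Unt W \<in> U"
    and sub_tens: "A \<in> U \<Longrightarrow> B \<in> U \<Longrightarrow> A \<odot> B \<in> U"
    and sub_assoc: "A \<in> U \<Longrightarrow> B \<in> U \<Longrightarrow> D \<in> U \<Longrightarrow>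
      (A \<odot> B) \<odot> D = A \<odot> (B \<odot> D) \<and> Asc W A B D = Ide W (A \<odot> (B \<odot> D))"
    and sub_lun: "A \<in> U \<Longrightarrow> Unt W \<odot> A = A \<and> Lun W A = Ide W A"
    and sub_run: "A \<in> U \<Longrightarrow> A \<odot> Unt W = A \<and> Run W A = Ide W A"

definition slice_cat ::
    "('o, 'a, 'y) cat_scheme \<Rightarrow> ('o, 'a, 'z) cat_scheme \<Rightarrow> 'o \<Rightarrow>
     ('o \<times> 'a, ('o \<times> 'a, 'a) arrow) cat" where
  "slice_cat \<U> K A =
     \<lparr>Ob = {(u, f). u \<in> Ob \<U> \<and> f \<in> Hom K u A},
      Arr = {Arrow (u, f) \<phi> (v, g) | u f \<phi> v g.
               u \<in> Ob \<U> \<and> f \<in> Hom K u A \<and> v \<in> Ob \<U> \<and> g \<in> Hom K v A \<and>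
               \<phi> \<in> Hom \<U> u v \<and> f = \<phi> \<Zsemi>\<^bsub>K\<^esub> g},
      Dom = Src, Cod = Tgt,
      Ide = (\<lambda>(u, f). Arrow (u, f) (Ide \<U> u) (u, f)),
      Cmp = (\<lambda>\<alpha> \<beta>. Arrow (Src \<alpha>) (Val \<alpha> \<Zsemi>\<^bsub>\<U>\<^esub> Val \<beta>) (Tgt \<beta>))\<rparr>"

text \<open>
  Lax monoidal functors into the category of small categories with its Cartesian structure.
  These have a separate record because the product of two categories lives at a different HOL
  type than its factors. The unit comparison, a functor from the terminal category, is given
  by the object it picks out.
\<close>

record ('o, 'a, 'p, 'b) catfun =
  nob :: "'o \<Rightarrow> ('p, 'b) cat"
  nar :: "'a \<Rightarrow> ('p, 'b, 'p, 'b) funct"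
  neps :: "'p"
  ntld :: "'o \<Rightarrow> 'o \<Rightarrow> ('p \<times> 'p, 'b \<times> 'b, 'p, 'b) funct"

locale lax_monoidal_cat_functor = monoidal_category V
  for V :: "('o, 'a, 'z) moncat_scheme" (structure) +
  fixes N :: "('o, 'a, 'p, 'b) catfun"
  assumes nob_category: "A \<in> Ob V \<Longrightarrow> category (nob N A)"
    and nar_functor: "f \<in> Hom V A B \<Longrightarrow> category_functor (nob N A) (nob N B) (nar N f)"
    and nar_ide: "A \<in> Ob V \<Longrightarrow> functor_eq (nob N A) (nar N (Ide V A)) id_funct"
    and nar_cmp: "f \<in> Hom V A B \<Longrightarrow> g \<in> Hom V B D \<Longrightarrow>
      functor_eq (nob N A) (nar N (f \<Zsemi> g)) (comp_funct (nar N f) (nar N g))"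
    and neps_ob: "neps N \<in> Ob (nob N (Unt V))"
    and ntld_functor: "A \<in> Ob V \<Longrightarrow> B \<in> Ob V \<Longrightarrow>
      category_functor (prod_cat (nob N A) (nob N B)) (nob N (A \<odot> B)) (ntld N A B)"
    and ntld_natural: "f \<in> Hom V A A' \<Longrightarrow> g \<in> Hom V B B' \<Longrightarrow>
      functor_eq (prod_cat (nob N A) (nob N B))
        (comp_funct (prod_funct (nar N f) (nar N g)) (ntld N A' B'))
        (comp_funct (ntld N A B) (nar N (f \<otimes> g)))"
    and ntld_assoc: "A \<in> Ob V \<Longrightarrow> B \<in> Ob V \<Longrightarrow> D \<in> Ob V \<Longrightarrow>
      functor_eq (prod_cat (prod_cat (nob N A) (nob N B)) (nob N D))
        (comp_funct (comp_funct (prod_funct (ntld N A B) id_funct) (ntld N (A \<odot> B) D))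
                    (nar N (Asc V A B D)))
        (comp_funct \<lparr>fob = (\<lambda>((x, y), z). (x, (y, z))), far = (\<lambda>((f, g), h). (f, (g, h)))\<rparr>
          (comp_funct (prod_funct id_funct (ntld N B D)) (ntld N A (B \<odot> D))))"
    and ntld_lun: "A \<in> Ob V \<Longrightarrow>
      functor_eq (nob N A)
        (comp_funct
          (comp_funct \<lparr>fob = (\<lambda>x. (neps N, x)), far = (\<lambda>f. (Ide (nob N (Unt V)) (neps N), f))\<rparr>
                      (ntld N (Unt V) A))
          (nar N (Lun V A)))
        id_funct"
    and ntld_run: "A \<in> Ob V \<Longrightarrow>
      functor_eq (nob N A)
        (comp_funct
          (comp_funct \<lparr>fob = (\<lambda>x. (x, neps N)), far = (\<lambda>f. (f, Ide (nob N (Unt V)) (neps N)))\<rparr>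
                      (ntld N A (Unt V)))
          (nar N (Run V A)))
        id_funct"

definition partial_slice ::
    "('o, 'a, 'y) moncat_scheme \<Rightarrow> ('o, 'a, 'z) moncat_scheme \<Rightarrow>
     ('o, 'a, 'o \<times> 'a, ('o \<times> 'a, 'a) arrow) catfun" where
  "partial_slice \<U> K =
     \<lparr>nob = slice_cat \<U> K,
      nar = (\<lambda>h. \<lparr>fob = (\<lambda>(u, f). (u, f \<Zsemi>\<^bsub>K\<^esub> h)),
                  far = (\<lambda>\<alpha>. Arrow (fst (Src \<alpha>), snd (Src \<alpha>) \<Zsemi>\<^bsub>K\<^esub> h) (Val \<alpha>)
                                    (fst (Tgt \<alpha>), snd (Tgt \<alpha>) \<Zsemi>\<^bsub>K\<^esub> h))\<rparr>),
      neps = (Unt K, Ide K (Unt K)),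
      ntld = (\<lambda>A B. \<lparr>fob = (\<lambda>((u, f), (v, g)). (u \<odot>\<^bsub>K\<^esub> v, f \<otimes>\<^bsub>K\<^esub> g)),
                     far = (\<lambda>(\<alpha>, \<beta>).
                       Arrow (fst (Src \<alpha>) \<odot>\<^bsub>K\<^esub> fst (Src \<beta>), snd (Src \<alpha>) \<otimes>\<^bsub>K\<^esub> snd (Src \<beta>))
                             (Val \<alpha> \<otimes>\<^bsub>K\<^esub> Val \<beta>)
                             (fst (Tgt \<alpha>) \<odot>\<^bsub>K\<^esub> fst (Tgt \<beta>), snd (Tgt \<alpha>) \<otimes>\<^bsub>K\<^esub> snd (Tgt \<beta>)))\<rparr>)\<rparr>"

definition comp_catfun ::
    "('o, 'a, 'p, 'b, 'z) laxfun_scheme \<Rightarrow> ('p, 'b, 'q, 'c) catfun \<Rightarrow> ('o, 'a, 'q, 'c) catfun" where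
  "comp_catfun F N =
     \<lparr>nob = (\<lambda>A. nob N (fob F A)),
      nar = (\<lambda>f. nar N (far F f)),
      neps = fob (nar N (eps F)) (neps N),
      ntld = (\<lambda>A B. comp_funct (ntld N (fob F A) (fob F B)) (nar N (tld F A B)))\<rparr>"

definition slice_base ::
    "('p, 'b, 'y) smoncat_scheme \<Rightarrow> 'p set \<Rightarrow> ('p, 'b, 'z) monmonad_scheme \<Rightarrow>
     ('o, 'a, 'p, 'b, 'w) laxfun_scheme \<Rightarrow>
     ('o, 'a, 'p \<times> ('p, 'b) arrow, ('p \<times> ('p, 'b) arrow, ('p, 'b) arrow) arrow) catfun" where
  \<comment> \<open>the composite written \<open>(U/MF)\<close>\<close>
  "slice_base W U M F =
     comp_catfun (comp_laxfun (kleisli W M) F (kleisli_incl W M))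
                 (partial_slice (full_subcategory (kleisli W M) U) (kleisli W M))"


section \<open>Enriched categories\<close>

record ('x, 'o, 'a) ecat =
  EOb :: "'x set"
  EHom :: "'x \<Rightarrow> 'x \<Rightarrow> 'o"
  ECmp :: "'x \<Rightarrow> 'x \<Rightarrow> 'x \<Rightarrow> 'a"
  EId :: "'x \<Rightarrow> 'a"

locale enriched_category = monoidal_category V
  for V :: "('o, 'a, 'y) moncat_scheme" (structure) +
  fixes C :: "('x, 'o, 'a) ecat"
  assumes ehom_ob: "X \<in> EOb C \<Longrightarrow> Y \<in> EOb C \<Longrightarrow> EHom C X Y \<in> Ob V"
    and ecmp_hom: "X \<in> EOb C \<Longrightarrow> Y \<in> EOb C \<Longrightarrow> Z \<in> EOb C \<Longrightarrow>
      ECmp C X Y Z \<in> Hom V (EHom C X Y \<odot> EHom C Y Z) (EHom C X Z)"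
    and eid_hom: "X \<in> EOb C \<Longrightarrow> EId C X \<in> Hom V (Unt V) (EHom C X X)"
    and ecmp_assoc: "X \<in> EOb C \<Longrightarrow> Y \<in> EOb C \<Longrightarrow> Z \<in> EOb C \<Longrightarrow> T \<in> EOb C \<Longrightarrow>
      (ECmp C X Y Z \<otimes> Ide V (EHom C Z T)) \<Zsemi> ECmp C X Z T =
      Asc V (EHom C X Y) (EHom C Y Z) (EHom C Z T)
        \<Zsemi> (Ide V (EHom C X Y) \<otimes> ECmp C Y Z T) \<Zsemi> ECmp C X Y T"
    and eid_ecmp: "X \<in> EOb C \<Longrightarrow> Y \<in> EOb C \<Longrightarrow>
      (EId C X \<otimes> Ide V (EHom C X Y)) \<Zsemi> ECmp C X X Y = Lun V (EHom C X Y)"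
    and ecmp_eid: "X \<in> EOb C \<Longrightarrow> Y \<in> EOb C \<Longrightarrow>
      (Ide V (EHom C X Y) \<otimes> EId C Y) \<Zsemi> ECmp C X Y Y = Run V (EHom C X Y)"

record ('x, 'y, 'a) efun =
  eob :: "'x \<Rightarrow> 'y"
  ear :: "'x \<Rightarrow> 'x \<Rightarrow> 'a"

locale enriched_functor = C: enriched_category V C + D: enriched_category V D
  for V :: "('o, 'a, 'z) moncat_scheme" (structure)
    and C :: "('x, 'o, 'a) ecat" and D :: "('y, 'o, 'a) ecat" +
  fixes F :: "('x, 'y, 'a) efun"
  assumes eob_ob: "X \<in> EOb C \<Longrightarrow> eob F X \<in> EOb D"
    and ear_hom: "X \<in> EOb C \<Longrightarrow> Y \<in> EOb C \<Longrightarrow>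
      ear F X Y \<in> Hom V (EHom C X Y) (EHom D (eob F X) (eob F Y))"
    and ear_cmp: "X \<in> EOb C \<Longrightarrow> Y \<in> EOb C \<Longrightarrow> Z \<in> EOb C \<Longrightarrow>
      ECmp C X Y Z \<Zsemi> ear F X Z =
      (ear F X Y \<otimes> ear F Y Z) \<Zsemi> ECmp D (eob F X) (eob F Y) (eob F Z)"
    and ear_id: "X \<in> EOb C \<Longrightarrow> EId C X \<Zsemi> ear F X X = EId D (eob F X)"

locale enriched_natural = F: enriched_functor V C D F + G: enriched_functor V C D G
  for V :: "('o, 'a, 'z) moncat_scheme" (structure)
    and C :: "('x, 'o, 'a) ecat" and D :: "('y, 'o, 'a) ecat"
    and F :: "('x, 'y, 'a) efun" and G :: "('x, 'y, 'a) efun" +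
  fixes t :: "'x \<Rightarrow> 'a"
  assumes ecomponent_hom: "X \<in> EOb C \<Longrightarrow> t X \<in> Hom V (Unt V) (EHom D (eob F X) (eob G X))"
    and enaturality: "X \<in> EOb C \<Longrightarrow> Y \<in> EOb C \<Longrightarrow>
      inverse_of V (Lun V (EHom C X Y)) \<Zsemi> (t X \<otimes> ear G X Y)
        \<Zsemi> ECmp D (eob F X) (eob G X) (eob G Y) =
      inverse_of V (Run V (EHom C X Y)) \<Zsemi> (ear F X Y \<otimes> t Y)
        \<Zsemi> ECmp D (eob F X) (eob F Y) (eob G Y)"

definition tensor_ecat ::
    "('o, 'a, 'z) smoncat_scheme \<Rightarrow> ('x, 'o, 'a) ecat \<Rightarrow> ('y, 'o, 'a) ecat \<Rightarrow> ('x \<times> 'y, 'o, 'a) ecat" where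
  "tensor_ecat V C D =
     \<lparr>EOb = EOb C \<times> EOb D,
      EHom = (\<lambda>(X1, X2) (Y1, Y2). EHom C X1 Y1 \<odot>\<^bsub>V\<^esub> EHom D X2 Y2),
      ECmp = (\<lambda>(X1, X2) (Y1, Y2) (Z1, Z2).
        middle_swap V (EHom C X1 Y1) (EHom D X2 Y2) (EHom C Y1 Z1) (EHom D Y2 Z2)
          \<Zsemi>\<^bsub>V\<^esub> (ECmp C X1 Y1 Z1 \<otimes>\<^bsub>V\<^esub> ECmp D X2 Y2 Z2)),
      EId = (\<lambda>(X1, X2). inverse_of V (Lun V (Unt V)) \<Zsemi>\<^bsub>V\<^esub> (EId C X1 \<otimes>\<^bsub>V\<^esub> EId D X2))\<rparr>"

definition id_efun :: "('o, 'a, 'z) cat_scheme \<Rightarrow> ('x, 'o, 'a) ecat \<Rightarrow> ('x, 'x, 'a) efun" where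
  "id_efun V C = \<lparr>eob = (\<lambda>X. X), ear = (\<lambda>X Y. Ide V (EHom C X Y))\<rparr>"

definition comp_efun ::
    "('o, 'a, 'z) cat_scheme \<Rightarrow> ('x, 'y, 'a) efun \<Rightarrow> ('y, 'w, 'a) efun \<Rightarrow> ('x, 'w, 'a) efun" where
  "comp_efun V F G =
     \<lparr>eob = (\<lambda>X. eob G (eob F X)),
      ear = (\<lambda>X Y. ear F X Y \<Zsemi>\<^bsub>V\<^esub> ear G (eob F X) (eob F Y))\<rparr>"

definition tensor_efun ::
    "('o, 'a, 'z) moncat_scheme \<Rightarrow> ('x, 'y, 'a) efun \<Rightarrow> ('v, 'w, 'a) efun \<Rightarrow>
     ('x \<times> 'v, 'y \<times> 'w, 'a) efun" where
  "tensor_efun V F G =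
     \<lparr>eob = (\<lambda>(X1, X2). (eob F X1, eob G X2)),
      ear = (\<lambda>(X1, X2) (Y1, Y2). ear F X1 Y1 \<otimes>\<^bsub>V\<^esub> ear G X2 Y2)\<rparr>"

definition asc_efun ::
    "('o, 'a, 'z) moncat_scheme \<Rightarrow> ('x, 'o, 'a) ecat \<Rightarrow> ('y, 'o, 'a) ecat \<Rightarrow> ('w, 'o, 'a) ecat \<Rightarrow>
     (('x \<times> 'y) \<times> 'w, 'x \<times> ('y \<times> 'w), 'a) efun" where
  "asc_efun V B C D =
     \<lparr>eob = (\<lambda>((X1, X2), X3). (X1, (X2, X3))),
      ear = (\<lambda>((X1, X2), X3) ((Y1, Y2), Y3).
        Asc V (EHom B X1 Y1) (EHom C X2 Y2) (EHom D X3 Y3))\<rparr>"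

definition swap_efun ::
    "('o, 'a, 'z) smoncat_scheme \<Rightarrow> ('x, 'o, 'a) ecat \<Rightarrow> ('y, 'o, 'a) ecat \<Rightarrow> ('x \<times> 'y, 'y \<times> 'x, 'a) efun" where
  "swap_efun V C D =
     \<lparr>eob = (\<lambda>(X1, X2). (X2, X1)),
      ear = (\<lambda>(X1, X2) (Y1, Y2). Sym V (EHom C X1 Y1) (EHom D X2 Y2))\<rparr>"

text \<open>The enriched functors \<open>X \<mapsto> (J, X)\<close> and \<open>X \<mapsto> (X, J)\<close> for a fixed object \<open>J\<close>.\<close>

definition linsert_efun ::
    "('o, 'a, 'z) moncat_scheme \<Rightarrow> ('x, 'o, 'a) ecat \<Rightarrow> 'x \<Rightarrow> ('x, 'x \<times> 'x, 'a) efun" where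
  "linsert_efun V C J =
     \<lparr>eob = (\<lambda>X. (J, X)),
      ear = (\<lambda>X Y. inverse_of V (Lun V (EHom C X Y)) \<Zsemi>\<^bsub>V\<^esub> (EId C J \<otimes>\<^bsub>V\<^esub> Ide V (EHom C X Y)))\<rparr>"

definition rinsert_efun ::
    "('o, 'a, 'z) moncat_scheme \<Rightarrow> ('x, 'o, 'a) ecat \<Rightarrow> 'x \<Rightarrow> ('x, 'x \<times> 'x, 'a) efun" where
  "rinsert_efun V C J =
     \<lparr>eob = (\<lambda>X. (X, J)),
      ear = (\<lambda>X Y. inverse_of V (Run V (EHom C X Y)) \<Zsemi>\<^bsub>V\<^esub> (Ide V (EHom C X Y) \<otimes>\<^bsub>V\<^esub> EId C J))\<rparr>"

record ('x, 'a) emon =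
  EBox :: "('x \<times> 'x, 'x, 'a) efun"
  EUnt :: "'x"
  EAsc :: "'x \<Rightarrow> 'x \<Rightarrow> 'x \<Rightarrow> 'a"
  ERun :: "'x \<Rightarrow> 'a"
  ELun :: "'x \<Rightarrow> 'a"

definition underlying_category ::
    "('o, 'a, 'z) moncat_scheme \<Rightarrow> ('x, 'o, 'a) ecat \<Rightarrow> ('x, ('x, 'a) arrow) cat" where
  "underlying_category V C =
     \<lparr>Ob = EOb C,
      Arr = {Arrow X f Y | X f Y. X \<in> EOb C \<and> Y \<in> EOb C \<and> f \<in> Hom V (Unt V) (EHom C X Y)},
      Dom = Src, Cod = Tgt,
      Ide = (\<lambda>X. Arrow X (EId C X) X),
      Cmp = (\<lambda>f g. Arrow (Src f)
        (inverse_of V (Lun V (Unt V)) \<Zsemi>\<^bsub>V\<^esub> (Val f \<otimes>\<^bsub>V\<^esub> Val g) \<Zsemi>\<^bsub>V\<^esub> ECmp C (Src f) (Tgt f) (Tgt g))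
        (Tgt g))\<rparr>"

definition underlying_moncat ::
    "('o, 'a, 'z) moncat_scheme \<Rightarrow> ('x, 'o, 'a) ecat \<Rightarrow> ('x, 'a) emon \<Rightarrow> ('x, ('x, 'a) arrow) moncat" where
  "underlying_moncat V C B =
     (let box = (\<lambda>X Y. eob (EBox B) (X, Y)) in
      cat.extend (underlying_category V C)
        (moncat.fields
          box
          (\<lambda>f g. Arrow (box (Src f) (Src g))
             (inverse_of V (Lun V (Unt V)) \<Zsemi>\<^bsub>V\<^esub> (Val f \<otimes>\<^bsub>V\<^esub> Val g)
                \<Zsemi>\<^bsub>V\<^esub> ear (EBox B) (Src f, Src g) (Tgt f, Tgt g))
             (box (Tgt f) (Tgt g)))
          (EUnt B)
          (\<lambda>X Y Z. Arrow (box (box X Y) Z) (EAsc B X Y Z) (box X (box Y Z)))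
          (\<lambda>X. Arrow (box (EUnt B) X) (ELun B X) X)
          (\<lambda>X. Arrow (box X (EUnt B)) (ERun B X) X)))"

locale monoidal_enriched_category = V: symmetric_monoidal_category V + C: enriched_category V C
  for V :: "('o, 'a, 'z) smoncat_scheme" (structure) and C :: "('x, 'o, 'a) ecat" +
  fixes B :: "('x, 'a) emon"
  assumes box_functor: "enriched_functor V (tensor_ecat V C C) C (EBox B)"
    and eunt_ob: "EUnt B \<in> EOb C"
    and easc_natural: "enriched_natural V (tensor_ecat V (tensor_ecat V C C) C) C
      (comp_efun V (tensor_efun V (EBox B) (id_efun V C)) (EBox B))
      (comp_efun V (asc_efun V C C C) (comp_efun V (tensor_efun V (id_efun V C) (EBox B)) (EBox B)))
      (\<lambda>((X, Y), Z). EAsc B X Y Z)"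
    and erun_natural: "enriched_natural V C C
      (comp_efun V (rinsert_efun V C (EUnt B)) (EBox B)) (id_efun V C) (ERun B)"
    and elun_natural: "enriched_natural V C C
      (comp_efun V (linsert_efun V C (EUnt B)) (EBox B)) (id_efun V C) (ELun B)"
    \<comment> \<open>this includes the invertibility of the associator and the unitors\<close>
    and underlying_monoidal: "monoidal_category (underlying_moncat V C B)"

locale symmetric_monoidal_enriched_category = monoidal_enriched_category V C B
  for V :: "('o, 'a, 'z) smoncat_scheme" (structure) and C :: "('x, 'o, 'a) ecat"
    and B :: "('x, 'a) emon" +
  fixes s :: "'x \<Rightarrow> 'x \<Rightarrow> 'a"
  assumes esym_natural: "enriched_natural V (tensor_ecat V C C) C
      (EBox B) (comp_efun V (swap_efun V C C) (EBox B)) (\<lambda>(X, Y). s X Y)"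
    and underlying_symmetric: "symmetry (underlying_moncat V C B)
      (\<lambda>X Y. Arrow (eob (EBox B) (X, Y)) (s X Y) (eob (EBox B) (Y, X)))"


section \<open>Strict 2-categories and pseudofunctors\<close>

text \<open>
  A 2-category is a category enriched in small categories: \<open>HomC D X Y\<close> is the hom-category,
  with the 1-cells as objects, the 2-cells as arrows and vertical composition;
  \<open>HComp D X Y Z\<close> is the horizontal composition functor.
\<close>

record ('x, 'p, 'q) two_cat =
  Cell0 :: "'x set"
  HomC :: "'x \<Rightarrow> 'x \<Rightarrow> ('p, 'q) cat"
  HComp :: "'x \<Rightarrow> 'x \<Rightarrow> 'x \<Rightarrow> ('p \<times> 'p, 'q \<times> 'q, 'p, 'q) funct"
  Id1 :: "'x \<Rightarrow> 'p"

abbreviation Cell1 :: "('x, 'p, 'q) two_cat \<Rightarrow> 'x \<Rightarrow> 'x \<Rightarrow> 'p set" where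
  "Cell1 D X Y \<equiv> Ob (HomC D X Y)"

abbreviation Cell2 :: "('x, 'p, 'q) two_cat \<Rightarrow> 'x \<Rightarrow> 'x \<Rightarrow> 'p \<Rightarrow> 'p \<Rightarrow> 'q set" where
  "Cell2 D X Y f g \<equiv> Hom (HomC D X Y) f g"

abbreviation VComp :: "('x, 'p, 'q) two_cat \<Rightarrow> 'x \<Rightarrow> 'x \<Rightarrow> 'q \<Rightarrow> 'q \<Rightarrow> 'q" where
  "VComp D X Y \<alpha> \<beta> \<equiv> \<alpha> \<Zsemi>\<^bsub>HomC D X Y\<^esub> \<beta>"

abbreviation Id2 :: "('x, 'p, 'q) two_cat \<Rightarrow> 'x \<Rightarrow> 'x \<Rightarrow> 'p \<Rightarrow> 'q" where
  "Id2 D X Y f \<equiv> Ide (HomC D X Y) f"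

abbreviation HComp1 :: "('x, 'p, 'q) two_cat \<Rightarrow> 'x \<Rightarrow> 'x \<Rightarrow> 'x \<Rightarrow> 'p \<Rightarrow> 'p \<Rightarrow> 'p" where
  "HComp1 D X Y Z f g \<equiv> fob (HComp D X Y Z) (f, g)"

abbreviation HComp2 :: "('x, 'p, 'q) two_cat \<Rightarrow> 'x \<Rightarrow> 'x \<Rightarrow> 'x \<Rightarrow> 'q \<Rightarrow> 'q \<Rightarrow> 'q" where
  "HComp2 D X Y Z \<alpha> \<beta> \<equiv> far (HComp D X Y Z) (\<alpha>, \<beta>)"

locale two_category =
  fixes D :: "('x, 'p, 'q) two_cat"
  assumes hom_category: "X \<in> Cell0 D \<Longrightarrow> Y \<in> Cell0 D \<Longrightarrow> category (HomC D X Y)"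
    and hcomp_functor: "X \<in> Cell0 D \<Longrightarrow> Y \<in> Cell0 D \<Longrightarrow> Z \<in> Cell0 D \<Longrightarrow>
      category_functor (prod_cat (HomC D X Y) (HomC D Y Z)) (HomC D X Z) (HComp D X Y Z)"
    and id1_cell: "X \<in> Cell0 D \<Longrightarrow> Id1 D X \<in> Cell1 D X X"
    and hcomp1_assoc: "X \<in> Cell0 D \<Longrightarrow> Y \<in> Cell0 D \<Longrightarrow> Z \<in> Cell0 D \<Longrightarrow> T \<in> Cell0 D \<Longrightarrow>
      f \<in> Cell1 D X Y \<Longrightarrow> g \<in> Cell1 D Y Z \<Longrightarrow> h \<in> Cell1 D Z T \<Longrightarrow>
      HComp1 D X Z T (HComp1 D X Y Z f g) h = HComp1 D X Y T f (HComp1 D Y Z T g h)"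
    and hcomp2_assoc: "X \<in> Cell0 D \<Longrightarrow> Y \<in> Cell0 D \<Longrightarrow> Z \<in> Cell0 D \<Longrightarrow> T \<in> Cell0 D \<Longrightarrow>
      \<alpha> \<in> Arr (HomC D X Y) \<Longrightarrow> \<beta> \<in> Arr (HomC D Y Z) \<Longrightarrow> \<gamma> \<in> Arr (HomC D Z T) \<Longrightarrow>
      HComp2 D X Z T (HComp2 D X Y Z \<alpha> \<beta>) \<gamma> = HComp2 D X Y T \<alpha> (HComp2 D Y Z T \<beta> \<gamma>)"
    and id1_hcomp1: "X \<in> Cell0 D \<Longrightarrow> Y \<in> Cell0 D \<Longrightarrow> f \<in> Cell1 D X Y \<Longrightarrow>
      HComp1 D X X Y (Id1 D X) f = f"
    and id1_hcomp2: "X \<in> Cell0 D \<Longrightarrow> Y \<in> Cell0 D \<Longrightarrow> \<alpha> \<in> Arr (HomC D X Y) \<Longrightarrow>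
      HComp2 D X X Y (Id2 D X X (Id1 D X)) \<alpha> = \<alpha>"
    and hcomp1_id1: "X \<in> Cell0 D \<Longrightarrow> Y \<in> Cell0 D \<Longrightarrow> f \<in> Cell1 D X Y \<Longrightarrow>
      HComp1 D X Y Y f (Id1 D Y) = f"
    and hcomp2_id1: "X \<in> Cell0 D \<Longrightarrow> Y \<in> Cell0 D \<Longrightarrow> \<alpha> \<in> Arr (HomC D X Y) \<Longrightarrow>
      HComp2 D X Y Y \<alpha> (Id2 D Y Y (Id1 D Y)) = \<alpha>"

definition change_of_base ::
    "('o, 'a, 'p, 'b) catfun \<Rightarrow> ('x, 'o, 'a) ecat \<Rightarrow> ('x, 'p, 'b) two_cat" where
  "change_of_base N C =
     \<lparr>Cell0 = EOb C,
      HomC = (\<lambda>X Y. nob N (EHom C X Y)),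
      HComp = (\<lambda>X Y Z. comp_funct (ntld N (EHom C X Y) (EHom C Y Z)) (nar N (ECmp C X Y Z))),
      Id1 = (\<lambda>X. fob (nar N (EId C X)) (neps N))\<rparr>"

definition prod_two_cat ::
    "('x, 'p, 'q) two_cat \<Rightarrow> ('y, 'r, 's) two_cat \<Rightarrow> ('x \<times> 'y, 'p \<times> 'r, 'q \<times> 's) two_cat" where
  "prod_two_cat C D =
     \<lparr>Cell0 = Cell0 C \<times> Cell0 D,
      HomC = (\<lambda>(X1, X2) (Y1, Y2). prod_cat (HomC C X1 Y1) (HomC D X2 Y2)),
      HComp = (\<lambda>(X1, X2) (Y1, Y2) (Z1, Z2).
        \<lparr>fob = (\<lambda>((f1, f2), (g1, g2)). (HComp1 C X1 Y1 Z1 f1 g1, HComp1 D X2 Y2 Z2 f2 g2)),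
         far = (\<lambda>((\<alpha>1, \<alpha>2), (\<beta>1, \<beta>2)).
                 (HComp2 C X1 Y1 Z1 \<alpha>1 \<beta>1, HComp2 D X2 Y2 Z2 \<alpha>2 \<beta>2))\<rparr>),
      Id1 = (\<lambda>(X1, X2). (Id1 C X1, Id1 D X2))\<rparr>"

text \<open>
  Pseudofunctors: \<open>pcomp P X Y Z f g : P f ; P g \<Rightarrow> P (f ; g)\<close> and
  \<open>punit P X : id (P X) \<Rightarrow> P (id X)\<close> are the structure 2-cells.
\<close>

record ('x, 'p, 'q, 'y, 'r, 's) pfun =
  pob :: "'x \<Rightarrow> 'y"
  phom :: "'x \<Rightarrow> 'x \<Rightarrow> ('p, 'q, 'r, 's) funct"
  pcomp :: "'x \<Rightarrow> 'x \<Rightarrow> 'x \<Rightarrow> 'p \<Rightarrow> 'p \<Rightarrow> 's"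
  punit :: "'x \<Rightarrow> 's"

abbreviation par1 :: "('x, 'p, 'q, 'y, 'r, 's) pfun \<Rightarrow> 'x \<Rightarrow> 'x \<Rightarrow> 'p \<Rightarrow> 'r" where
  "par1 P X Y f \<equiv> fob (phom P X Y) f"

abbreviation par2 :: "('x, 'p, 'q, 'y, 'r, 's) pfun \<Rightarrow> 'x \<Rightarrow> 'x \<Rightarrow> 'q \<Rightarrow> 's" where
  "par2 P X Y \<alpha> \<equiv> far (phom P X Y) \<alpha>"

locale pseudofunctor = C: two_category C + D: two_category D
  for C :: "('x, 'p, 'q) two_cat" and D :: "('y, 'r, 's) two_cat" +
  fixes P :: "('x, 'p, 'q, 'y, 'r, 's) pfun"
  assumes pob_cell: "X \<in> Cell0 C \<Longrightarrow> pob P X \<in> Cell0 D"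
    and phom_functor: "X \<in> Cell0 C \<Longrightarrow> Y \<in> Cell0 C \<Longrightarrow>
      category_functor (HomC C X Y) (HomC D (pob P X) (pob P Y)) (phom P X Y)"
    and pcomp_cell: "X \<in> Cell0 C \<Longrightarrow> Y \<in> Cell0 C \<Longrightarrow> Z \<in> Cell0 C \<Longrightarrow>
      f \<in> Cell1 C X Y \<Longrightarrow> g \<in> Cell1 C Y Z \<Longrightarrow>
      pcomp P X Y Z f g \<in> Cell2 D (pob P X) (pob P Z)
        (HComp1 D (pob P X) (pob P Y) (pob P Z) (par1 P X Y f) (par1 P Y Z g))
        (par1 P X Z (HComp1 C X Y Z f g))"
    and pcomp_iso: "X \<in> Cell0 C \<Longrightarrow> Y \<in> Cell0 C \<Longrightarrow> Z \<in> Cell0 C \<Longrightarrow>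
      f \<in> Cell1 C X Y \<Longrightarrow> g \<in> Cell1 C Y Z \<Longrightarrow>
      iso (HomC D (pob P X) (pob P Z)) (pcomp P X Y Z f g)"
    and pcomp_natural: "X \<in> Cell0 C \<Longrightarrow> Y \<in> Cell0 C \<Longrightarrow> Z \<in> Cell0 C \<Longrightarrow>
      \<alpha> \<in> Cell2 C X Y f f' \<Longrightarrow> \<beta> \<in> Cell2 C Y Z g g' \<Longrightarrow>
      VComp D (pob P X) (pob P Z)
        (HComp2 D (pob P X) (pob P Y) (pob P Z) (par2 P X Y \<alpha>) (par2 P Y Z \<beta>))
        (pcomp P X Y Z f' g') =
      VComp D (pob P X) (pob P Z)
        (pcomp P X Y Z f g)
        (par2 P X Z (HComp2 C X Y Z \<alpha> \<beta>))"
    and punit_cell: "X \<in> Cell0 C \<Longrightarrow>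
      punit P X \<in> Cell2 D (pob P X) (pob P X) (Id1 D (pob P X)) (par1 P X X (Id1 C X))"
    and punit_iso: "X \<in> Cell0 C \<Longrightarrow> iso (HomC D (pob P X) (pob P X)) (punit P X)"
    and pcomp_assoc: "X \<in> Cell0 C \<Longrightarrow> Y \<in> Cell0 C \<Longrightarrow> Z \<in> Cell0 C \<Longrightarrow> T \<in> Cell0 C \<Longrightarrow>
      f \<in> Cell1 C X Y \<Longrightarrow> g \<in> Cell1 C Y Z \<Longrightarrow> h \<in> Cell1 C Z T \<Longrightarrow>
      VComp D (pob P X) (pob P T)
        (HComp2 D (pob P X) (pob P Z) (pob P T)
          (pcomp P X Y Z f g) (Id2 D (pob P Z) (pob P T) (par1 P Z T h)))
        (pcomp P X Z T (HComp1 C X Y Z f g) h) =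
      VComp D (pob P X) (pob P T)
        (HComp2 D (pob P X) (pob P Y) (pob P T)
          (Id2 D (pob P X) (pob P Y) (par1 P X Y f)) (pcomp P Y Z T g h))
        (pcomp P X Y T f (HComp1 C Y Z T g h))"
    and punit_pcomp: "X \<in> Cell0 C \<Longrightarrow> Y \<in> Cell0 C \<Longrightarrow> f \<in> Cell1 C X Y \<Longrightarrow>
      VComp D (pob P X) (pob P Y)
        (HComp2 D (pob P X) (pob P X) (pob P Y)
          (punit P X) (Id2 D (pob P X) (pob P Y) (par1 P X Y f)))
        (pcomp P X X Y (Id1 C X) f) =
      Id2 D (pob P X) (pob P Y) (par1 P X Y f)"
    and pcomp_punit: "X \<in> Cell0 C \<Longrightarrow> Y \<in> Cell0 C \<Longrightarrow> f \<in> Cell1 C X Y \<Longrightarrow>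
      VComp D (pob P X) (pob P Y)
        (HComp2 D (pob P X) (pob P Y) (pob P Y)
          (Id2 D (pob P X) (pob P Y) (par1 P X Y f)) (punit P Y))
        (pcomp P X Y Y f (Id1 C Y)) =
      Id2 D (pob P X) (pob P Y) (par1 P X Y f)"

definition strict_pfun ::
    "('x, 'p, 'q) two_cat \<Rightarrow> ('y, 'r, 's) two_cat \<Rightarrow> ('x \<Rightarrow> 'y) \<Rightarrow>
     ('x \<Rightarrow> 'x \<Rightarrow> ('p, 'q, 'r, 's) funct) \<Rightarrow> ('x, 'p, 'q, 'y, 'r, 's) pfun" where
  \<comment> \<open>a 2-functor as a pseudofunctor, with identities as structure 2-cells\<close>
  "strict_pfun C D P0 PH =
     \<lparr>pob = P0, phom = PH,
      pcomp = (\<lambda>X Y Z f g. Id2 D (P0 X) (P0 Z) (fob (PH X Z) (HComp1 C X Y Z f g))),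
      punit = (\<lambda>X. Id2 D (P0 X) (P0 X) (Id1 D (P0 X)))\<rparr>"

definition id_pfun :: "('x, 'p, 'q) two_cat \<Rightarrow> ('x, 'p, 'q, 'x, 'p, 'q) pfun" where
  "id_pfun C = strict_pfun C C (\<lambda>X. X) (\<lambda>X Y. id_funct)"

definition asc_pfun ::
    "('x, 'p, 'q) two_cat \<Rightarrow>
     (('x \<times> 'x) \<times> 'x, ('p \<times> 'p) \<times> 'p, ('q \<times> 'q) \<times> 'q, 'x \<times> ('x \<times> 'x), 'p \<times> ('p \<times> 'p), 'q \<times> ('q \<times> 'q)) pfun" where
  "asc_pfun C =
     strict_pfun (prod_two_cat (prod_two_cat C C) C) (prod_two_cat C (prod_two_cat C C))
       (\<lambda>((X1, X2), X3). (X1, (X2, X3)))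
       (\<lambda>X Y. \<lparr>fob = (\<lambda>((f1, f2), f3). (f1, (f2, f3))), far = (\<lambda>((\<alpha>1, \<alpha>2), \<alpha>3). (\<alpha>1, (\<alpha>2, \<alpha>3)))\<rparr>)"

definition swap_pfun ::
    "('x, 'p, 'q) two_cat \<Rightarrow> ('x \<times> 'x, 'p \<times> 'p, 'q \<times> 'q, 'x \<times> 'x, 'p \<times> 'p, 'q \<times> 'q) pfun" where
  "swap_pfun C =
     strict_pfun (prod_two_cat C C) (prod_two_cat C C)
       (\<lambda>(X1, X2). (X2, X1))
       (\<lambda>X Y. \<lparr>fob = (\<lambda>(f1, f2). (f2, f1)), far = (\<lambda>(\<alpha>1, \<alpha>2). (\<alpha>2, \<alpha>1))\<rparr>)"

definition linsert_pfun ::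
    "('x, 'p, 'q) two_cat \<Rightarrow> 'x \<Rightarrow> ('x, 'p, 'q, 'x \<times> 'x, 'p \<times> 'p, 'q \<times> 'q) pfun" where
  "linsert_pfun C J =
     strict_pfun C (prod_two_cat C C) (\<lambda>X. (J, X))
       (\<lambda>X Y. \<lparr>fob = (\<lambda>f. (Id1 C J, f)), far = (\<lambda>\<alpha>. (Id2 C J J (Id1 C J), \<alpha>))\<rparr>)"

definition rinsert_pfun ::
    "('x, 'p, 'q) two_cat \<Rightarrow> 'x \<Rightarrow> ('x, 'p, 'q, 'x \<times> 'x, 'p \<times> 'p, 'q \<times> 'q) pfun" where
  "rinsert_pfun C J =
     strict_pfun C (prod_two_cat C C) (\<lambda>X. (X, J))
       (\<lambda>X Y. \<lparr>fob = (\<lambda>f. (f, Id1 C J)), far = (\<lambda>\<alpha>. (\<alpha>, Id2 C J J (Id1 C J)))\<rparr>)"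

text \<open>The argument \<open>E\<close> is the codomain of the second pseudofunctor.\<close>

definition comp_pfun ::
    "('z, 't, 'u) two_cat \<Rightarrow> ('x, 'p, 'q, 'y, 'r, 's) pfun \<Rightarrow> ('y, 'r, 's, 'z, 't, 'u) pfun \<Rightarrow>
     ('x, 'p, 'q, 'z, 't, 'u) pfun" where
  "comp_pfun E P Q =
     \<lparr>pob = (\<lambda>X. pob Q (pob P X)),
      phom = (\<lambda>X Y. comp_funct (phom P X Y) (phom Q (pob P X) (pob P Y))),
      pcomp = (\<lambda>X Y Z f g.
        VComp E (pob Q (pob P X)) (pob Q (pob P Z))
          (pcomp Q (pob P X) (pob P Y) (pob P Z) (par1 P X Y f) (par1 P Y Z g))
          (par2 Q (pob P X) (pob P Z) (pcomp P X Y Z f g))),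
      punit = (\<lambda>X.
        VComp E (pob Q (pob P X)) (pob Q (pob P X))
          (punit Q (pob P X))
          (par2 Q (pob P X) (pob P X) (punit P X)))\<rparr>"

definition prod_pfun ::
    "('x, 'p, 'q, 'y, 'r, 's) pfun \<Rightarrow> ('x', 'p', 'q', 'y', 'r', 's') pfun \<Rightarrow>
     ('x \<times> 'x', 'p \<times> 'p', 'q \<times> 'q', 'y \<times> 'y', 'r \<times> 'r', 's \<times> 's') pfun" where
  "prod_pfun P Q =
     \<lparr>pob = (\<lambda>(X1, X2). (pob P X1, pob Q X2)),
      phom = (\<lambda>(X1, X2) (Y1, Y2). prod_funct (phom P X1 Y1) (phom Q X2 Y2)),
      pcomp = (\<lambda>(X1, X2) (Y1, Y2) (Z1, Z2) (f1, f2) (g1, g2).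
        (pcomp P X1 Y1 Z1 f1 g1, pcomp Q X2 Y2 Z2 f2 g2)),
      punit = (\<lambda>(X1, X2). (punit P X1, punit Q X2))\<rparr>"

text \<open>
  Pseudonatural transformations: the structure 2-cell at a 1-cell \<open>f\<close> from \<open>X\<close> to \<open>Y\<close> is
  \<open>pn2 t X Y f : P f ; t Y \<Rightarrow> t X ; Q f\<close>.
\<close>

record ('x, 'p, 'r, 's) pnat =
  pn1 :: "'x \<Rightarrow> 'r"
  pn2 :: "'x \<Rightarrow> 'x \<Rightarrow> 'p \<Rightarrow> 's"

locale pseudonatural = P: pseudofunctor C D P + Q: pseudofunctor C D Q
  for C :: "('x, 'p, 'q) two_cat" and D :: "('y, 'r, 's) two_cat"
    and P :: "('x, 'p, 'q, 'y, 'r, 's) pfun" and Q :: "('x, 'p, 'q, 'y, 'r, 's) pfun" +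
  fixes t :: "('x, 'p, 'r, 's) pnat"
  assumes pn1_cell: "X \<in> Cell0 C \<Longrightarrow> pn1 t X \<in> Cell1 D (pob P X) (pob Q X)"
    and pn2_cell: "X \<in> Cell0 C \<Longrightarrow> Y \<in> Cell0 C \<Longrightarrow> f \<in> Cell1 C X Y \<Longrightarrow>
      pn2 t X Y f \<in> Cell2 D (pob P X) (pob Q Y)
        (HComp1 D (pob P X) (pob P Y) (pob Q Y) (par1 P X Y f) (pn1 t Y))
        (HComp1 D (pob P X) (pob Q X) (pob Q Y) (pn1 t X) (par1 Q X Y f))"
    and pn2_iso: "X \<in> Cell0 C \<Longrightarrow> Y \<in> Cell0 C \<Longrightarrow> f \<in> Cell1 C X Y \<Longrightarrow>
      iso (HomC D (pob P X) (pob Q Y)) (pn2 t X Y f)"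
    and pn2_natural: "X \<in> Cell0 C \<Longrightarrow> Y \<in> Cell0 C \<Longrightarrow> \<alpha> \<in> Cell2 C X Y f g \<Longrightarrow>
      VComp D (pob P X) (pob Q Y)
        (HComp2 D (pob P X) (pob P Y) (pob Q Y)
          (par2 P X Y \<alpha>) (Id2 D (pob P Y) (pob Q Y) (pn1 t Y)))
        (pn2 t X Y g) =
      VComp D (pob P X) (pob Q Y)
        (pn2 t X Y f)
        (HComp2 D (pob P X) (pob Q X) (pob Q Y)
          (Id2 D (pob P X) (pob Q X) (pn1 t X)) (par2 Q X Y \<alpha>))"
    and pn2_unit: "X \<in> Cell0 C \<Longrightarrow>
      VComp D (pob P X) (pob Q X)
        (HComp2 D (pob P X) (pob P X) (pob Q X)
          (punit P X) (Id2 D (pob P X) (pob Q X) (pn1 t X)))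
        (pn2 t X X (Id1 C X)) =
      HComp2 D (pob P X) (pob Q X) (pob Q X)
        (Id2 D (pob P X) (pob Q X) (pn1 t X)) (punit Q X)"
    and pn2_comp: "X \<in> Cell0 C \<Longrightarrow> Y \<in> Cell0 C \<Longrightarrow> Z \<in> Cell0 C \<Longrightarrow>
      f \<in> Cell1 C X Y \<Longrightarrow> g \<in> Cell1 C Y Z \<Longrightarrow>
      VComp D (pob P X) (pob Q Z)
        (HComp2 D (pob P X) (pob P Z) (pob Q Z)
          (pcomp P X Y Z f g) (Id2 D (pob P Z) (pob Q Z) (pn1 t Z)))
        (pn2 t X Z (HComp1 C X Y Z f g)) =
      VComp D (pob P X) (pob Q Z)
        (VComp D (pob P X) (pob Q Z)
          (HComp2 D (pob P X) (pob P Y) (pob Q Z)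
            (Id2 D (pob P X) (pob P Y) (par1 P X Y f)) (pn2 t Y Z g))
          (HComp2 D (pob P X) (pob Q Y) (pob Q Z)
            (pn2 t X Y f) (Id2 D (pob Q Y) (pob Q Z) (par1 Q Y Z g))))
        (HComp2 D (pob P X) (pob Q X) (pob Q Z)
          (Id2 D (pob P X) (pob Q X) (pn1 t X)) (pcomp Q X Y Z f g))"

text \<open>
  Strict (2-)naturality is pseudonaturality with identity structure 2-cells, so it also asserts
  compatibility with the structure 2-cells of the two pseudofunctors.
\<close>

definition strictly_natural ::
    "('x, 'p, 'q) two_cat \<Rightarrow> ('y, 'r, 's) two_cat \<Rightarrow> ('x, 'p, 'q, 'y, 'r, 's) pfun \<Rightarrow>
     ('x, 'p, 'q, 'y, 'r, 's) pfun \<Rightarrow> ('x \<Rightarrow> 'r) \<Rightarrow> bool" where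
  "strictly_natural C D P Q t \<longleftrightarrow>
     (\<forall>X\<in>Cell0 C. \<forall>Y\<in>Cell0 C. \<forall>f\<in>Cell1 C X Y.
        HComp1 D (pob P X) (pob P Y) (pob Q Y) (par1 P X Y f) (t Y) =
        HComp1 D (pob P X) (pob Q X) (pob Q Y) (t X) (par1 Q X Y f)) \<and>
     pseudonatural C D P Q
       \<lparr>pn1 = t,
        pn2 = (\<lambda>X Y f. Id2 D (pob P X) (pob Q Y)
                 (HComp1 D (pob P X) (pob P Y) (pob Q Y) (par1 P X Y f) (t Y)))\<rparr>"

definition invertible_1cell :: "('x, 'p, 'q) two_cat \<Rightarrow> 'x \<Rightarrow> 'x \<Rightarrow> 'p \<Rightarrow> bool" where
  "invertible_1cell D X Y f \<longleftrightarrow> f \<in> Cell1 D X Y \<and>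
     (\<exists>g\<in>Cell1 D Y X. HComp1 D X Y X f g = Id1 D X \<and> HComp1 D Y X Y g f = Id1 D Y)"


section \<open>Nearly strict (symmetric) monoidal 2-categories\<close>

record ('x, 'p, 'q) nsmon =
  Box :: "('x \<times> 'x, 'p \<times> 'p, 'q \<times> 'q, 'x, 'p, 'q) pfun"
  BUnt :: "'x"
  BAsc :: "'x \<Rightarrow> 'x \<Rightarrow> 'x \<Rightarrow> 'p"
  BRun :: "'x \<Rightarrow> 'p"
  BLun :: "'x \<Rightarrow> 'p"

abbreviation box0 :: "('x, 'p, 'q) nsmon \<Rightarrow> 'x \<Rightarrow> 'x \<Rightarrow> 'x" where
  "box0 T X Y \<equiv> pob (Box T) (X, Y)"

abbreviation box1 :: "('x, 'p, 'q) nsmon \<Rightarrow> 'x \<Rightarrow> 'x \<Rightarrow> 'x \<Rightarrow> 'x \<Rightarrow> 'p \<Rightarrow> 'p \<Rightarrow> 'p" where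
  "box1 T X1 X2 Y1 Y2 f1 f2 \<equiv> par1 (Box T) (X1, X2) (Y1, Y2) (f1, f2)"

abbreviation box2 :: "('x, 'p, 'q) nsmon \<Rightarrow> 'x \<Rightarrow> 'x \<Rightarrow> 'x \<Rightarrow> 'x \<Rightarrow> 'q \<Rightarrow> 'q \<Rightarrow> 'q" where
  "box2 T X1 X2 Y1 Y2 \<alpha>1 \<alpha>2 \<equiv> par2 (Box T) (X1, X2) (Y1, Y2) (\<alpha>1, \<alpha>2)"

text \<open>\<open>tensorator \<dots> f1 f2 g1 g2 : (f1 \<box> f2) ; (g1 \<box> g2) \<Rightarrow> (f1 ; g1) \<box> (f2 ; g2)\<close>\<close>

abbreviation tensorator ::
    "('x, 'p, 'q) nsmon \<Rightarrow> 'x \<Rightarrow> 'x \<Rightarrow> 'x \<Rightarrow> 'x \<Rightarrow> 'x \<Rightarrow> 'x \<Rightarrow> 'p \<Rightarrow> 'p \<Rightarrow> 'p \<Rightarrow> 'p \<Rightarrow> 'q" where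
  "tensorator T X1 X2 Y1 Y2 Z1 Z2 f1 f2 g1 g2 \<equiv>
     pcomp (Box T) (X1, X2) (Y1, Y2) (Z1, Z2) (f1, f2) (g1, g2)"

locale nearly_strict_monoidal_two_category = two_category D
  for D :: "('x, 'p, 'q) two_cat" +
  fixes T :: "('x, 'p, 'q) nsmon"
  assumes box_pseudofunctor: "pseudofunctor (prod_two_cat D D) D (Box T)"
    and bunt_cell: "BUnt T \<in> Cell0 D"
    and basc_natural: "strictly_natural (prod_two_cat (prod_two_cat D D) D) D
      (comp_pfun D (prod_pfun (Box T) (id_pfun D)) (Box T))
      (comp_pfun D (asc_pfun D) (comp_pfun D (prod_pfun (id_pfun D) (Box T)) (Box T)))
      (\<lambda>((X, Y), Z). BAsc T X Y Z)"
    and basc_invertible: "X \<in> Cell0 D \<Longrightarrow> Y \<in> Cell0 D \<Longrightarrow> Z \<in> Cell0 D \<Longrightarrow>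
      invertible_1cell D (box0 T (box0 T X Y) Z) (box0 T X (box0 T Y Z)) (BAsc T X Y Z)"
    and brun_natural: "strictly_natural D D
      (comp_pfun D (rinsert_pfun D (BUnt T)) (Box T)) (id_pfun D) (BRun T)"
    and brun_invertible: "X \<in> Cell0 D \<Longrightarrow> invertible_1cell D (box0 T X (BUnt T)) X (BRun T X)"
    and blun_natural: "strictly_natural D D
      (comp_pfun D (linsert_pfun D (BUnt T)) (Box T)) (id_pfun D) (BLun T)"
    and blun_invertible: "X \<in> Cell0 D \<Longrightarrow> invertible_1cell D (box0 T (BUnt T) X) X (BLun T X)"
    and bpentagon: "W \<in> Cell0 D \<Longrightarrow> X \<in> Cell0 D \<Longrightarrow> Y \<in> Cell0 D \<Longrightarrow> Z \<in> Cell0 D \<Longrightarrow>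
      HComp1 D (box0 T (box0 T (box0 T W X) Y) Z) (box0 T (box0 T W X) (box0 T Y Z))
               (box0 T W (box0 T X (box0 T Y Z)))
        (BAsc T (box0 T W X) Y Z)
        (BAsc T W X (box0 T Y Z)) =
      HComp1 D (box0 T (box0 T (box0 T W X) Y) Z) (box0 T W (box0 T (box0 T X Y) Z))
               (box0 T W (box0 T X (box0 T Y Z)))
        (HComp1 D (box0 T (box0 T (box0 T W X) Y) Z) (box0 T (box0 T W (box0 T X Y)) Z)
                  (box0 T W (box0 T (box0 T X Y) Z))
          (box1 T (box0 T (box0 T W X) Y) Z (box0 T W (box0 T X Y)) Z (BAsc T W X Y) (Id1 D Z))
          (BAsc T W (box0 T X Y) Z))
        (box1 T W (box0 T (box0 T X Y) Z) W (box0 T X (box0 T Y Z)) (Id1 D W) (BAsc T X Y Z))"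
    and btriangle: "X \<in> Cell0 D \<Longrightarrow> Y \<in> Cell0 D \<Longrightarrow>
      HComp1 D (box0 T (box0 T X (BUnt T)) Y) (box0 T X (box0 T (BUnt T) Y)) (box0 T X Y)
        (BAsc T X (BUnt T) Y)
        (box1 T X (box0 T (BUnt T) Y) X Y (Id1 D X) (BLun T Y)) =
      box1 T (box0 T X (BUnt T)) Y X Y (BRun T X) (Id1 D Y)"

locale nearly_strict_symmetric_monoidal_two_category = nearly_strict_monoidal_two_category D T
  for D :: "('x, 'p, 'q) two_cat" and T :: "('x, 'p, 'q) nsmon" +
  fixes S :: "('x \<times> 'x, 'p \<times> 'p, 'p, 'q) pnat"
  assumes bsym_pseudonatural: "pseudonatural (prod_two_cat D D) D
      (Box T) (comp_pfun D (swap_pfun D) (Box T)) S"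
    and bsym_bsym: "X \<in> Cell0 D \<Longrightarrow> Y \<in> Cell0 D \<Longrightarrow>
      HComp1 D (box0 T X Y) (box0 T Y X) (box0 T X Y) (pn1 S (X, Y)) (pn1 S (Y, X)) =
      Id1 D (box0 T X Y)"
    and bsym_unit: "X \<in> Cell0 D \<Longrightarrow>
      HComp1 D (box0 T X (BUnt T)) (box0 T (BUnt T) X) X (pn1 S (X, BUnt T)) (BLun T X) = BRun T X"
    and bhexagon: "X \<in> Cell0 D \<Longrightarrow> Y \<in> Cell0 D \<Longrightarrow> Z \<in> Cell0 D \<Longrightarrow>
      HComp1 D (box0 T (box0 T X Y) Z) (box0 T (box0 T Y Z) X) (box0 T Y (box0 T Z X))
        (HComp1 D (box0 T (box0 T X Y) Z) (box0 T X (box0 T Y Z)) (box0 T (box0 T Y Z) X)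
          (BAsc T X Y Z)
          (pn1 S (X, box0 T Y Z)))
        (BAsc T Y Z X) =
      HComp1 D (box0 T (box0 T X Y) Z) (box0 T Y (box0 T X Z)) (box0 T Y (box0 T Z X))
        (HComp1 D (box0 T (box0 T X Y) Z) (box0 T (box0 T Y X) Z) (box0 T Y (box0 T X Z))
          (box1 T (box0 T X Y) Z (box0 T Y X) Z (pn1 S (X, Y)) (Id1 D Z))
          (BAsc T Y X Z))
        (box1 T Y (box0 T X Z) Y (box0 T Z X) (Id1 D Y) (pn1 S (X, Z)))"

end

theory Submission
  imports Defs
begin

text \<open>
  All coherence isomorphisms of the Kleisli category \<open>K\<close> are lifted from \<open>W\<close>, so \<open>K\<close> is symmetric
  monoidal, \<open>U\<close> stays strict in it, and \<open>V \<rightarrow> W \<rightarrow> K\<close> is a lax symmetric monoidal functor \<open>G\<close>. This reduces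
  everything to a symmetric monoidal category \<open>K\<close> with a full strict monoidal subcategory \<open>U\<close>.

  A 1-cell is then a generalized element \<open>u \<rightarrow> G (C(X, Y))\<close> with parameter object \<open>u \<in> U\<close>. The lax structure
  of \<open>G\<close> turns every equation between arrows of \<open>V\<close> into an equation between generalized elements,
  strictly as far as associators and unitors are concerned, and up to a symmetry of the parameter
  objects wherever the symmetry of \<open>V\<close> occurs. The latter happens exactly in the middle swap used in
  the composition of \<open>C \<otimes> C\<close>, which gives the tensorators, and in the naturality of the symmetry of \<open>C\<close>.
  Since a 2-cell is determined by its endpoints and its Kleisli arrow, the remaining axioms are
  equations between permutations of tensor factors in \<open>U\<close>, which follow from the hexagon.
\<close>

section \<open>Categories and monoidal categories\<close>

text \<open>The obstacle is that neither \<open>V\<close> nor \<open>K\<close> is strict, while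
  horizontal composition and the structure 1-cells must satisfy their laws on the nose. An
  associator or unitor coming from \<open>G\<close> sits at objects \<open>G A\<close>, where it
  need not be an identity; its naturality moves it to the domains of the arrows involved, which are
  parameter objects in \<open>U\<close>, and there it vanishes. The symmetry is moved in the same
  way but survives.

  Pentagon, triangle and hexagon for 1-cells are not recomputed. An arrow \<open>I -> C(X,Y)\<close>
  of the underlying category gives a 1-cell with the unit as parameter; this assignment preserves
  composition and monoidal product strictly, so it carries over the equations of the underlying
  monoidal category.

  Strict naturality is formulated as pseudonaturality between composite pseudofunctors. Hence
  products and composites of pseudofunctors must be shown to be pseudofunctors, and their composite
  structure 2-cells enter the compatibility conditions. That is where \<open>middle_swap_asc\<close>
  comes from; \<open>middle_swap_sym\<close> is its counterpart for the symmetry.\<close>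

lemma Hom_iff: "f \<in> Hom C A B \<longleftrightarrow> f \<in> Arr C \<and> Dom C f = A \<and> Cod C f = B"
  by (auto simp: Hom_def)

context category
begin

lemma dom_cod_ob [simp]:
  assumes "f \<in> Arr C"
  shows "Dom C f \<in> Ob C" and "Cod C f \<in> Ob C"
  using assms dom_ob cod_ob by auto

lemma hom_ob:
  assumes "f \<in> Hom C A B"
  shows "A \<in> Ob C" and "B \<in> Ob C"
  using assms by (auto simp: Hom_iff)

lemma ide_simps [simp]:
  assumes "A \<in> Ob C"
  shows "Ide C A \<in> Arr C" and "Dom C (Ide C A) = A" and "Cod C (Ide C A) = A"
  using ide_hom[OF assms] by (auto simp: Hom_iff)

lemma cmp_simps [simp]:
  assumes "f \<in> Arr C" and "g \<in> Arr C" and "Cod C f = Dom C g"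
  shows "f \<Zsemi> g \<in> Arr C" and "Dom C (f \<Zsemi> g) = Dom C f" and "Cod C (f \<Zsemi> g) = Cod C g"
  using cmp_hom[of f "Dom C f" "Dom C g" g "Cod C g"] assms by (auto simp: Hom_iff)

lemma ide_cmp_arr [simp]: "f \<in> Arr C \<Longrightarrow> Dom C f = A \<Longrightarrow> Ide C A \<Zsemi> f = f"
  by (rule ide_cmp[of f A "Cod C f"]) (simp add: Hom_iff)

lemma cmp_ide_arr [simp]: "f \<in> Arr C \<Longrightarrow> Cod C f = B \<Longrightarrow> f \<Zsemi> Ide C B = f"
  by (rule cmp_ide[of f "Dom C f" B]) (simp add: Hom_iff)

lemma cmp_assoc_arr [simp]:
  assumes "f \<in> Arr C" and "g \<in> Arr C" and "h \<in> Arr C"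
    and "Cod C f = Dom C g" and "Cod C g = Dom C h"
  shows "(f \<Zsemi> g) \<Zsemi> h = f \<Zsemi> (g \<Zsemi> h)"
  using cmp_assoc[of f "Dom C f" "Dom C g" g "Dom C h" h "Cod C h"] assms by (simp add: Hom_iff)

text \<open>Composites are normalised to the right, and then the left side of a known equation is no
  subterm of a longer composite. This form extends the equation by a tail \<open>x\<close>; it is
  the main device for applying naturality squares inside composites.\<close>

lemma cmp_left_eq:
  assumes "f \<Zsemi> g = h \<Zsemi> k" and "f \<in> Arr C" and "g \<in> Arr C" and "h \<in> Arr C" and "k \<in> Arr C"
    and "Cod C f = Dom C g" and "Cod C h = Dom C k" and "x \<in> Arr C" and "Cod C g = Dom C x"
  shows "f \<Zsemi> (g \<Zsemi> x) = h \<Zsemi> (k \<Zsemi> x)"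
proof -
  have "Cod C k = Cod C g"
    using assms by (metis cmp_simps(3))
  then have "f \<Zsemi> (g \<Zsemi> x) = (f \<Zsemi> g) \<Zsemi> x" and "(h \<Zsemi> k) \<Zsemi> x = h \<Zsemi> (k \<Zsemi> x)"
    using assms(2-) by auto
  then show ?thesis
    by (simp only: assms(1))
qed

lemma inverse_arrows_unique:
  assumes "inverse_arrows C f g" and "inverse_arrows C f h"
  shows "g = h"
proof -
  have 1: "f \<in> Arr C" "g \<in> Arr C" "h \<in> Arr C" "Dom C g = Cod C f" "Cod C g = Dom C f"
    "Dom C h = Cod C f" "Cod C h = Dom C f"
    and 2: "g \<Zsemi> f = Ide C (Cod C f)" "f \<Zsemi> h = Ide C (Dom C f)"
    using assms by (auto simp: inverse_arrows_def Hom_iff)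
  have "(g \<Zsemi> f) \<Zsemi> h = g \<Zsemi> (f \<Zsemi> h)"
    by (rule cmp_assoc_arr) (use 1 in auto)
  then show ?thesis
    using 1 by (simp add: 2)
qed

lemma inverse_of_eq: "inverse_arrows C f g \<Longrightarrow> inverse_of C f = g"
  unfolding inverse_of_def by (rule the_equality) (auto intro: inverse_arrows_unique)

lemma iso_inverse_arrows: "iso C f \<Longrightarrow> inverse_arrows C f (inverse_of C f)"
  using inverse_of_eq by (auto simp: iso_def)

lemma iso_simps [simp]:
  assumes "iso C f"
  shows "f \<in> Arr C" and "inverse_of C f \<in> Arr C"
    and "Dom C (inverse_of C f) = Cod C f" and "Cod C (inverse_of C f) = Dom C f"
    and "f \<Zsemi> inverse_of C f = Ide C (Dom C f)" and "inverse_of C f \<Zsemi> f = Ide C (Cod C f)"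
  using iso_inverse_arrows[OF assms] by (auto simp: inverse_arrows_def Hom_iff)

lemma iso_cancel [simp]:
  assumes "iso C f" and "g \<in> Arr C"
  shows "Cod C f = Dom C g \<Longrightarrow> inverse_of C f \<Zsemi> (f \<Zsemi> g) = g"
    and "Dom C f = Dom C g \<Longrightarrow> f \<Zsemi> (inverse_of C f \<Zsemi> g) = g"
  using assms by (simp_all flip: cmp_assoc_arr)

lemma inverse_arrows_ide: "A \<in> Ob C \<Longrightarrow> inverse_arrows C (Ide C A) (Ide C A)"
  by (simp add: inverse_arrows_def Hom_iff)

lemma inverse_of_ide [simp]: "A \<in> Ob C \<Longrightarrow> inverse_of C (Ide C A) = Ide C A"
  by (rule inverse_of_eq) (rule inverse_arrows_ide)

lemma iso_ide [simp]: "A \<in> Ob C \<Longrightarrow> iso C (Ide C A)"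
  using inverse_arrows_ide by (auto simp: iso_def)

lemma inverse_arrows_cmp:
  assumes "inverse_arrows C f f'" and "inverse_arrows C g g'" and "Cod C f = Dom C g"
  shows "inverse_arrows C (f \<Zsemi> g) (g' \<Zsemi> f')"
proof -
  have 1: "f \<in> Arr C" "f' \<in> Arr C" "Dom C f' = Cod C f" "Cod C f' = Dom C f"
    "g \<in> Arr C" "g' \<in> Arr C" "Dom C g' = Cod C g" "Cod C g' = Dom C g"
    using assms by (auto simp: inverse_arrows_def Hom_iff)
  have 2: "g \<Zsemi> (g' \<Zsemi> f') = (g \<Zsemi> g') \<Zsemi> f'" "f' \<Zsemi> (f \<Zsemi> g) = (f' \<Zsemi> f) \<Zsemi> g"
    using 1 assms(3) by simp_all
  show ?thesis
    using 1 assms by (simp add: 2 inverse_arrows_def Hom_iff del: cmp_assoc_arr) (simp add: 1 2 assms(3))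
qed

lemma iso_cmp: "iso C f \<Longrightarrow> iso C g \<Longrightarrow> Cod C f = Dom C g \<Longrightarrow> iso C (f \<Zsemi> g)"
  unfolding iso_def by (blast intro: inverse_arrows_cmp)

lemma iso_inverse_of: "iso C f \<Longrightarrow> iso C (inverse_of C f)"
  using iso_inverse_arrows[of f] unfolding iso_def[of C "inverse_of C f"] inverse_arrows_def
  by (intro exI[of _ f]) (auto simp: Hom_iff)

end

section \<open>Products of categories, and functors between categories\<close>

lemma category_prod_cat:
  assumes "category C" and "category D"
  shows "category (prod_cat C D)"
proof -
  interpret C: category C by fact
  interpret D: category D by fact
  show ?thesis
    by unfold_locales (auto simp: prod_cat_def Hom_iff)
qed

lemma Hom_prod_cat [simp]: "Hom (prod_cat C D) (A, A') (B, B') = Hom C A B \<times> Hom D A' B'"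
  by (auto simp: Hom_iff prod_cat_def)

lemma prod_cat_sel [simp]:
  "Ob (prod_cat C D) = Ob C \<times> Ob D"
  "Arr (prod_cat C D) = Arr C \<times> Arr D"
  "Ide (prod_cat C D) (A, A') = (Ide C A, Ide D A')"
  "(f, f') \<Zsemi>\<^bsub>prod_cat C D\<^esub> (g, g') = (f \<Zsemi>\<^bsub>C\<^esub> g, f' \<Zsemi>\<^bsub>D\<^esub> g')"
  "Dom (prod_cat C D) (f, f') = (Dom C f, Dom D f')"
  "Cod (prod_cat C D) (f, f') = (Cod C f, Cod D f')"
  by (simp_all add: prod_cat_def)

lemma iso_prod_cat:
  assumes "iso C f" and "iso D g"
  shows "iso (prod_cat C D) (f, g)"
proof -
  obtain f' g' where "inverse_arrows C f f'" "inverse_arrows D g g'"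
    using assms by (auto simp: iso_def)
  then have "inverse_arrows (prod_cat C D) (f, g) (f', g')"
    by (auto simp: inverse_arrows_def prod_cat_def Hom_iff)
  then show ?thesis
    by (auto simp: iso_def)
qed

context category_functor
begin

lemma far_simps [simp]:
  assumes "f \<in> Arr C"
  shows "far F f \<in> Arr D" and "Dom D (far F f) = fob F (Dom C f)"
    and "Cod D (far F f) = fob F (Cod C f)"
  using far_hom[of f "Dom C f" "Cod C f"] assms by (auto simp: Hom_iff)

lemma fob_ob_simp [simp]: "A \<in> Ob C \<Longrightarrow> fob F A \<in> Ob D"
  by (rule fob_ob)

lemma far_cmp_arr:
  "f \<in> Arr C \<Longrightarrow> g \<in> Arr C \<Longrightarrow> Cod C f = Dom C g \<Longrightarrow>
     far F (f \<Zsemi>\<^bsub>C\<^esub> g) = far F f \<Zsemi>\<^bsub>D\<^esub> far F g"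
  using far_cmp[of f "Dom C f" "Dom C g" g "Cod C g"] by (simp add: Hom_iff)

lemma far_inverse_arrows:
  assumes "inverse_arrows C f g"
  shows "inverse_arrows D (far F f) (far F g)"
proof -
  have 1: "f \<in> Arr C" "g \<in> Arr C" "Dom C g = Cod C f" "Cod C g = Dom C f"
    using assms by (auto simp: inverse_arrows_def Hom_iff)
  then show ?thesis
    using assms by (auto simp: inverse_arrows_def Hom_iff far_ide simp flip: far_cmp_arr)
qed

lemma far_iso: "iso C f \<Longrightarrow> iso D (far F f)"
  using far_inverse_arrows by (auto simp: iso_def)

lemma far_inverse_of: "iso C f \<Longrightarrow> far F (inverse_of C f) = inverse_of D (far F f)"
  using D.inverse_of_eq[OF far_inverse_arrows[OF C.iso_inverse_arrows]] by simp

end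

lemma category_functorI:
  assumes "category C" and "category D"
    and "\<And>A. A \<in> Ob C \<Longrightarrow> fob F A \<in> Ob D"
    and "\<And>f. f \<in> Arr C \<Longrightarrow> far F f \<in> Hom D (fob F (Dom C f)) (fob F (Cod C f))"
    and "\<And>A. A \<in> Ob C \<Longrightarrow> far F (Ide C A) = Ide D (fob F A)"
    and "\<And>f g. f \<in> Arr C \<Longrightarrow> g \<in> Arr C \<Longrightarrow> Cod C f = Dom C g \<Longrightarrow>
      far F (f \<Zsemi>\<^bsub>C\<^esub> g) = far F f \<Zsemi>\<^bsub>D\<^esub> far F g"
  shows "category_functor C D F"
  using assms by (auto simp: category_functor_def category_functor_axioms_def Hom_iff)

lemma category_functor_comp:
  assumes "category_functor C D F" and "category_functor D E G"
  shows "category_functor C E (comp_funct F G)"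
proof -
  interpret F: category_functor C D F by fact
  interpret G: category_functor D E G by fact
  show ?thesis
    by unfold_locales
      (auto simp: comp_funct_def F.far_ide G.far_ide F.far_cmp_arr G.far_cmp_arr Hom_iff)
qed

lemma category_functor_prod:
  assumes "category_functor C D F" and "category_functor C' D' G"
  shows "category_functor (prod_cat C C') (prod_cat D D') (prod_funct F G)"
proof -
  interpret F: category_functor C D F by fact
  interpret G: category_functor C' D' G by fact
  show ?thesis
    by (rule category_functorI)
      (auto simp: prod_cat_def prod_funct_def F.far_ide G.far_ide F.far_cmp_arr G.far_cmp_arr Hom_iff
        intro!: category_prod_cat[unfolded prod_cat_def] F.C.category_axioms F.D.category_axioms
          G.C.category_axioms G.D.category_axioms)
qed

section \<open>Calculation rules for tensor products, structure isomorphisms and lax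
  comparisons\<close>

context monoidal_category
begin

lemma unt_ob_simp [simp]: "Unt C \<in> Ob C"
  by (rule unt_ob)

lemma tens_simps [simp]:
  assumes "f \<in> Arr C" and "g \<in> Arr C"
  shows "f \<otimes> g \<in> Arr C" and "Dom C (f \<otimes> g) = Dom C f \<odot> Dom C g"
    and "Cod C (f \<otimes> g) = Cod C f \<odot> Cod C g"
proof -
  interpret T: category_functor "prod_cat C C" C
    "\<lparr>fob = (\<lambda>(A, B). A \<odot> B), far = (\<lambda>(f, g). f \<otimes> g)\<rparr>"
    by (rule tens_functor)
  have "(f, g) \<in> Arr (prod_cat C C)"
    using assms by (simp add: prod_cat_def)
  from T.far_simps[OF this] show "f \<otimes> g \<in> Arr C" "Dom C (f \<otimes> g) = Dom C f \<odot> Dom C g"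
    "Cod C (f \<otimes> g) = Cod C f \<odot> Cod C g"
    by (simp_all add: prod_cat_def)
qed

lemma tens0_ob [simp]: "A \<in> Ob C \<Longrightarrow> B \<in> Ob C \<Longrightarrow> A \<odot> B \<in> Ob C"
  using tens_simps(1,2)[of "Ide C A" "Ide C B"] dom_cod_ob(1) by (metis ide_simps(1,2))

lemma tens_ide [simp]: "A \<in> Ob C \<Longrightarrow> B \<in> Ob C \<Longrightarrow> Ide C A \<otimes> Ide C B = Ide C (A \<odot> B)"
  using category_functor.far_ide[OF tens_functor, of "(A, B)"] by (simp add: prod_cat_def)

text \<open>As a simplification rule this merges composed tensors into one. Proofs that must keep
  the tensors apart delete it together with \<open>interchange'\<close>, its version for a
  right-nested composite.\<close>

lemma interchange [simp]:
  assumes "f \<in> Arr C" and "f' \<in> Arr C" and "g \<in> Arr C" and "g' \<in> Arr C"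
    and "Cod C f = Dom C g" and "Cod C f' = Dom C g'"
  shows "(f \<otimes> f') \<Zsemi> (g \<otimes> g') = (f \<Zsemi> g) \<otimes> (f' \<Zsemi> g')"
  using category_functor.far_cmp[OF tens_functor, of "(f, f')" "(Dom C f, Dom C f')"
      "(Dom C g, Dom C g')" "(g, g')" "(Cod C g, Cod C g')"] assms
  by (simp add: prod_cat_def Hom_iff)

lemma interchange' [simp]:
  assumes "f \<in> Arr C" and "f' \<in> Arr C" and "g \<in> Arr C" and "g' \<in> Arr C" and "x \<in> Arr C"
    and "Cod C f = Dom C g" and "Cod C f' = Dom C g'" and "Cod C g \<odot> Cod C g' = Dom C x"
  shows "(f \<otimes> f') \<Zsemi> ((g \<otimes> g') \<Zsemi> x) = ((f \<Zsemi> g) \<otimes> (f' \<Zsemi> g')) \<Zsemi> x"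
  using assms by (simp flip: cmp_assoc_arr)

text \<open>Opposite in direction to \<open>interchange\<close>: it splits a whiskered composite and
  is used in \<open>whisker_simps\<close> with \<open>interchange\<close> deleted. It holds because
  an identity composed with itself is that identity.\<close>

lemma tens_cmp_right: "f \<in> Arr C \<Longrightarrow> g \<in> Arr C \<Longrightarrow> A \<in> Ob C \<Longrightarrow> Cod C f = Dom C g \<Longrightarrow>
    Ide C A \<otimes> (f \<Zsemi> g) = (Ide C A \<otimes> f) \<Zsemi> (Ide C A \<otimes> g)"
  by simp

lemma tens_cmp_left: "f \<in> Arr C \<Longrightarrow> g \<in> Arr C \<Longrightarrow> A \<in> Ob C \<Longrightarrow> Cod C f = Dom C g \<Longrightarrow>
    (f \<Zsemi> g) \<otimes> Ide C A = (f \<otimes> Ide C A) \<Zsemi> (g \<otimes> Ide C A)"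
  by simp

lemma tens_inverse_arrows:
  assumes "inverse_arrows C f f'" and "inverse_arrows C g g'"
  shows "inverse_arrows C (f \<otimes> g) (f' \<otimes> g')"
  using assms by (simp add: inverse_arrows_def Hom_iff)

lemma tens_iso: "iso C f \<Longrightarrow> iso C g \<Longrightarrow> iso C (f \<otimes> g)"
  unfolding iso_def by (blast intro: tens_inverse_arrows)

lemma structure_iso [simp]:
  assumes "A \<in> Ob C"
  shows "B \<in> Ob C \<Longrightarrow> D \<in> Ob C \<Longrightarrow> iso C (Asc C A B D)"
    and "iso C (Lun C A)" and "iso C (Run C A)"
  using assms asc_iso lun_iso run_iso by auto

lemma structure_simps [simp]:
  assumes "A \<in> Ob C"
  shows "B \<in> Ob C \<Longrightarrow> D \<in> Ob C \<Longrightarrow> Dom C (Asc C A B D) = (A \<odot> B) \<odot> D"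
    and "B \<in> Ob C \<Longrightarrow> D \<in> Ob C \<Longrightarrow> Cod C (Asc C A B D) = A \<odot> (B \<odot> D)"
    and "Dom C (Lun C A) = Unt C \<odot> A" and "Cod C (Lun C A) = A"
    and "Dom C (Run C A) = A \<odot> Unt C" and "Cod C (Run C A) = A"
  using asc_hom lun_hom run_hom assms by (auto simp: Hom_iff)

lemma asc_natural_arr:
  assumes "f \<in> Arr C" and "g \<in> Arr C" and "h \<in> Arr C"
  shows "((f \<otimes> g) \<otimes> h) \<Zsemi> Asc C (Cod C f) (Cod C g) (Cod C h) =
    Asc C (Dom C f) (Dom C g) (Dom C h) \<Zsemi> (f \<otimes> (g \<otimes> h))"
  using asc_natural[of f "Dom C f" "Cod C f" g "Dom C g" "Cod C g" h "Dom C h" "Cod C h"] assms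
  by (simp add: Hom_iff)

end

context symmetry
begin

lemma sym_simps [simp]:
  assumes "A \<in> Ob C" and "B \<in> Ob C"
  shows "s A B \<in> Arr C" and "Dom C (s A B) = A \<odot> B" and "Cod C (s A B) = B \<odot> A"
  using sym_hom[OF assms] by (auto simp: Hom_iff)

lemma sym_inverse_arrows: "A \<in> Ob C \<Longrightarrow> B \<in> Ob C \<Longrightarrow> inverse_arrows C (s A B) (s B A)"
  by (simp add: inverse_arrows_def Hom_iff sym_sym)

lemma sym_iso [simp]: "A \<in> Ob C \<Longrightarrow> B \<in> Ob C \<Longrightarrow> iso C (s A B)"
  using sym_inverse_arrows by (auto simp: iso_def)

lemma sym_natural_arr:
  "f \<in> Arr C \<Longrightarrow> g \<in> Arr C \<Longrightarrow>
     (f \<otimes> g) \<Zsemi> s (Cod C f) (Cod C g) = s (Dom C f) (Dom C g) \<Zsemi> (g \<otimes> f)"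
  using sym_natural[of f "Dom C f" "Cod C f" g "Dom C g" "Cod C g"] by (simp add: Hom_iff)

end

context symmetric_monoidal_category
begin

lemma middle_swap_iso_hom:
  assumes "A \<in> Ob C" and "B \<in> Ob C" and "D \<in> Ob C" and "E \<in> Ob C"
  shows "iso C (middle_swap C A B D E)"
    and "middle_swap C A B D E \<in> Hom C ((A \<odot> B) \<odot> (D \<odot> E)) ((A \<odot> D) \<odot> (B \<odot> E))"
proof -
  show "iso C (middle_swap C A B D E)"
    unfolding middle_swap_def using assms by (intro iso_cmp tens_iso iso_inverse_of) auto
  show "middle_swap C A B D E \<in> Hom C ((A \<odot> B) \<odot> (D \<odot> E)) ((A \<odot> D) \<odot> (B \<odot> E))"
    unfolding middle_swap_def using assms by (simp add: Hom_iff)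
qed

lemma middle_swap_simps [simp]:
  assumes "A \<in> Ob C" and "B \<in> Ob C" and "D \<in> Ob C" and "E \<in> Ob C"
  shows "middle_swap C A B D E \<in> Arr C"
    and "Dom C (middle_swap C A B D E) = (A \<odot> B) \<odot> (D \<odot> E)"
    and "Cod C (middle_swap C A B D E) = (A \<odot> D) \<odot> (B \<odot> E)"
  using middle_swap_iso_hom(2)[OF assms] by (auto simp: Hom_iff)

end

context lax_monoidal_functor
begin

lemma eps_simps [simp]:
  "eps F \<in> Arr W" "Dom W (eps F) = Unt W" "Cod W (eps F) = fob F (Unt V)"
  using eps_hom by (auto simp: Hom_iff)

lemma tld_simps [simp]:
  assumes "A \<in> Ob V" and "B \<in> Ob V"
  shows "tld F A B \<in> Arr W" and "Dom W (tld F A B) = fob F A \<odot>\<^bsub>W\<^esub> fob F B"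
    and "Cod W (tld F A B) = fob F (A \<odot>\<^bsub>V\<^esub> B)"
  using tld_hom[OF assms] by (auto simp: Hom_iff)

lemma tld_natural_arr:
  "f \<in> Arr V \<Longrightarrow> g \<in> Arr V \<Longrightarrow>
     (far F f \<otimes>\<^bsub>W\<^esub> far F g) \<Zsemi>\<^bsub>W\<^esub> tld F (Cod V f) (Cod V g) =
     tld F (Dom V f) (Dom V g) \<Zsemi>\<^bsub>W\<^esub> far F (f \<otimes>\<^bsub>V\<^esub> g)"
  using tld_natural[of f "Dom V f" "Cod V f" g "Dom V g" "Cod V g"] by (simp add: Hom_iff)

lemma tld_structure:
  assumes "A \<in> Ob V"
  shows "B \<in> Ob V \<Longrightarrow> D \<in> Ob V \<Longrightarrow>
      (tld F A B \<otimes>\<^bsub>W\<^esub> Ide W (fob F D)) \<Zsemi>\<^bsub>W\<^esub> (tld F (A \<odot>\<^bsub>V\<^esub> B) D \<Zsemi>\<^bsub>W\<^esub> far F (Asc V A B D)) =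
      Asc W (fob F A) (fob F B) (fob F D)
        \<Zsemi>\<^bsub>W\<^esub> ((Ide W (fob F A) \<otimes>\<^bsub>W\<^esub> tld F B D) \<Zsemi>\<^bsub>W\<^esub> tld F A (B \<odot>\<^bsub>V\<^esub> D))"
    and "(eps F \<otimes>\<^bsub>W\<^esub> Ide W (fob F A)) \<Zsemi>\<^bsub>W\<^esub> (tld F (Unt V) A \<Zsemi>\<^bsub>W\<^esub> far F (Lun V A)) = Lun W (fob F A)"
    and "(Ide W (fob F A) \<otimes>\<^bsub>W\<^esub> eps F) \<Zsemi>\<^bsub>W\<^esub> (tld F A (Unt V) \<Zsemi>\<^bsub>W\<^esub> far F (Run V A)) = Run W (fob F A)"
  using tld_assoc[of A B D] tld_lun[of A] tld_run[of A] assms by simp_all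

end

section \<open>The monoidal Kleisli category\<close>

context symmetric_monoidal_monad
begin

sublocale Mon: lax_symmetric_monoidal_functor W W "monad_laxfun W M"
  by (rule monad_lax)

sublocale Mu: monoidal_transformation W W "comp_laxfun W (monad_laxfun W M) (monad_laxfun W M)"
    "monad_laxfun W M" "Mu M"
  by (rule mu_monoidal)

sublocale Eta: monoidal_transformation W W "id_laxfun W" "monad_laxfun W M" "Eta M"
  by (rule eta_monoidal)

lemma M_simps [simp]:
  assumes "f \<in> Arr W"
  shows "far M f \<in> Arr W" and "Dom W (far M f) = fob M (Dom W f)"
    and "Cod W (far M f) = fob M (Cod W f)"
  using Mon.far_simps[OF assms] by (simp_all add: monad_laxfun_def)

lemma M_ob [simp]: "A \<in> Ob W \<Longrightarrow> fob M A \<in> Ob W"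
  using Mon.fob_ob_simp by (simp add: monad_laxfun_def)

lemma M_cmp [simp]: "f \<in> Arr W \<Longrightarrow> g \<in> Arr W \<Longrightarrow> Cod W f = Dom W g \<Longrightarrow>
    far M (f \<Zsemi> g) = far M f \<Zsemi> far M g"
  using Mon.far_cmp_arr by (simp add: monad_laxfun_def)

lemma nabla_simps [simp]:
  assumes "A \<in> Ob W" and "B \<in> Ob W"
  shows "Nabla M A B \<in> Arr W" and "Dom W (Nabla M A B) = fob M A \<odot> fob M B"
    and "Cod W (Nabla M A B) = fob M (A \<odot> B)"
  using Mon.tld_simps[OF assms] by (simp_all add: monad_laxfun_def)

lemma mu_simps [simp]:
  assumes "A \<in> Ob W"
  shows "Mu M A \<in> Arr W" and "Dom W (Mu M A) = fob M (fob M A)" and "Cod W (Mu M A) = fob M A"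
  using Mu.component_hom[OF assms] by (simp_all add: comp_laxfun_def monad_laxfun_def Hom_iff)

lemma eta_simps [simp]:
  assumes "A \<in> Ob W"
  shows "Eta M A \<in> Arr W" and "Dom W (Eta M A) = A" and "Cod W (Eta M A) = fob M A"
  using Eta.component_hom[OF assms] by (simp_all add: id_laxfun_def monad_laxfun_def Hom_iff)

lemma nabla_natural:
  "f \<in> Arr W \<Longrightarrow> g \<in> Arr W \<Longrightarrow>
     (far M f \<otimes> far M g) \<Zsemi> Nabla M (Cod W f) (Cod W g) =
     Nabla M (Dom W f) (Dom W g) \<Zsemi> far M (f \<otimes> g)"
  using Mon.tld_natural_arr by (simp add: monad_laxfun_def)

lemma nabla_structure:
  assumes "A \<in> Ob W"
  shows "B \<in> Ob W \<Longrightarrow> D \<in> Ob W \<Longrightarrow>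
      (Nabla M A B \<otimes> Ide W (fob M D)) \<Zsemi> (Nabla M (A \<odot> B) D \<Zsemi> far M (Asc W A B D)) =
      Asc W (fob M A) (fob M B) (fob M D)
        \<Zsemi> ((Ide W (fob M A) \<otimes> Nabla M B D) \<Zsemi> Nabla M A (B \<odot> D))"
    and "(Eta M (Unt W) \<otimes> Ide W (fob M A)) \<Zsemi> (Nabla M (Unt W) A \<Zsemi> far M (Lun W A)) = Lun W (fob M A)"
    and "(Ide W (fob M A) \<otimes> Eta M (Unt W)) \<Zsemi> (Nabla M A (Unt W) \<Zsemi> far M (Run W A)) = Run W (fob M A)"
  using Mon.tld_structure[of A] assms by (simp_all add: monad_laxfun_def)

lemma nabla_sym: "A \<in> Ob W \<Longrightarrow> B \<in> Ob W \<Longrightarrow>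
    Nabla M A B \<Zsemi> far M (Sym W A B) = Sym W (fob M A) (fob M B) \<Zsemi> Nabla M B A"
  using Mon.tld_sym[of A B] by (simp add: monad_laxfun_def)

lemma mu_natural: "f \<in> Arr W \<Longrightarrow> far M (far M f) \<Zsemi> Mu M (Cod W f) = Mu M (Dom W f) \<Zsemi> far M f"
  using Mu.naturality[of f "Dom W f" "Cod W f"] by (simp add: comp_laxfun_def monad_laxfun_def Hom_iff)

lemma mu_nabla: "A \<in> Ob W \<Longrightarrow> B \<in> Ob W \<Longrightarrow>
    (Mu M A \<otimes> Mu M B) \<Zsemi> Nabla M A B =
    Nabla M (fob M A) (fob M B) \<Zsemi> (far M (Nabla M A B) \<Zsemi> Mu M (A \<odot> B))"
  using Mu.component_tld[of A B] by (simp add: comp_laxfun_def monad_laxfun_def)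

lemma eta_natural: "f \<in> Arr W \<Longrightarrow> f \<Zsemi> Eta M (Cod W f) = Eta M (Dom W f) \<Zsemi> far M f"
  using Eta.naturality[of f "Dom W f" "Cod W f"] by (simp add: id_laxfun_def monad_laxfun_def Hom_iff)

lemma eta_nabla: "A \<in> Ob W \<Longrightarrow> B \<in> Ob W \<Longrightarrow> (Eta M A \<otimes> Eta M B) \<Zsemi> Nabla M A B = Eta M (A \<odot> B)"
  using Eta.component_tld[of A B] by (simp add: id_laxfun_def monad_laxfun_def)

section \<open>The Kleisli category, its pure arrows, and its symmetric monoidal structure\<close>

abbreviation "K \<equiv> kleisli W M"

abbreviation "L \<equiv> kleisli_lift W M"

lemma kleisli_arr_iff:
  "f \<in> Arr K \<longleftrightarrow> Src f \<in> Ob W \<and> Tgt f \<in> Ob W \<and> Val f \<in> Hom W (Src f) (fob M (Tgt f))"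
  by (cases f) (auto simp: kleisli_def Hom_iff)

lemma kleisli_sel [simp]:
  "Ob K = Ob W" "Dom K f = Src f" "Cod K f = Tgt f" "Ide K A = Arrow A (Eta M A) A"
  "f \<Zsemi>\<^bsub>K\<^esub> g = Arrow (Src f) (Val f \<Zsemi> far M (Val g) \<Zsemi> Mu M (Tgt g)) (Tgt g)"
  "A \<odot>\<^bsub>K\<^esub> B = A \<odot> B" "Unt K = Unt W" "Asc K A B D = L (Asc W A B D)"
  "f \<otimes>\<^bsub>K\<^esub> g =
     Arrow (Src f \<odot> Src g) ((Val f \<otimes> Val g) \<Zsemi> Nabla M (Tgt f) (Tgt g)) (Tgt f \<odot> Tgt g)"
  "Lun K A = L (Lun W A)" "Run K A = L (Run W A)" "Sym K A B = L (Sym W A B)"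
  by (simp_all add: kleisli_def)

text \<open>The left unit law of Kleisli composition: naturality of \<open>Eta\<close> carries
  \<open>f\<close> to the front, leaving \<open>Eta\<close> at \<open>M B\<close> followed by
  \<open>Mu\<close>, which is an identity by \<open>eta_mu\<close>.\<close>

lemma eta_bind:
  assumes "f \<in> Arr W" and "Cod W f = fob M B" and "B \<in> Ob W" and "Dom W f = A"
  shows "Eta M A \<Zsemi> (far M f \<Zsemi> Mu M B) = f"
  using cmp_left_eq[OF eta_natural, of f "Mu M B"] assms by (auto simp: eta_mu)

text \<open>For associativity, naturality of \<open>Mu\<close> moves the last arrow past the inner
  multiplication; what remains is the associativity law \<open>mu_mu\<close> of the monad.\<close>

lemma category_kleisli: "category K"
proof
  fix f g h A B D E
  assume "f \<in> Hom K A B" "g \<in> Hom K B D" "h \<in> Hom K D E"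
  then show "(f \<Zsemi>\<^bsub>K\<^esub> g) \<Zsemi>\<^bsub>K\<^esub> h = f \<Zsemi>\<^bsub>K\<^esub> (g \<Zsemi>\<^bsub>K\<^esub> h)"
    using cmp_left_eq[OF mu_natural, of "Val h" "Mu M E"]
    by (auto simp: Hom_iff kleisli_arr_iff mu_mu)
next
  fix f A B
  assume "f \<in> Hom K A B"
  then have *: "Tgt f = B" "Src f = A" "B \<in> Ob W" "Val f \<in> Hom W A (fob M B)"
    by (auto simp: Hom_iff kleisli_arr_iff)
  then show "Ide K A \<Zsemi>\<^bsub>K\<^esub> f = f"
    by (cases f) (auto simp: Hom_iff eta_bind)
  show "f \<Zsemi>\<^bsub>K\<^esub> Ide K B = f"
    using * by (cases f) (auto simp: Hom_iff M_eta_mu)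
qed (auto simp: Hom_iff kleisli_arr_iff)

sublocale K: category K
  by (rule category_kleisli)

lemma lift_simps [simp]:
  "Src (L h) = Dom W h" "Tgt (L h) = Cod W h" "Val (L h) = h \<Zsemi> Eta M (Cod W h)"
  by (simp_all add: kleisli_lift_def)

lemma lift_arr [simp]: "h \<in> Arr W \<Longrightarrow> L h \<in> Arr K"
  by (simp add: kleisli_arr_iff Hom_iff)

text \<open>Composing with a pure arrow cancels \<open>Mu\<close> against \<open>Eta\<close>.
  Together with \<open>lift_cmp_kleisli\<close> this turns each naturality square for a structure
  isomorphism of \<open>K\<close> into an equation in \<open>W\<close> without
  multiplications.\<close>

lemma kleisli_cmp_lift:
  assumes "f \<in> Arr K" and "h \<in> Arr W" and "Tgt f = Dom W h"
  shows "f \<Zsemi>\<^bsub>K\<^esub> L h = Arrow (Src f) (Val f \<Zsemi> far M h) (Cod W h)"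
  using assms by (simp add: kleisli_arr_iff Hom_iff M_eta_mu)

lemma lift_cmp_kleisli:
  assumes "f \<in> Arr K" and "h \<in> Arr W" and "Cod W h = Src f"
  shows "L h \<Zsemi>\<^bsub>K\<^esub> f = Arrow (Dom W h) (h \<Zsemi> Val f) (Tgt f)"
  using assms by (auto simp: kleisli_arr_iff Hom_iff eta_bind)

lemma lift_ide: "A \<in> Ob W \<Longrightarrow> L (Ide W A) = Ide K A"
  by (simp add: kleisli_lift_def)

lemma lift_cmp:
  "f \<in> Arr W \<Longrightarrow> g \<in> Arr W \<Longrightarrow> Cod W f = Dom W g \<Longrightarrow> L (f \<Zsemi> g) = L f \<Zsemi>\<^bsub>K\<^esub> L g"
  using lift_cmp_kleisli[of "L g" f] by (simp del: kleisli_sel(5)) (simp add: kleisli_lift_def)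

lemma lift_tens: "f \<in> Arr W \<Longrightarrow> g \<in> Arr W \<Longrightarrow> L (f \<otimes> g) = L f \<otimes>\<^bsub>K\<^esub> L g"
  by (simp add: kleisli_lift_def flip: eta_nabla)

lemma lift_functor: "category_functor W K \<lparr>fob = (\<lambda>A. A), far = L\<rparr>"
  by (rule category_functorI)
    (auto simp: Hom_iff lift_ide lift_cmp category_axioms K.category_axioms simp del: kleisli_sel(4,5))

lemma lift_iso: "iso W f \<Longrightarrow> iso K (L f)"
  using category_functor.far_iso[OF lift_functor] by simp

lemma lift_inverse_of: "iso W f \<Longrightarrow> L (inverse_of W f) = inverse_of K (L f)"
  using category_functor.far_inverse_of[OF lift_functor] by simp

text \<open>Preservation of identities is monoidality of \<open>Eta\<close>. Preservation of
  composition is monoidality of \<open>Mu\<close>: it replaces two multiplications by one on the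
  tensor product, after which naturality of \<open>Nabla\<close> moves the second pair of arrows
  past \<open>Nabla\<close>.\<close>

lemma kleisli_tens_functor:
  "category_functor (prod_cat K K) K \<lparr>fob = (\<lambda>(A, B). A \<odot>\<^bsub>K\<^esub> B), far = (\<lambda>(f, g). f \<otimes>\<^bsub>K\<^esub> g)\<rparr>"
proof (rule category_functorI)
  fix \<phi> \<psi>
  assume "\<phi> \<in> Arr (prod_cat K K)" "\<psi> \<in> Arr (prod_cat K K)"
    "Cod (prod_cat K K) \<phi> = Dom (prod_cat K K) \<psi>"
  then obtain f f' g g' where 1: "\<phi> = (f, f')" "\<psi> = (g, g')"
    "f \<in> Arr K" "f' \<in> Arr K" "g \<in> Arr K" "g' \<in> Arr K" "Tgt f = Src g" "Tgt f' = Src g'"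
    by (auto simp: prod_cat_def)
  let ?h = "Val f \<otimes> Val f'" and ?k = "far M (Val g) \<otimes> far M (Val g')"
    and ?T = "Tgt g" and ?T' = "Tgt g'"
  note 2 = 1[unfolded kleisli_arr_iff Hom_iff]
  have "(?k \<Zsemi> (Mu M ?T \<otimes> Mu M ?T')) \<Zsemi> Nabla M ?T ?T' =
      ?k \<Zsemi> (Nabla M (fob M ?T) (fob M ?T') \<Zsemi> (far M (Nabla M ?T ?T') \<Zsemi> Mu M (?T \<odot> ?T')))"
    using 2 by (simp add: mu_nabla del: interchange interchange')
  also have "\<dots> = Nabla M (Src g) (Src g') \<Zsemi> (far M (Val g \<otimes> Val g')
      \<Zsemi> (far M (Nabla M ?T ?T') \<Zsemi> Mu M (?T \<odot> ?T')))"
    using nabla_natural[of "Val g" "Val g'"] 2 by (intro cmp_left_eq) (simp_all)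
  finally have "?h \<Zsemi> ((?k \<Zsemi> (Mu M ?T \<otimes> Mu M ?T')) \<Zsemi> Nabla M ?T ?T') =
      ?h \<Zsemi> (Nabla M (Src g) (Src g') \<Zsemi> (far M (Val g \<otimes> Val g')
      \<Zsemi> (far M (Nabla M ?T ?T') \<Zsemi> Mu M (?T \<odot> ?T'))))"
    by (rule arg_cong)
  then show "far \<lparr>fob = (\<lambda>(A, B). A \<odot>\<^bsub>K\<^esub> B), far = (\<lambda>(f, g). f \<otimes>\<^bsub>K\<^esub> g)\<rparr> (\<phi> \<Zsemi>\<^bsub>prod_cat K K\<^esub> \<psi>) =
      far \<lparr>fob = (\<lambda>(A, B). A \<odot>\<^bsub>K\<^esub> B), far = (\<lambda>(f, g). f \<otimes>\<^bsub>K\<^esub> g)\<rparr> \<phi> \<Zsemi>\<^bsub>K\<^esub>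
      far \<lparr>fob = (\<lambda>(A, B). A \<odot>\<^bsub>K\<^esub> B), far = (\<lambda>(f, g). f \<otimes>\<^bsub>K\<^esub> g)\<rparr> \<psi>"
    using 2 by (simp add: prod_cat_def)
qed (auto simp: category_prod_cat K.category_axioms, auto simp: prod_cat_def kleisli_arr_iff Hom_iff eta_nabla)

text \<open>Pentagon and triangle involve only pure arrows, so they are images under
  \<open>L\<close> of those in \<open>W\<close>. Naturality is the real content, since it concerns
  arbitrary Kleisli arrows; it rests on \<open>nabla_structure\<close>, the lax monoidality of
  \<open>M\<close>.\<close>

lemma monoidal_category_kleisli: "monoidal_category K"
proof (intro monoidal_category.intro category_kleisli monoidal_category_axioms.intro kleisli_tens_functor)
  fix A B D E
  assume 1: "A \<in> Ob K" "B \<in> Ob K"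
  show "Asc K A (Unt K) B \<Zsemi>\<^bsub>K\<^esub> (Ide K A \<otimes>\<^bsub>K\<^esub> Lun K B) = Run K A \<otimes>\<^bsub>K\<^esub> Ide K B"
    using triangle[of A B] 1
    by (simp add: lift_ide[symmetric] lift_cmp[symmetric] lift_tens[symmetric] del: kleisli_sel(4,5,9))
  assume 2: "D \<in> Ob K"
  then show "Asc K A B D \<in> Hom K ((A \<odot>\<^bsub>K\<^esub> B) \<odot>\<^bsub>K\<^esub> D) (A \<odot>\<^bsub>K\<^esub> (B \<odot>\<^bsub>K\<^esub> D))"
    "iso K (Asc K A B D)"
    using 1 by (auto simp: Hom_iff lift_iso)
  assume "E \<in> Ob K"
  then show "Asc K (A \<odot>\<^bsub>K\<^esub> B) D E \<Zsemi>\<^bsub>K\<^esub> Asc K A B (D \<odot>\<^bsub>K\<^esub> E) =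
      (Asc K A B D \<otimes>\<^bsub>K\<^esub> Ide K E) \<Zsemi>\<^bsub>K\<^esub> Asc K A (B \<odot>\<^bsub>K\<^esub> D) E
        \<Zsemi>\<^bsub>K\<^esub> (Ide K A \<otimes>\<^bsub>K\<^esub> Asc K B D E)"
    using pentagon[of A B D E] 1 2
    by (simp add: lift_ide[symmetric] lift_cmp[symmetric] lift_tens[symmetric] del: kleisli_sel(4,5,9))
next
  fix f g h A A' B B' D D'
  assume 1: "f \<in> Hom K A A'"
  let ?f = "Val f"
  have 2: "?f \<in> Arr W" "Dom W ?f = A" "Cod W ?f = fob M A'" "A' \<in> Ob W" "A \<in> Ob W"
      "f \<in> Arr K" "Src f = A" "Tgt f = A'"
    using 1 hom_ob[of ?f] by (auto simp: kleisli_arr_iff Hom_iff)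
  have 3: "Ide K (Unt W) \<in> Arr K" "Src (Ide K (Unt W)) = Unt W" "Tgt (Ide K (Unt W)) = Unt W"
    "Val (Ide K (Unt W)) = Eta M (Unt W)"
    by (auto simp: kleisli_arr_iff Hom_iff)
  \<comment> \<open>Splitting off \<open>?f\<close> isolates the unit on the left of
    \<open>Nabla\<close>, exactly the configuration of the left unit law in
    \<open>nabla_structure\<close>.\<close>
  have "(Eta M (Unt W) \<otimes> ?f) \<Zsemi> (Nabla M (Unt W) A' \<Zsemi> far M (Lun W A')) =
      (Ide W (Unt W) \<otimes> ?f) \<Zsemi> ((Eta M (Unt W) \<otimes> Ide W (fob M A')) \<Zsemi> (Nabla M (Unt W) A' \<Zsemi> far M (Lun W A')))"
    using 2 by simp
  also have "\<dots> = Lun W A \<Zsemi> ?f"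
    using lun_natural[of ?f A] 2 by (simp add: nabla_structure Hom_iff del: interchange')
  finally have "(Eta M (Unt W) \<otimes> ?f) \<Zsemi> (Nabla M (Unt W) A' \<Zsemi> far M (Lun W A')) = Lun W A \<Zsemi> ?f" .
  then show "(Ide K (Unt K) \<otimes>\<^bsub>K\<^esub> f) \<Zsemi>\<^bsub>K\<^esub> Lun K A' = Lun K A \<Zsemi>\<^bsub>K\<^esub> f"
    using 2 by (simp add: kleisli_cmp_lift lift_cmp_kleisli kleisli_arr_iff Hom_iff del: kleisli_sel(5))
  have "(?f \<otimes> Eta M (Unt W)) \<Zsemi> (Nabla M A' (Unt W) \<Zsemi> far M (Run W A')) =
      (?f \<otimes> Ide W (Unt W)) \<Zsemi> ((Ide W (fob M A') \<otimes> Eta M (Unt W)) \<Zsemi> (Nabla M A' (Unt W) \<Zsemi> far M (Run W A')))"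
    using 2 by simp
  also have "\<dots> = Run W A \<Zsemi> ?f"
    using run_natural[of ?f A] 2 by (simp add: nabla_structure Hom_iff del: interchange')
  finally have "(?f \<otimes> Eta M (Unt W)) \<Zsemi> (Nabla M A' (Unt W) \<Zsemi> far M (Run W A')) = Run W A \<Zsemi> ?f" .
  then show "(f \<otimes>\<^bsub>K\<^esub> Ide K (Unt K)) \<Zsemi>\<^bsub>K\<^esub> Run K A' = Run K A \<Zsemi>\<^bsub>K\<^esub> f"
    using 2 by (simp add: kleisli_cmp_lift lift_cmp_kleisli kleisli_arr_iff Hom_iff del: kleisli_sel(5))
  assume "g \<in> Hom K B B'" "h \<in> Hom K D D'"
  let ?g = "Val g" and ?h = "Val h"
  have 4: "?g \<in> Arr W" "Dom W ?g = B" "Cod W ?g = fob M B'" "B' \<in> Ob W" "B \<in> Ob W"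
      "g \<in> Arr K" "Src g = B" "Tgt g = B'"
      "?h \<in> Arr W" "Dom W ?h = D" "Cod W ?h = fob M D'" "D' \<in> Ob W" "D \<in> Ob W"
      "h \<in> Arr K" "Src h = D" "Tgt h = D'"
    using \<open>g \<in> _\<close> \<open>h \<in> _\<close> hom_ob[of ?g] hom_ob[of ?h] by (auto simp: kleisli_arr_iff Hom_iff)
  let ?x = "Ide W (fob M A') \<otimes> Nabla M B' D'" and ?y = "Nabla M A' (B' \<odot> D')"
  \<comment> \<open>The three arrows are collected in front, so that the remaining
    \<open>Nabla\<close> composite is one side of the lax associativity law and the associator of
    \<open>W\<close> becomes accessible to naturality.\<close>
  have "(((?f \<otimes> ?g) \<Zsemi> Nabla M A' B') \<otimes> ?h) \<Zsemi> (Nabla M (A' \<odot> B') D' \<Zsemi> far M (Asc W A' B' D')) =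
      ((?f \<otimes> ?g) \<otimes> ?h) \<Zsemi> ((Nabla M A' B' \<otimes> Ide W (fob M D')) \<Zsemi> (Nabla M (A' \<odot> B') D' \<Zsemi> far M (Asc W A' B' D')))"
    using 2 4 by simp
  also have "\<dots> = ((?f \<otimes> ?g) \<otimes> ?h) \<Zsemi> (Asc W (fob M A') (fob M B') (fob M D') \<Zsemi> (?x \<Zsemi> ?y))"
    using 2 4 by (simp only: nabla_structure)
  also have "\<dots> = Asc W A B D \<Zsemi> ((?f \<otimes> (?g \<otimes> ?h)) \<Zsemi> (?x \<Zsemi> ?y))"
    using asc_natural_arr[of ?f ?g ?h] 2 4 by (intro cmp_left_eq) simp_all
  also have "\<dots> = Asc W A B D \<Zsemi> ((?f \<otimes> ((?g \<otimes> ?h) \<Zsemi> Nabla M B' D')) \<Zsemi> ?y)"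
    using 2 4 by simp
  finally show "((f \<otimes>\<^bsub>K\<^esub> g) \<otimes>\<^bsub>K\<^esub> h) \<Zsemi>\<^bsub>K\<^esub> Asc K A' B' D' = Asc K A B D \<Zsemi>\<^bsub>K\<^esub> (f \<otimes>\<^bsub>K\<^esub> (g \<otimes>\<^bsub>K\<^esub> h))"
    using 2 4 by (simp add: kleisli_cmp_lift lift_cmp_kleisli kleisli_arr_iff Hom_iff del: kleisli_sel(5))
qed (auto simp: Hom_iff lift_iso)

lemma symmetric_monoidal_category_kleisli: "symmetric_monoidal_category K"
proof (intro symmetric_monoidal_category.intro symmetry.intro monoidal_category_kleisli symmetry_axioms.intro)
  fix A B D
  assume 1: "A \<in> Ob K"
  then show "Sym K A (Unt K) \<Zsemi>\<^bsub>K\<^esub> Lun K A = Run K A"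
    using sym_unit[of A] by (simp add: lift_cmp[symmetric] del: kleisli_sel(5))
  assume 2: "B \<in> Ob K"
  show "Sym K A B \<in> Hom K (A \<odot>\<^bsub>K\<^esub> B) (B \<odot>\<^bsub>K\<^esub> A)"
    using 1 2 by (simp add: Hom_iff)
  show "Sym K A B \<Zsemi>\<^bsub>K\<^esub> Sym K B A = Ide K (A \<odot>\<^bsub>K\<^esub> B)"
    using 1 2 by (simp add: lift_cmp[symmetric] lift_ide[symmetric] sym_sym del: kleisli_sel(4,5))
  assume "D \<in> Ob K"
  then show "Asc K A B D \<Zsemi>\<^bsub>K\<^esub> Sym K A (B \<odot>\<^bsub>K\<^esub> D) \<Zsemi>\<^bsub>K\<^esub> Asc K B D A =
      (Sym K A B \<otimes>\<^bsub>K\<^esub> Ide K D) \<Zsemi>\<^bsub>K\<^esub> Asc K B A D \<Zsemi>\<^bsub>K\<^esub> (Ide K B \<otimes>\<^bsub>K\<^esub> Sym K A D)"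
    using hexagon[of A B D] 1 2
    by (simp add: lift_ide[symmetric] lift_cmp[symmetric] lift_tens[symmetric] del: kleisli_sel(4,5,9))
next
  fix f g A A' B B'
  assume 1: "f \<in> Hom K A A'" "g \<in> Hom K B B'"
  let ?f = "Val f" and ?g = "Val g"
  have 2: "?f \<in> Arr W" "Dom W ?f = A" "Cod W ?f = fob M A'" "A' \<in> Ob W" "A \<in> Ob W"
      "f \<in> Arr K" "Src f = A" "Tgt f = A'"
      "?g \<in> Arr W" "Dom W ?g = B" "Cod W ?g = fob M B'" "B' \<in> Ob W" "B \<in> Ob W"
      "g \<in> Arr K" "Src g = B" "Tgt g = B'"
    using 1 hom_ob[of ?f] hom_ob[of ?g] by (auto simp: kleisli_arr_iff Hom_iff)
  have "(?f \<otimes> ?g) \<Zsemi> (Nabla M A' B' \<Zsemi> far M (Sym W A' B')) =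
      (?f \<otimes> ?g) \<Zsemi> (Sym W (fob M A') (fob M B') \<Zsemi> Nabla M B' A')"
    using 2 by (simp only: nabla_sym)
  also have "\<dots> = Sym W A B \<Zsemi> ((?g \<otimes> ?f) \<Zsemi> Nabla M B' A')"
    using sym_natural_arr[of ?f ?g] 2 by (intro cmp_left_eq) simp_all
  finally show "(f \<otimes>\<^bsub>K\<^esub> g) \<Zsemi>\<^bsub>K\<^esub> Sym K A' B' = Sym K A B \<Zsemi>\<^bsub>K\<^esub> (g \<otimes>\<^bsub>K\<^esub> f)"
    using 2 by (simp add: kleisli_cmp_lift lift_cmp_kleisli kleisli_arr_iff Hom_iff del: kleisli_sel(5))
qed

text \<open>\<open>L\<close> preserves composition, tensor and inverses, and every factor of the
  middle swap of \<open>K\<close> is pure. This is why the tensorators are given by coherence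
  isomorphisms of \<open>W\<close>.\<close>

lemma kleisli_middle_swap:
  assumes "A \<in> Ob W" and "B \<in> Ob W" and "D \<in> Ob W" and "E \<in> Ob W"
  shows "middle_swap K A B D E = L (middle_swap W A B D E)"
  unfolding middle_swap_def using assms
  by (simp add: lift_ide[symmetric] lift_cmp[symmetric] lift_tens[symmetric]
      lift_inverse_of[symmetric] del: kleisli_sel(4,5,9))

lemma full_strict_monoidal_subcategory_kleisli:
  assumes "full_strict_monoidal_subcategory W U"
  shows "full_strict_monoidal_subcategory K U"
proof -
  interpret U: full_strict_monoidal_subcategory W U by fact
  have "A \<in> U \<Longrightarrow> A \<in> Ob W" for A
    using U.sub_ob by auto
  then show ?thesis
    by (intro full_strict_monoidal_subcategory.intro full_strict_monoidal_subcategory_axioms.intro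
        monoidal_category_kleisli)
      (auto simp: U.sub_unt U.sub_tens U.sub_assoc U.sub_lun U.sub_run lift_ide simp del: kleisli_sel(4))
qed

text \<open>The comparisons of \<open>kleisli_incl\<close> are identities, so those of the composite
  are the lifts of \<open>eps F\<close> and \<open>tld F\<close>, and each axiom is the image under
  \<open>L\<close> of the same axiom for \<open>F\<close>.\<close>

lemma lax_symmetric_monoidal_functor_kleisli:
  assumes "lax_symmetric_monoidal_functor V W F"
  shows "lax_symmetric_monoidal_functor V K (comp_laxfun K F (kleisli_incl W M))"
    (is "lax_symmetric_monoidal_functor V K ?G")
proof -
  interpret F: lax_symmetric_monoidal_functor V W F by fact
  have eps: "eps ?G = L (eps F)"
    by (simp add: comp_laxfun_def kleisli_incl_def lift_ide[symmetric] lift_cmp[symmetric] del: kleisli_sel(4,5))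
  have tld: "tld ?G A B = L (tld F A B)" if "A \<in> Ob V" "B \<in> Ob V" for A B
    using that by (simp add: comp_laxfun_def kleisli_incl_def lift_ide[symmetric] lift_cmp[symmetric]
        del: kleisli_sel(4,5))
  have fob: "fob ?G A = fob F A" and far: "far ?G f = L (far F f)" for A f
    by (simp_all add: comp_laxfun_def kleisli_incl_def)
  note lift = lift_ide[symmetric] lift_cmp[symmetric] lift_tens[symmetric]
  have *: "f \<in> Hom V A B \<Longrightarrow> f \<in> Arr V" for f A B
    by (simp add: Hom_iff)
  have "category_functor V K ?G"
    by (rule category_functorI)
      (auto simp: fob far lift F.far_ide F.far_cmp_arr Hom_iff F.V.category_axioms
        K.category_axioms simp del: kleisli_sel(4,5))
  then show ?thesis
    by (intro lax_symmetric_monoidal_functor.intro lax_monoidal_functor.intro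
        lax_monoidal_functor_axioms.intro lax_symmetric_monoidal_functor_axioms.intro
        F.V.monoidal_category_axioms monoidal_category_kleisli symmetric_monoidal_category_kleisli
        F.V.symmetric_monoidal_category_axioms)
      (insert F.tld_natural F.tld_assoc F.tld_lun F.tld_run F.tld_sym,
        auto simp: eps tld fob far lift Hom_iff
        simp del: kleisli_sel(4,5,9))
qed

end

section \<open>Strict parameters and partial slices\<close>

lemma arrow_eq_iff: "\<alpha> = \<beta> \<longleftrightarrow> Src \<alpha> = Src \<beta> \<and> Val \<alpha> = Val \<beta> \<and> Tgt \<alpha> = Tgt \<beta>"
  by (cases \<alpha>; cases \<beta>) auto

locale strict_subcategory =
  symmetric_monoidal_category K + full_strict_monoidal_subcategory K U
  for K :: "('o, 'a, 'z) smoncat_scheme" (structure) and U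
begin

lemma sub_simps [simp]:
  assumes "A \<in> U"
  shows "A \<in> Ob K" and "Unt K \<odot> A = A" and "A \<odot> Unt K = A"
    and "B \<in> U \<Longrightarrow> A \<odot> B \<in> U"
    and "B \<in> U \<Longrightarrow> D \<in> U \<Longrightarrow> (A \<odot> B) \<odot> D = A \<odot> (B \<odot> D)"
    and "B \<in> U \<Longrightarrow> D \<in> U \<Longrightarrow> Asc K A B D = Ide K (A \<odot> (B \<odot> D))"
    and "Lun K A = Ide K A" and "Run K A = Ide K A"
  using assms sub_ob sub_tens sub_assoc sub_lun sub_run by auto

lemma sub_unt_simp [simp]: "Unt K \<in> U"
  by (rule sub_unt)

text \<open>Naturality exchanges the associator at the codomains for the one at the domains, which
  is an identity in \<open>U\<close>. The codomains may be objects such as \<open>G A\<close>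
  outside \<open>U\<close>, which is the case needed for generalized elements.\<close>

lemma tens_assoc_sub:
  assumes "f \<in> Arr K" and "g \<in> Arr K" and "h \<in> Arr K"
    and "Dom K f \<in> U" and "Dom K g \<in> U" and "Dom K h \<in> U"
  shows "((f \<otimes> g) \<otimes> h) \<Zsemi> Asc K (Cod K f) (Cod K g) (Cod K h) = f \<otimes> (g \<otimes> h)"
  using asc_natural_arr[of f g h] assms by simp

lemma tens_assoc [simp]:
  assumes "f \<in> Arr K" and "g \<in> Arr K" and "h \<in> Arr K"
    and "Dom K f \<in> U" and "Dom K g \<in> U" and "Dom K h \<in> U"
    and "Cod K f \<in> U" and "Cod K g \<in> U" and "Cod K h \<in> U"
  shows "(f \<otimes> g) \<otimes> h = f \<otimes> (g \<otimes> h)"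
  using asc_natural_arr[of f g h] assms by simp

lemma tens_unt [simp]:
  assumes "f \<in> Arr K" and "Dom K f \<in> U" and "Cod K f \<in> U"
  shows "Ide K (Unt K) \<otimes> f = f" and "f \<otimes> Ide K (Unt K) = f"
  using lun_natural[of f "Dom K f" "Cod K f"] run_natural[of f "Dom K f" "Cod K f"] assms
  by (simp_all add: Hom_iff)

lemma tens_unt_natural:
  assumes "f \<in> Arr K" and "Dom K f \<in> U"
  shows "(Ide K (Unt K) \<otimes> f) \<Zsemi> Lun K (Cod K f) = f"
    and "(f \<otimes> Ide K (Unt K)) \<Zsemi> Run K (Cod K f) = f"
  using lun_natural[of f "Dom K f" "Cod K f"] run_natural[of f "Dom K f" "Cod K f"] assms
  by (simp_all add: Hom_iff)

section \<open>Braidings and middle swaps of parameter objects\<close>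

lemma middle_swap_sub:
  assumes "A \<in> U" and "B \<in> U" and "D \<in> U" and "E \<in> U"
  shows "middle_swap K A B D E = Ide K A \<otimes> (Sym K B D \<otimes> Ide K E)"
  using assms by (simp add: middle_swap_def)

lemma sym_tens_right:
  assumes "A \<in> U" and "B \<in> U" and "D \<in> U"
  shows "Sym K A (B \<odot> D) = (Sym K A B \<otimes> Ide K D) \<Zsemi> (Ide K B \<otimes> Sym K A D)"
  using hexagon[of A B D] assms by simp

text \<open>The second hexagon, obtained by inverting the first: both sides are inverse to
  \<open>Sym K D (A \<odot> B)\<close>, and inverses are unique.\<close>

lemma sym_tens_left:
  assumes "A \<in> U" and "B \<in> U" and "D \<in> U"
  shows "Sym K (A \<odot> B) D = (Ide K A \<otimes> Sym K B D) \<Zsemi> (Sym K A D \<otimes> Ide K B)"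
proof (rule inverse_arrows_unique)
  show "inverse_arrows K (Sym K D (A \<odot> B)) (Sym K (A \<odot> B) D)"
    using assms by (intro sym_inverse_arrows) simp_all
  show "inverse_arrows K (Sym K D (A \<odot> B)) ((Ide K A \<otimes> Sym K B D) \<Zsemi> (Sym K A D \<otimes> Ide K B))"
    unfolding sym_tens_right[OF assms(3,1,2)] using assms
    by (intro inverse_arrows_cmp tens_inverse_arrows inverse_arrows_ide sym_inverse_arrows) simp_all
qed

lemma sym_unt [simp]:
  assumes "A \<in> U"
  shows "Sym K A (Unt K) = Ide K A" and "Sym K (Unt K) A = Ide K A"
proof -
  show 1: "Sym K A (Unt K) = Ide K A"
    using sym_unit[of A] assms by simp
  show "Sym K (Unt K) A = Ide K A"
    using sym_sym[of A "Unt K"] assms by (simp add: 1)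
qed

lemma middle_swap_natural:
  assumes "f1 \<in> Hom K u1 u1'" and "f2 \<in> Hom K u2 u2'" and "g1 \<in> Hom K v1 v1'" and "g2 \<in> Hom K v2 v2'"
    and "{u1, u2, v1, v2, u1', u2', v1', v2'} \<subseteq> U"
  shows "((f1 \<otimes> f2) \<otimes> (g1 \<otimes> g2)) \<Zsemi> middle_swap K u1' u2' v1' v2' =
    middle_swap K u1 u2 v1 v2 \<Zsemi> ((f1 \<otimes> g1) \<otimes> (f2 \<otimes> g2))"
proof -
  \<comment> \<open>These equations bracket the two inner factors together, against the direction of
    the simplification rule \<open>tens_assoc\<close>, so that naturality of the symmetry applies to
    them as one tensor.\<close>
  have 1: "f2 \<otimes> (g1 \<otimes> g2) = (f2 \<otimes> g1) \<otimes> g2" "g1 \<otimes> (f2 \<otimes> g2) = (g1 \<otimes> f2) \<otimes> g2"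
    using assms by (simp_all add: Hom_iff)
  have 2: "(f2 \<otimes> g1) \<Zsemi> Sym K u2' v1' = Sym K u2 v1 \<Zsemi> (g1 \<otimes> f2)"
    using sym_natural_arr[of f2 g1] assms by (auto simp: Hom_iff)
  have "((f1 \<otimes> f2) \<otimes> (g1 \<otimes> g2)) \<Zsemi> middle_swap K u1' u2' v1' v2' =
      (f1 \<otimes> (f2 \<otimes> (g1 \<otimes> g2))) \<Zsemi> (Ide K u1' \<otimes> (Sym K u2' v1' \<otimes> Ide K v2'))"
    using assms by (simp add: middle_swap_sub Hom_iff)
  also have "\<dots> = f1 \<otimes> (((f2 \<otimes> g1) \<Zsemi> Sym K u2' v1') \<otimes> g2)"
    unfolding 1 using assms by (simp add: Hom_iff del: tens_assoc)
  also have "\<dots> = (Ide K u1 \<otimes> (Sym K u2 v1 \<otimes> Ide K v2)) \<Zsemi> (f1 \<otimes> ((g1 \<otimes> f2) \<otimes> g2))"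
    unfolding 2 using assms by (simp add: Hom_iff del: tens_assoc)
  also have "\<dots> = middle_swap K u1 u2 v1 v2 \<Zsemi> ((f1 \<otimes> g1) \<otimes> (f2 \<otimes> g2))"
    using assms by (simp add: middle_swap_sub Hom_iff)
  finally show ?thesis .
qed

lemma ide_tens_ide_tens: "A \<in> U \<Longrightarrow> B \<in> U \<Longrightarrow> f \<in> Arr K \<Longrightarrow> Dom K f \<in> U \<Longrightarrow> Cod K f \<in> U \<Longrightarrow>
    Ide K A \<otimes> (Ide K B \<otimes> f) = Ide K (A \<odot> B) \<otimes> f"
  by (simp flip: tens_assoc tens_ide)

text \<open>
  These rules turn a composite of braidings into a composite of braidings that are tensored
  with one identity on either side; only the order of the factors is then left open.
\<close>

lemmas whisker_simps = middle_swap_sub sym_tens_left sym_tens_right tens_cmp_left tens_cmp_right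
  ide_tens_ide_tens

text \<open>Arrows acting on disjoint blocks of a tensor product commute. \<open>P\<close> and
  \<open>Q\<close> are the untouched outer blocks, and \<open>x\<close> is the tail of a
  right-nested composite; after \<open>whisker_simps\<close>, this is the only remaining freedom in
  the order of crossings.\<close>

lemma whisker_exchange:
  assumes "f \<in> Hom K A A'" and "g \<in> Hom K B B'" and "{P, Q, A, A', B, B'} \<subseteq> U" and "x \<in> Arr K"
    and "Dom K x = P \<odot> (A' \<odot> (B' \<odot> Q))"
  shows "(Ide K P \<otimes> (f \<otimes> Ide K (B \<odot> Q))) \<Zsemi> ((Ide K (P \<odot> A') \<otimes> (g \<otimes> Ide K Q)) \<Zsemi> x) =
    (Ide K (P \<odot> A) \<otimes> (g \<otimes> Ide K Q)) \<Zsemi> ((Ide K P \<otimes> (f \<otimes> Ide K (B' \<odot> Q))) \<Zsemi> x)"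
proof -
  have "(Ide K P \<otimes> (f \<otimes> Ide K (B \<odot> Q))) \<Zsemi> (Ide K (P \<odot> A') \<otimes> (g \<otimes> Ide K Q)) =
      (Ide K P \<otimes> (f \<otimes> Ide K (B \<odot> Q))) \<Zsemi> (Ide K P \<otimes> (Ide K A' \<otimes> (g \<otimes> Ide K Q)))"
    using assms by (simp add: ide_tens_ide_tens Hom_iff del: interchange interchange')
  also have "\<dots> = (Ide K P \<otimes> (Ide K A \<otimes> (g \<otimes> Ide K Q))) \<Zsemi> (Ide K P \<otimes> (f \<otimes> Ide K (B' \<odot> Q)))"
    using assms by (simp add: Hom_iff)
  also have "\<dots> = (Ide K (P \<odot> A) \<otimes> (g \<otimes> Ide K Q)) \<Zsemi> (Ide K P \<otimes> (f \<otimes> Ide K (B' \<odot> Q)))"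
    using assms by (simp add: ide_tens_ide_tens Hom_iff del: interchange interchange')
  finally show ?thesis
    by (rule cmp_left_eq) (use assms in \<open>auto simp: Hom_iff\<close>)
qed

text \<open>This is the associativity axiom for tensorators. By the hexagons both sides are made of
  the crossings of \<open>u2\<close> with \<open>v1\<close>, of \<open>v2\<close> with
  \<open>w1\<close>, and then of \<open>u2\<close> with \<open>w1\<close>. The first two occur in
  opposite orders and act on disjoint blocks; the third is the common tail.\<close>

lemma middle_swap_assoc:
  assumes "{u1, u2, v1, v2, w1, w2} \<subseteq> U"
  shows "(middle_swap K u1 u2 v1 v2 \<otimes> Ide K (w1 \<odot> w2)) \<Zsemi> middle_swap K (u1 \<odot> v1) (u2 \<odot> v2) w1 w2 =
    (Ide K (u1 \<odot> u2) \<otimes> middle_swap K v1 v2 w1 w2) \<Zsemi> middle_swap K u1 u2 (v1 \<odot> w1) (v2 \<odot> w2)"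
  using assms whisker_exchange[of "Sym K u2 v1" "u2 \<odot> v1" "v1 \<odot> u2" "Sym K v2 w1" "v2 \<odot> w1" "w1 \<odot> v2"
      u1 w2 "Ide K (u1 \<odot> v1) \<otimes> (Sym K u2 w1 \<otimes> Ide K (v2 \<odot> w2))"]
  by (simp add: whisker_simps Hom_iff del: interchange interchange')

text \<open>Compatibility of tensorators with the associator. Both sides begin with the crossing of
  \<open>u3\<close> with \<open>v1\<close> and then perform those of \<open>u3\<close> with
  \<open>v2\<close> and \<open>u2\<close> with \<open>v1\<close>, in opposite orders. As the
  exchanged pair comes last, the tail passed to \<open>whisker_exchange\<close> is an
  identity.\<close>

lemma middle_swap_asc:
  assumes "{u1, u2, u3, v1, v2, v3} \<subseteq> U"
  shows "middle_swap K (u1 \<odot> u2) u3 (v1 \<odot> v2) v3 \<Zsemi> (middle_swap K u1 u2 v1 v2 \<otimes> Ide K (u3 \<odot> v3)) =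
    middle_swap K u1 (u2 \<odot> u3) v1 (v2 \<odot> v3) \<Zsemi> (Ide K (u1 \<odot> v1) \<otimes> middle_swap K u2 u3 v2 v3)"
  using assms whisker_exchange[of "Sym K u2 v1" "u2 \<odot> v1" "v1 \<odot> u2" "Sym K u3 v2" "u3 \<odot> v2" "v2 \<odot> u3"
      u1 v3 "Ide K (u1 \<odot> (v1 \<odot> (u2 \<odot> (v2 \<odot> (u3 \<odot> v3)))))"]
  by (simp add: whisker_simps Hom_iff del: interchange interchange')

text \<open>The composition axiom for the pseudonatural symmetry. The large braiding on the left
  contains the crossing of \<open>v1\<close> with \<open>u2\<close>, which undoes the middle swap by
  \<open>sym_sym\<close>. Of the three crossings left, those of \<open>u1\<close> with
  \<open>u2\<close> and of \<open>v1\<close> with \<open>v2\<close> are disjoint and may be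
  reordered.\<close>

lemma middle_swap_sym:
  assumes "{u1, u2, v1, v2} \<subseteq> U"
  shows "middle_swap K u1 u2 v1 v2 \<Zsemi> Sym K (u1 \<odot> v1) (u2 \<odot> v2) =
    (Ide K (u1 \<odot> u2) \<otimes> Sym K v1 v2) \<Zsemi> ((Sym K u1 u2 \<otimes> Ide K (v2 \<odot> v1)) \<Zsemi> middle_swap K u2 u1 v2 v1)"
proof -
  have "(Ide K u1 \<otimes> (Sym K u2 v1 \<otimes> Ide K v2)) \<Zsemi> ((Ide K u1 \<otimes> (Sym K v1 u2 \<otimes> Ide K v2)) \<Zsemi> x) = x"
    if "x \<in> Arr K" "Dom K x = u1 \<odot> (u2 \<odot> (v1 \<odot> v2))" for x
    using assms that by (simp add: sym_sym)
  moreover have "(Sym K u1 u2 \<otimes> Ide K (v1 \<odot> v2)) \<Zsemi> ((Ide K (u2 \<odot> u1) \<otimes> Sym K v1 v2)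
        \<Zsemi> (Ide K u2 \<otimes> (Sym K u1 v2 \<otimes> Ide K v1))) =
      (Ide K (u1 \<odot> u2) \<otimes> Sym K v1 v2) \<Zsemi> ((Sym K u1 u2 \<otimes> Ide K (v2 \<odot> v1))
        \<Zsemi> (Ide K u2 \<otimes> (Sym K u1 v2 \<otimes> Ide K v1)))"
    using assms by simp
  ultimately show ?thesis
    using assms by (simp add: whisker_simps del: interchange interchange')
qed

lemma middle_swap_unt [simp]:
  assumes "u1 \<in> U" and "u2 \<in> U"
  shows "middle_swap K (Unt K) (Unt K) u1 u2 = Ide K (u1 \<odot> u2)"
    and "middle_swap K u1 u2 (Unt K) (Unt K) = Ide K (u1 \<odot> u2)"
    and "middle_swap K (Unt K) u1 (Unt K) u2 = Ide K (u1 \<odot> u2)"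
    and "middle_swap K u1 (Unt K) u2 (Unt K) = Ide K (u1 \<odot> u2)"
  using assms by (simp_all add: middle_swap_sub)

section \<open>Slice categories over the parameter objects\<close>

lemma slice_ob_iff:
  "a \<in> Ob (slice_cat (full_subcategory K U) K A) \<longleftrightarrow>
     fst a \<in> U \<and> snd a \<in> Arr K \<and> Dom K (snd a) = fst a \<and> Cod K (snd a) = A"
  by (cases a) (auto simp: slice_cat_def full_subcategory_def Hom_iff)

lemma slice_sel [simp]:
  "Dom (slice_cat (full_subcategory K U) K A) = Src"
  "Cod (slice_cat (full_subcategory K U) K A) = Tgt"
  "Ide (slice_cat (full_subcategory K U) K A) a = Arrow a (Ide K (fst a)) a"
  "\<alpha> \<Zsemi>\<^bsub>slice_cat (full_subcategory K U) K A\<^esub> \<beta> = Arrow (Src \<alpha>) (Val \<alpha> \<Zsemi> Val \<beta>) (Tgt \<beta>)"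
  by (simp_all add: slice_cat_def full_subcategory_def case_prod_unfold)

lemma slice_hom_iff:
  "\<alpha> \<in> Hom (slice_cat (full_subcategory K U) K A) a b \<longleftrightarrow>
     a \<in> Ob (slice_cat (full_subcategory K U) K A) \<and> b \<in> Ob (slice_cat (full_subcategory K U) K A) \<and>
     Src \<alpha> = a \<and> Tgt \<alpha> = b \<and>
     Val \<alpha> \<in> Arr K \<and> Dom K (Val \<alpha>) = fst a \<and> Cod K (Val \<alpha>) = fst b \<and> snd a = Val \<alpha> \<Zsemi> snd b"
proof -
  obtain u f \<phi> v g where "\<alpha> = Arrow (u, f) \<phi> (v, g)"
    by (cases \<alpha>) auto
  then show ?thesis
    by (auto simp: slice_ob_iff Hom_iff simp del: cmp_simps)
      (auto simp: slice_cat_def full_subcategory_def Hom_iff simp del: cmp_simps)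
qed

lemma slice_arr_iff:
  "\<alpha> \<in> Arr (slice_cat (full_subcategory K U) K A) \<longleftrightarrow>
     \<alpha> \<in> Hom (slice_cat (full_subcategory K U) K A) (Src \<alpha>) (Tgt \<alpha>)"
  by (simp add: Hom_iff)

lemma slice_arr_endpoints:
  assumes "\<alpha> \<in> Arr (slice_cat (full_subcategory K U) K A)"
  shows "Src \<alpha> \<in> Ob (slice_cat (full_subcategory K U) K A) \<and>
    Tgt \<alpha> \<in> Ob (slice_cat (full_subcategory K U) K A) \<and>
    Val \<alpha> \<in> Arr K \<and> Dom K (Val \<alpha>) = fst (Src \<alpha>) \<and> Cod K (Val \<alpha>) = fst (Tgt \<alpha>)"
  using assms by (simp_all add: slice_arr_iff slice_hom_iff)

lemma category_slice: "category (slice_cat (full_subcategory K U) K A)" (is "category ?S")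
proof
  fix \<alpha> \<beta> \<gamma> a b c d
  show "\<alpha> \<in> Arr ?S \<Longrightarrow> Dom ?S \<alpha> \<in> Ob ?S" "\<alpha> \<in> Arr ?S \<Longrightarrow> Cod ?S \<alpha> \<in> Ob ?S"
    by (simp_all add: slice_arr_iff slice_hom_iff)
  show "a \<in> Ob ?S \<Longrightarrow> Ide ?S a \<in> Hom ?S a a"
    by (simp add: slice_hom_iff slice_ob_iff)
  assume 1: "\<alpha> \<in> Hom ?S a b"
  show "Ide ?S a \<Zsemi>\<^bsub>?S\<^esub> \<alpha> = \<alpha>" "\<alpha> \<Zsemi>\<^bsub>?S\<^esub> Ide ?S b = \<alpha>"
    using 1 by (simp_all add: slice_hom_iff arrow_eq_iff)
  assume 2: "\<beta> \<in> Hom ?S b c"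
  show "\<alpha> \<Zsemi>\<^bsub>?S\<^esub> \<beta> \<in> Hom ?S a c"
    using 1 2 by (simp add: slice_hom_iff slice_ob_iff)
  assume "\<gamma> \<in> Hom ?S c d"
  with 1 2 show "(\<alpha> \<Zsemi>\<^bsub>?S\<^esub> \<beta>) \<Zsemi>\<^bsub>?S\<^esub> \<gamma> = \<alpha> \<Zsemi>\<^bsub>?S\<^esub> (\<beta> \<Zsemi>\<^bsub>?S\<^esub> \<gamma>)"
    by (simp add: slice_hom_iff)
qed

text \<open>Precomposing the triangle of \<open>\<alpha>\<close> with the inverse of
  \<open>Val \<alpha>\<close> gives the triangle of the inverse, so invertibility can be tested in
  \<open>K\<close>.\<close>

lemma slice_iso:
  assumes "\<alpha> \<in> Arr (slice_cat (full_subcategory K U) K A)" and "iso K (Val \<alpha>)"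
  shows "iso (slice_cat (full_subcategory K U) K A) \<alpha>"
proof -
  have "inverse_arrows (slice_cat (full_subcategory K U) K A) \<alpha>
      (Arrow (Tgt \<alpha>) (inverse_of K (Val \<alpha>)) (Src \<alpha>))"
    using assms by (simp add: inverse_arrows_def slice_hom_iff slice_arr_iff slice_ob_iff)
  then show ?thesis
    by (auto simp: iso_def)
qed

end

section \<open>Generalized elements and the slice functor along \<open>G\<close>\<close>

locale slice_setting =
  V: symmetric_monoidal_category V + K: strict_subcategory K U +
  lax_symmetric_monoidal_functor V K G
  for V :: "('vo, 'va, 'y) smoncat_scheme" and K :: "('o, 'a, 'z) smoncat_scheme" (structure)
    and G :: "('vo, 'va, 'o, 'a, 'w) laxfun_scheme" and U
begin

abbreviation "N \<equiv> comp_catfun G (partial_slice (full_subcategory K U) K)"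

text \<open>
  Arrows \<open>u \<rightarrow> G A\<close> with \<open>u \<in> U\<close> are treated as generalized elements of \<open>A\<close>: an arrow \<open>h : A \<rightarrow> B\<close> of
  \<open>V\<close> acts on them by \<open>f \<Zsemi> far G h\<close>, and \<open>pair\<close> is their tensor product. Because \<open>U\<close> is strict, the
  associator and the unitors of \<open>V\<close> act without changing the parameter object, so equations between
  arrows of \<open>V\<close> become equations between generalized elements.
\<close>

definition pair :: "'vo \<Rightarrow> 'vo \<Rightarrow> 'a \<Rightarrow> 'a \<Rightarrow> 'a" where
  "pair A B f g = (f \<otimes> g) \<Zsemi> tld G A B"

lemma pair_simps [simp]:
  assumes "A \<in> Ob V" and "B \<in> Ob V" and "f \<in> Arr K" and "g \<in> Arr K"
    and "Cod K f = fob G A" and "Cod K g = fob G B"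
  shows "pair A B f g \<in> Arr K" and "Dom K (pair A B f g) = Dom K f \<odot> Dom K g"
    and "Cod K (pair A B f g) = fob G (A \<odot>\<^bsub>V\<^esub> B)"
  using assms by (simp_all add: pair_def)

lemma pair_far:
  assumes "h \<in> Arr V" and "k \<in> Arr V" and "f \<in> Arr K" and "g \<in> Arr K"
    and "Cod K f = fob G (Dom V h)" and "Cod K g = fob G (Dom V k)"
    and "Cod V h = A" and "Cod V k = B"
  shows "pair A B (f \<Zsemi> far G h) (g \<Zsemi> far G k) =
    pair (Dom V h) (Dom V k) f g \<Zsemi> far G (h \<otimes>\<^bsub>V\<^esub> k)"
proof -
  have "A \<in> Ob V" "B \<in> Ob V"
    using assms by auto
  then have "((f \<otimes> g) \<Zsemi> (far G h \<otimes> far G k)) \<Zsemi> tld G A B =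
      (f \<otimes> g) \<Zsemi> (tld G (Dom V h) (Dom V k) \<Zsemi> far G (h \<otimes>\<^bsub>V\<^esub> k))"
    using tld_natural_arr[of h k] assms by (simp del: K.interchange K.interchange')
  then show ?thesis
    using assms by (simp add: pair_def)
qed

lemma pair_cmp:
  assumes "A \<in> Ob V" and "B \<in> Ob V" and "f \<in> Arr K" and "g \<in> Arr K"
    and "Cod K f = fob G A" and "Cod K g = fob G B" and "\<phi> \<in> Arr K" and "\<psi> \<in> Arr K"
    and "Cod K \<phi> = Dom K f" and "Cod K \<psi> = Dom K g"
  shows "pair A B (\<phi> \<Zsemi> f) (\<psi> \<Zsemi> g) = (\<phi> \<otimes> \<psi>) \<Zsemi> pair A B f g"
  using assms by (simp add: pair_def)

text \<open>The associativity law of \<open>tld\<close> replaces the associator of \<open>V\<close>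
  by one of \<open>K\<close> at the objects \<open>G A\<close>, \<open>G B\<close>,
  \<open>G D\<close>; \<open>tens_assoc_sub\<close> then makes it disappear at the parameter
  objects.\<close>

lemma pair_asc:
  assumes "A \<in> Ob V" and "B \<in> Ob V" and "D \<in> Ob V" and "f \<in> Arr K" and "g \<in> Arr K" and "h \<in> Arr K"
    and "Cod K f = fob G A" and "Cod K g = fob G B" and "Cod K h = fob G D"
    and "{Dom K f, Dom K g, Dom K h} \<subseteq> U"
  shows "pair (A \<odot>\<^bsub>V\<^esub> B) D (pair A B f g) h \<Zsemi> far G (Asc V A B D) =
    pair A (B \<odot>\<^bsub>V\<^esub> D) f (pair B D g h)"
proof -
  let ?a = "Asc K (fob G A) (fob G B) (fob G D)"
  let ?t = "(Ide K (fob G A) \<otimes> tld G B D) \<Zsemi> tld G A (B \<odot>\<^bsub>V\<^esub> D)"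
  have "pair (A \<odot>\<^bsub>V\<^esub> B) D (pair A B f g) h \<Zsemi> far G (Asc V A B D) =
      ((f \<otimes> g) \<otimes> h) \<Zsemi> ((tld G A B \<otimes> Ide K (fob G D)) \<Zsemi>
        tld G (A \<odot>\<^bsub>V\<^esub> B) D \<Zsemi> far G (Asc V A B D))"
    using assms by (simp add: pair_def)
  also have "\<dots> = ((f \<otimes> g) \<otimes> h) \<Zsemi> (?a \<Zsemi> ?t)"
    using assms by (simp add: tld_structure del: K.interchange K.interchange')
  also have "\<dots> = (((f \<otimes> g) \<otimes> h) \<Zsemi> ?a) \<Zsemi> ?t"
    using assms by simp
  also have "\<dots> = (f \<otimes> (g \<otimes> h)) \<Zsemi> ?t"
    using K.tens_assoc_sub[of f g h] assms by simp
  also have "\<dots> = pair A (B \<odot>\<^bsub>V\<^esub> D) f (pair B D g h)"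
    using assms by (simp add: pair_def)
  finally show ?thesis .
qed

lemma pair_eps:
  assumes "A \<in> Ob V" and "f \<in> Arr K" and "Cod K f = fob G A" and "Dom K f \<in> U"
  shows "pair (Unt V) A (eps G) f \<Zsemi> far G (Lun V A) = f"
    and "pair A (Unt V) f (eps G) \<Zsemi> far G (Run V A) = f"
proof -
  have "pair (Unt V) A (eps G) f \<Zsemi> far G (Lun V A) =
      (Ide K (Unt K) \<otimes> f) \<Zsemi> ((eps G \<otimes> Ide K (fob G A)) \<Zsemi>
        tld G (Unt V) A \<Zsemi> far G (Lun V A))"
    using assms by (simp add: pair_def)
  also have "\<dots> = f"
    using K.tens_unt_natural(1)[of f] assms by (simp add: tld_structure del: K.interchange K.interchange')
  finally show "pair (Unt V) A (eps G) f \<Zsemi> far G (Lun V A) = f" .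
  have "pair A (Unt V) f (eps G) \<Zsemi> far G (Run V A) =
      (f \<otimes> Ide K (Unt K)) \<Zsemi> ((Ide K (fob G A) \<otimes> eps G) \<Zsemi>
        tld G A (Unt V) \<Zsemi> far G (Run V A))"
    using assms by (simp add: pair_def)
  also have "\<dots> = f"
    using K.tens_unt_natural(2)[of f] assms by (simp add: tld_structure del: K.interchange K.interchange')
  finally show "pair A (Unt V) f (eps G) \<Zsemi> far G (Run V A) = f" .
qed

text \<open>The same move as for the associator, but the symmetry arriving at the parameter objects
  need not be an identity. It is the source of the tensorators and of the structure 2-cells of the
  symmetry.\<close>

lemma pair_sym:
  assumes "A \<in> Ob V" and "B \<in> Ob V" and "f \<in> Arr K" and "g \<in> Arr K"
    and "Cod K f = fob G A" and "Cod K g = fob G B"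
  shows "pair A B f g \<Zsemi> far G (Sym V A B) =
    Sym K (Dom K f) (Dom K g) \<Zsemi> pair B A g f"
proof -
  have "pair A B f g \<Zsemi> far G (Sym V A B) =
      (f \<otimes> g) \<Zsemi> (Sym K (fob G A) (fob G B) \<Zsemi> tld G B A)"
    using assms by (simp add: pair_def tld_sym)
  also have "\<dots> = Sym K (Dom K f) (Dom K g) \<Zsemi> ((g \<otimes> f) \<Zsemi> tld G B A)"
    using K.sym_natural_arr[of f g] assms by (intro K.cmp_left_eq) simp_all
  finally show ?thesis
    using assms by (simp add: pair_def)
qed

text \<open>Solves an equation for its right-hand generalized element. It is needed because the
  middle swap and the inverse unitors of \<open>V\<close> involve inverses of structure
  isomorphisms.\<close>

lemma far_cancel:
  assumes "iso V h" and "x \<in> Arr K" and "Cod K x = fob G (Dom V h)"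
    and "x \<Zsemi> far G h = y"
  shows "y \<Zsemi> far G (inverse_of V h) = x"
  using assms by (auto simp: far_iso far_inverse_of)

text \<open>
  Among the factors of the middle swap only the symmetry moves parameter objects, hence the middle
  swap of the parameters on the right-hand side.
\<close>

lemma pair_middle_swap:
  assumes "A \<in> Ob V" and "B \<in> Ob V" and "D \<in> Ob V" and "E \<in> Ob V"
    and "f1 \<in> Hom K u1 (fob G A)" and "f2 \<in> Hom K u2 (fob G B)"
    and "g1 \<in> Hom K v1 (fob G D)" and "g2 \<in> Hom K v2 (fob G E)" and "{u1, u2, v1, v2} \<subseteq> U"
  shows "pair (A \<odot>\<^bsub>V\<^esub> B) (D \<odot>\<^bsub>V\<^esub> E) (pair A B f1 f2) (pair D E g1 g2) \<Zsemi>
      far G (middle_swap V A B D E) =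
    middle_swap K u1 u2 v1 v2 \<Zsemi>
      pair (A \<odot>\<^bsub>V\<^esub> D) (B \<odot>\<^bsub>V\<^esub> E) (pair A D f1 g1) (pair B E f2 g2)"
proof -
  note Hom_iff [simp]
  have U: "{Dom K f1, Dom K f2, Dom K g1, Dom K g2} \<subseteq> U"
    using assms by simp
  \<comment> \<open>\<open>pair_asc\<close> read backwards, for the two inverse associators inside
    the middle swap.\<close>
  note inv = far_cancel[OF V.structure_iso(1) _ _ pair_asc]
  have map: "pair A X f1 y \<Zsemi> far G (Ide V A \<otimes>\<^bsub>V\<^esub> h) = pair A (Cod V h) f1 (y \<Zsemi> far G h)"
    if "h \<in> Arr V" "X = Dom V h" "y \<in> Arr K" "Cod K y = fob G X" for X y h
    using pair_far[of "Ide V A" h f1 y A] assms that by (simp add: far_ide)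
  have map': "pair X E y g2 \<Zsemi> far G (h \<otimes>\<^bsub>V\<^esub> Ide V E) = pair (Cod V h) E (y \<Zsemi> far G h) g2"
    if "h \<in> Arr V" "X = Dom V h" "y \<in> Arr K" "Cod K y = fob G X" for X y h
    using pair_far[of h "Ide V E" y g2 _ E] assms that by (simp add: far_ide)
  let ?f2g = "pair B (D \<odot>\<^bsub>V\<^esub> E) f2 (pair D E g1 g2)"
  have 1: "pair (A \<odot>\<^bsub>V\<^esub> B) (D \<odot>\<^bsub>V\<^esub> E) (pair A B f1 f2) (pair D E g1 g2) \<Zsemi> far G (Asc V A B (D \<odot>\<^bsub>V\<^esub> E)) =
      pair A (B \<odot>\<^bsub>V\<^esub> (D \<odot>\<^bsub>V\<^esub> E)) f1 ?f2g"
    using assms U by (intro pair_asc) auto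
  have 2: "?f2g \<Zsemi> far G (inverse_of V (Asc V B D E)) = pair (B \<odot>\<^bsub>V\<^esub> D) E (pair B D f2 g1) g2"
    using assms U by (intro inv) auto
  have 3: "pair (B \<odot>\<^bsub>V\<^esub> D) E (pair B D f2 g1) g2 \<Zsemi> far G (Sym V B D \<otimes>\<^bsub>V\<^esub> Ide V E) =
      pair (D \<odot>\<^bsub>V\<^esub> B) E (Sym K u2 v1 \<Zsemi> pair D B g1 f2) g2"
    using assms by (subst map') (auto simp: pair_sym)
  have 4: "pair (D \<odot>\<^bsub>V\<^esub> B) E (Sym K u2 v1 \<Zsemi> pair D B g1 f2) g2 =
      (Sym K u2 v1 \<otimes> Ide K v2) \<Zsemi> pair (D \<odot>\<^bsub>V\<^esub> B) E (pair D B g1 f2) g2"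
    using pair_cmp[of "D \<odot>\<^bsub>V\<^esub> B" E "pair D B g1 f2" g2 "Sym K u2 v1" "Ide K v2"] assms by simp
  have 5: "pair (D \<odot>\<^bsub>V\<^esub> B) E (pair D B g1 f2) g2 \<Zsemi> far G (Asc V D B E) =
      pair D (B \<odot>\<^bsub>V\<^esub> E) g1 (pair B E f2 g2)"
    using assms U by (intro pair_asc) auto
  let ?s = "Sym K u2 v1 \<otimes> Ide K v2" and ?gf = "pair D (B \<odot>\<^bsub>V\<^esub> E) g1 (pair B E f2 g2)"
  have 6: "pair A (D \<odot>\<^bsub>V\<^esub> (B \<odot>\<^bsub>V\<^esub> E)) f1 (?s \<Zsemi> ?gf) =
      (Ide K u1 \<otimes> ?s) \<Zsemi> pair A (D \<odot>\<^bsub>V\<^esub> (B \<odot>\<^bsub>V\<^esub> E)) f1 ?gf"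
    using pair_cmp[of A "D \<odot>\<^bsub>V\<^esub> (B \<odot>\<^bsub>V\<^esub> E)" f1 ?gf "Ide K u1" ?s] assms by simp
  have 7: "pair A (D \<odot>\<^bsub>V\<^esub> (B \<odot>\<^bsub>V\<^esub> E)) f1 ?gf \<Zsemi> far G (inverse_of V (Asc V A D (B \<odot>\<^bsub>V\<^esub> E))) =
      pair (A \<odot>\<^bsub>V\<^esub> D) (B \<odot>\<^bsub>V\<^esub> E) (pair A D f1 g1) (pair B E f2 g2)"
    using assms U by (intro inv) auto
  have assoc: "x \<Zsemi> far G (a \<Zsemi>\<^bsub>V\<^esub> b) = (x \<Zsemi> far G a) \<Zsemi> far G b"
    if "a \<in> Arr V" "b \<in> Arr V" "Cod V a = Dom V b" "x \<in> Arr K" "Cod K x = fob G (Dom V a)" for x a b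
    using that by (simp add: far_cmp_arr)
  have "pair (A \<odot>\<^bsub>V\<^esub> B) (D \<odot>\<^bsub>V\<^esub> E) (pair A B f1 f2) (pair D E g1 g2) \<Zsemi> far G (middle_swap V A B D E) =
     pair A (D \<odot>\<^bsub>V\<^esub> (B \<odot>\<^bsub>V\<^esub> E)) f1 (((?s \<Zsemi> pair (D \<odot>\<^bsub>V\<^esub> B) E (pair D B g1 f2) g2) \<Zsemi> far G (Asc V D B E)))
      \<Zsemi> far G (inverse_of V (Asc V A D (B \<odot>\<^bsub>V\<^esub> E)))"
    unfolding middle_swap_def using assms
    by (simp add: assoc 1 2 3 4 map del: V.interchange V.interchange' V.cmp_assoc_arr K.cmp_assoc_arr)
  also have "\<dots> = pair A (D \<odot>\<^bsub>V\<^esub> (B \<odot>\<^bsub>V\<^esub> E)) f1 (?s \<Zsemi> ?gf)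
      \<Zsemi> far G (inverse_of V (Asc V A D (B \<odot>\<^bsub>V\<^esub> E)))"
    using assms by (simp add: 5)
  also have "\<dots> = (Ide K u1 \<otimes> ?s) \<Zsemi>
      pair (A \<odot>\<^bsub>V\<^esub> D) (B \<odot>\<^bsub>V\<^esub> E) (pair A D f1 g1) (pair B E f2 g2)"
    unfolding 6 7[symmetric] using assms by simp
  finally show ?thesis
    using assms by (simp add: K.middle_swap_sub)
qed

abbreviation "S A \<equiv> slice_cat (full_subcategory K U) K (fob G A)"

lemma N_sel [simp]:
  "nob N A = S A"
  "fob (nar N h) a = (fst a, snd a \<Zsemi> far G h)"
  "far (nar N h) \<alpha> = Arrow (fob (nar N h) (Src \<alpha>)) (Val \<alpha>) (fob (nar N h) (Tgt \<alpha>))"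
  "neps N = (Unt K, eps G)"
  "fob (ntld N A B) (a, b) = (fst a \<odot> fst b, pair A B (snd a) (snd b))"
  "far (ntld N A B) (\<alpha>, \<beta>) =
     Arrow (fob (ntld N A B) (Src \<alpha>, Src \<beta>)) (Val \<alpha> \<otimes> Val \<beta>) (fob (ntld N A B) (Tgt \<alpha>, Tgt \<beta>))"
  by (simp_all add: comp_catfun_def partial_slice_def comp_funct_def case_prod_unfold pair_def)

lemma nar_functor: "h \<in> Hom V A B \<Longrightarrow> category_functor (S A) (S B) (nar N h)"
  by (rule category_functorI)
    (auto simp: K.category_slice K.slice_ob_iff K.slice_arr_iff K.slice_hom_iff Hom_iff[where C = V] arrow_eq_iff)

lemma ntld_functor:
  assumes "A \<in> Ob V" and "B \<in> Ob V"
  shows "category_functor (prod_cat (S A) (S B)) (S (A \<odot>\<^bsub>V\<^esub> B)) (ntld N A B)"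
  using assms
  by (intro category_functorI category_prod_cat K.category_slice)
    (auto simp: prod_cat_def K.slice_ob_iff K.slice_arr_iff K.slice_hom_iff Hom_iff[where C = V] arrow_eq_iff pair_cmp)

text \<open>The coherence conditions demand equality of functors, not just isomorphism. Strictness
  of \<open>U\<close> provides it: on objects by \<open>pair_asc\<close> and
  \<open>pair_eps\<close>, on arrows because tensoring between objects of \<open>U\<close> is
  strictly associative and unital.\<close>

lemma lax_monoidal_cat_functor_slice: "lax_monoidal_cat_functor V N"
proof (intro lax_monoidal_cat_functor.intro lax_monoidal_cat_functor_axioms.intro V.monoidal_category_axioms;
    (unfold N_sel(1))?)
qed (auto simp: K.category_slice nar_functor ntld_functor functor_eq_def id_funct_def comp_funct_def
    prod_funct_def K.slice_ob_iff Hom_iff[where C = V] prod_eq_iff arrow_eq_iff far_ide far_cmp_arr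
    pair_eps pair_asc pair_far dest!: K.slice_arr_endpoints)

end

section \<open>Products and composites of pseudofunctors\<close>

context two_category
begin

lemma id2_cell: "X \<in> Cell0 D \<Longrightarrow> Y \<in> Cell0 D \<Longrightarrow> f \<in> Cell1 D X Y \<Longrightarrow> Id2 D X Y f \<in> Cell2 D X Y f f"
  using category.ide_hom[OF hom_category] by blast

lemma cell2_cells:
  assumes "X \<in> Cell0 D" and "Y \<in> Cell0 D" and "\<alpha> \<in> Cell2 D X Y f g"
  shows "f \<in> Cell1 D X Y" and "g \<in> Cell1 D X Y"
  using category.hom_ob[OF hom_category] assms by blast+

lemma vcomp_cell:
  "X \<in> Cell0 D \<Longrightarrow> Y \<in> Cell0 D \<Longrightarrow> \<alpha> \<in> Cell2 D X Y f g \<Longrightarrow> \<beta> \<in> Cell2 D X Y g h \<Longrightarrow>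
     VComp D X Y \<alpha> \<beta> \<in> Cell2 D X Y f h"
  using category.cmp_hom[OF hom_category] by blast

lemma vcomp_id2:
  assumes "X \<in> Cell0 D" and "Y \<in> Cell0 D" and "\<alpha> \<in> Cell2 D X Y f g"
  shows "VComp D X Y (Id2 D X Y f) \<alpha> = \<alpha>" and "VComp D X Y \<alpha> (Id2 D X Y g) = \<alpha>"
  using category.ide_cmp[OF hom_category] category.cmp_ide[OF hom_category] assms by blast+

lemma hcomp1_cell:
  assumes "X \<in> Cell0 D" and "Y \<in> Cell0 D" and "Z \<in> Cell0 D"
    and "f \<in> Cell1 D X Y" and "g \<in> Cell1 D Y Z"
  shows "HComp1 D X Y Z f g \<in> Cell1 D X Z"
  using category_functor.fob_ob[OF hcomp_functor, of X Y Z "(f, g)"] assms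
  by (simp add: prod_cat_def)

lemma hcomp2_cell:
  assumes "X \<in> Cell0 D" and "Y \<in> Cell0 D" and "Z \<in> Cell0 D"
    and "\<alpha> \<in> Cell2 D X Y f f'" and "\<beta> \<in> Cell2 D Y Z g g'"
  shows "HComp2 D X Y Z \<alpha> \<beta> \<in> Cell2 D X Z (HComp1 D X Y Z f g) (HComp1 D X Y Z f' g')"
  using category_functor.far_hom[OF hcomp_functor, of X Y Z "(\<alpha>, \<beta>)" "(f, g)" "(f', g')"] assms
  by simp

lemma hcomp2_id2:
  assumes "X \<in> Cell0 D" and "Y \<in> Cell0 D" and "Z \<in> Cell0 D"
    and "f \<in> Cell1 D X Y" and "g \<in> Cell1 D Y Z"
  shows "HComp2 D X Y Z (Id2 D X Y f) (Id2 D Y Z g) = Id2 D X Z (HComp1 D X Y Z f g)"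
  using category_functor.far_ide[OF hcomp_functor, of X Y Z "(f, g)"] assms
  by (simp add: prod_cat_def)

lemma hcomp2_vcomp:
  assumes "X \<in> Cell0 D" and "Y \<in> Cell0 D" and "Z \<in> Cell0 D"
    and "\<alpha> \<in> Cell2 D X Y f f'" and "\<alpha>' \<in> Cell2 D X Y f' f''"
    and "\<beta> \<in> Cell2 D Y Z g g'" and "\<beta>' \<in> Cell2 D Y Z g' g''"
  shows "HComp2 D X Y Z (VComp D X Y \<alpha> \<alpha>') (VComp D Y Z \<beta> \<beta>') =
    VComp D X Z (HComp2 D X Y Z \<alpha> \<beta>) (HComp2 D X Y Z \<alpha>' \<beta>')"
  using category_functor.far_cmp[OF hcomp_functor, of X Y Z "(\<alpha>, \<beta>)" "(f, g)" "(f', g')" "(\<alpha>', \<beta>')" "(f'', g'')"] assms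
  by simp

lemma hcomp2_arr:
  assumes "X \<in> Cell0 D" and "Y \<in> Cell0 D" and "Z \<in> Cell0 D"
    and "\<alpha> \<in> Arr (HomC D X Y)" and "\<beta> \<in> Arr (HomC D Y Z)"
  shows "HComp2 D X Y Z \<alpha> \<beta> \<in> Cell2 D X Z
      (HComp1 D X Y Z (Dom (HomC D X Y) \<alpha>) (Dom (HomC D Y Z) \<beta>))
      (HComp1 D X Y Z (Cod (HomC D X Y) \<alpha>) (Cod (HomC D Y Z) \<beta>))"
  using assms by (intro hcomp2_cell) (auto simp: Hom_iff)

lemma hcomp2_vcomp_arr:
  assumes "X \<in> Cell0 D" and "Y \<in> Cell0 D" and "Z \<in> Cell0 D"
    and "\<alpha> \<in> Arr (HomC D X Y)" and "\<alpha>' \<in> Arr (HomC D X Y)"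
    and "\<beta> \<in> Arr (HomC D Y Z)" and "\<beta>' \<in> Arr (HomC D Y Z)"
    and "Cod (HomC D X Y) \<alpha> = Dom (HomC D X Y) \<alpha>'" and "Cod (HomC D Y Z) \<beta> = Dom (HomC D Y Z) \<beta>'"
  shows "HComp2 D X Y Z (VComp D X Y \<alpha> \<alpha>') (VComp D Y Z \<beta> \<beta>') =
    VComp D X Z (HComp2 D X Y Z \<alpha> \<beta>) (HComp2 D X Y Z \<alpha>' \<beta>')"
  using assms
  by (intro hcomp2_vcomp[of X Y Z \<alpha> "Dom (HomC D X Y) \<alpha>" "Dom (HomC D X Y) \<alpha>'" \<alpha>' "Cod (HomC D X Y) \<alpha>'"
        \<beta> "Dom (HomC D Y Z) \<beta>" "Dom (HomC D Y Z) \<beta>'" \<beta>' "Cod (HomC D Y Z) \<beta>'"]) (auto simp: Hom_iff)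

end

lemma prod_two_cat_sel [simp]:
  "Cell0 (prod_two_cat C D) = Cell0 C \<times> Cell0 D"
  "HomC (prod_two_cat C D) (X, X') (Y, Y') = prod_cat (HomC C X Y) (HomC D X' Y')"
  "HComp1 (prod_two_cat C D) (X, X') (Y, Y') (Z, Z') (f, f') (g, g') =
     (HComp1 C X Y Z f g, HComp1 D X' Y' Z' f' g')"
  "HComp2 (prod_two_cat C D) (X, X') (Y, Y') (Z, Z') (\<alpha>, \<alpha>') (\<beta>, \<beta>') =
     (HComp2 C X Y Z \<alpha> \<beta>, HComp2 D X' Y' Z' \<alpha>' \<beta>')"
  "Id1 (prod_two_cat C D) (X, X') = (Id1 C X, Id1 D X')"
  by (simp_all add: prod_two_cat_def)

lemma two_category_prod:
  assumes "two_category C" and "two_category D"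
  shows "two_category (prod_two_cat C D)"
proof -
  interpret C: two_category C by fact
  interpret D: two_category D by fact
  show ?thesis
  proof (rule two_category.intro)
    fix X Y Z assume "X \<in> Cell0 (prod_two_cat C D)" "Y \<in> Cell0 (prod_two_cat C D)"
      "Z \<in> Cell0 (prod_two_cat C D)"
    then obtain X1 X2 Y1 Y2 Z1 Z2 where 1: "X = (X1, X2)" "Y = (Y1, Y2)" "Z = (Z1, Z2)"
      "X1 \<in> Cell0 C" "Y1 \<in> Cell0 C" "Z1 \<in> Cell0 C" "X2 \<in> Cell0 D" "Y2 \<in> Cell0 D" "Z2 \<in> Cell0 D"
      by auto
    let ?H = "\<lambda>X Y. HomC (prod_two_cat C D) X Y"
    show "category_functor (prod_cat (?H X Y) (?H Y Z)) (?H X Z) (HComp (prod_two_cat C D) X Y Z)"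
      unfolding 1 prod_two_cat_sel
    proof (intro category_functorI category_prod_cat C.hom_category D.hom_category 1)
    qed (use 1 in \<open>auto simp: C.hcomp1_cell D.hcomp1_cell C.hcomp2_id2 D.hcomp2_id2
          C.hcomp2_arr D.hcomp2_arr C.hcomp2_vcomp_arr D.hcomp2_vcomp_arr\<close>)
  qed (auto simp: category_prod_cat C.hom_category D.hom_category C.id1_cell D.id1_cell
      C.hcomp1_assoc D.hcomp1_assoc C.hcomp2_assoc D.hcomp2_assoc
      C.id1_hcomp1 D.id1_hcomp1 C.id1_hcomp2 D.id1_hcomp2
      C.hcomp1_id1 D.hcomp1_id1 C.hcomp2_id1 D.hcomp2_id1)
qed

text \<open>With identity structure 2-cells, all coherence axioms collapse to unit laws. This covers
  the identity, reassociation, swap and unit-insertion functors that occur in the naturality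
  conditions.\<close>

lemma pseudofunctor_strict_pfun:
  assumes "two_category C" and "two_category D"
    and P0: "\<And>X. X \<in> Cell0 C \<Longrightarrow> P0 X \<in> Cell0 D"
    and PH: "\<And>X Y. X \<in> Cell0 C \<Longrightarrow> Y \<in> Cell0 C \<Longrightarrow>
      category_functor (HomC C X Y) (HomC D (P0 X) (P0 Y)) (PH X Y)"
    and comp1: "\<And>X Y Z f g. X \<in> Cell0 C \<Longrightarrow> Y \<in> Cell0 C \<Longrightarrow> Z \<in> Cell0 C \<Longrightarrow>
      f \<in> Cell1 C X Y \<Longrightarrow> g \<in> Cell1 C Y Z \<Longrightarrow>
      HComp1 D (P0 X) (P0 Y) (P0 Z) (fob (PH X Y) f) (fob (PH Y Z) g) =
      fob (PH X Z) (HComp1 C X Y Z f g)"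
    and comp2: "\<And>X Y Z \<alpha> \<beta>. X \<in> Cell0 C \<Longrightarrow> Y \<in> Cell0 C \<Longrightarrow> Z \<in> Cell0 C \<Longrightarrow>
      \<alpha> \<in> Arr (HomC C X Y) \<Longrightarrow> \<beta> \<in> Arr (HomC C Y Z) \<Longrightarrow>
      HComp2 D (P0 X) (P0 Y) (P0 Z) (far (PH X Y) \<alpha>) (far (PH Y Z) \<beta>) =
      far (PH X Z) (HComp2 C X Y Z \<alpha> \<beta>)"
    and unit1: "\<And>X. X \<in> Cell0 C \<Longrightarrow> fob (PH X X) (Id1 C X) = Id1 D (P0 X)"
  shows "pseudofunctor C D (strict_pfun C D P0 PH)"
proof -
  interpret C: two_category C by fact
  interpret D: two_category D by fact
  have cell1: "fob (PH X Y) f \<in> Cell1 D (P0 X) (P0 Y)"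
    if "X \<in> Cell0 C" "Y \<in> Cell0 C" "f \<in> Cell1 C X Y" for X Y f
    using category_functor.fob_ob[OF PH] that by blast
  have cell2: "far (PH X Y) \<alpha> \<in> Cell2 D (P0 X) (P0 Y) (fob (PH X Y) f) (fob (PH X Y) g)"
    if "X \<in> Cell0 C" "Y \<in> Cell0 C" "\<alpha> \<in> Cell2 C X Y f g" for X Y f g \<alpha>
    using category_functor.far_hom[OF PH] that by blast
  note id = D.id2_cell D.vcomp_id2[OF _ _ D.id2_cell] D.hcomp2_id2 D.hcomp1_cell D.id1_cell
    category.iso_ide[OF D.hom_category]
  show ?thesis
    unfolding strict_pfun_def
  proof (intro pseudofunctor.intro pseudofunctor_axioms.intro assms(1,2), simp_all add: P0 PH)
    fix X Y Z f f' g g' \<alpha> \<beta>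
    assume 0: "X \<in> Cell0 C" "Y \<in> Cell0 C" "Z \<in> Cell0 C"
    {
      assume 1: "f \<in> Cell1 C X Y" "g \<in> Cell1 C Y Z"
      then have "fob (PH X Z) (HComp1 C X Y Z f g) \<in> Cell1 D (P0 X) (P0 Z)"
        using 0 by (simp add: cell1 C.hcomp1_cell)
      then show "Id2 D (P0 X) (P0 Z) (fob (PH X Z) (HComp1 C X Y Z f g)) \<in> Cell2 D (P0 X) (P0 Z)
          (HComp1 D (P0 X) (P0 Y) (P0 Z) (fob (PH X Y) f) (fob (PH Y Z) g))
          (fob (PH X Z) (HComp1 C X Y Z f g))"
        "iso (HomC D (P0 X) (P0 Z)) (Id2 D (P0 X) (P0 Z) (fob (PH X Z) (HComp1 C X Y Z f g)))"
        using 0 1 by (simp_all add: comp1 id P0)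
    next
      assume 1: "\<alpha> \<in> Cell2 C X Y f f'" "\<beta> \<in> Cell2 C Y Z g g'"
      then have "HComp2 C X Y Z \<alpha> \<beta> \<in> Cell2 C X Z (HComp1 C X Y Z f g) (HComp1 C X Y Z f' g')"
        using 0 by (intro C.hcomp2_cell)
      then have "far (PH X Z) (HComp2 C X Y Z \<alpha> \<beta>) \<in> Cell2 D (P0 X) (P0 Z)
          (fob (PH X Z) (HComp1 C X Y Z f g)) (fob (PH X Z) (HComp1 C X Y Z f' g'))"
        using 0 by (intro cell2)
      moreover have "\<alpha> \<in> Arr (HomC C X Y)" "\<beta> \<in> Arr (HomC C Y Z)"
        using 1 by (simp_all add: Hom_iff)
      ultimately show "VComp D (P0 X) (P0 Z)
          (HComp2 D (P0 X) (P0 Y) (P0 Z) (far (PH X Y) \<alpha>) (far (PH Y Z) \<beta>))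
          (Id2 D (P0 X) (P0 Z) (fob (PH X Z) (HComp1 C X Y Z f' g'))) =
        VComp D (P0 X) (P0 Z)
          (Id2 D (P0 X) (P0 Z) (fob (PH X Z) (HComp1 C X Y Z f g)))
          (far (PH X Z) (HComp2 C X Y Z \<alpha> \<beta>))"
        using 0 by (simp add: comp2 D.vcomp_id2 P0)
    }
  qed (simp_all add: P0 id unit1 comp1 cell1 C.hcomp1_cell C.hcomp1_assoc C.id1_cell
      C.id1_hcomp1 C.hcomp1_id1 D.id1_hcomp1 D.hcomp1_id1 flip: unit1)
qed

lemma phom_strict_pfun [simp]: "phom (strict_pfun C D P0 PH) = PH"
  by (simp add: strict_pfun_def)

lemma pseudofunctor_id:
  assumes "two_category C"
  shows "pseudofunctor C C (id_pfun C)"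
proof -
  interpret C: two_category C by fact
  show ?thesis
    unfolding id_pfun_def
    by (intro pseudofunctor_strict_pfun assms category_functorI)
      (auto simp: id_funct_def C.hom_category Hom_iff)
qed

lemma pseudofunctor_asc:
  assumes "two_category C"
  shows "pseudofunctor (prod_two_cat (prod_two_cat C C) C) (prod_two_cat C (prod_two_cat C C)) (asc_pfun C)"
proof -
  interpret C: two_category C by fact
  show ?thesis
    unfolding asc_pfun_def
    by (intro pseudofunctor_strict_pfun two_category_prod assms category_functorI)
      (auto simp: C.hom_category Hom_iff intro!: category_prod_cat)
qed

lemma pseudofunctor_swap:
  assumes "two_category C"
  shows "pseudofunctor (prod_two_cat C C) (prod_two_cat C C) (swap_pfun C)"
proof -
  interpret C: two_category C by fact
  show ?thesis
    unfolding swap_pfun_def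
    by (intro pseudofunctor_strict_pfun two_category_prod assms category_functorI)
      (auto simp: C.hom_category Hom_iff intro!: category_prod_cat)
qed

text \<open>Inserting a fixed object preserves composition strictly because the identity 1-cell on
  \<open>J\<close> is idempotent under horizontal composition, and likewise its identity
  2-cell.\<close>

lemma pseudofunctor_insert:
  assumes "two_category C" and "J \<in> Cell0 C"
  shows "pseudofunctor C (prod_two_cat C C) (linsert_pfun C J)"
    and "pseudofunctor C (prod_two_cat C C) (rinsert_pfun C J)"
proof -
  interpret C: two_category C by fact
  note J = assms(2) C.id1_cell[OF assms(2)] C.id1_hcomp1[OF assms(2,2)] C.id1_hcomp2[OF assms(2,2)]
    C.id2_cell[OF assms(2,2)] C.vcomp_id2[OF assms(2,2) C.id2_cell[OF assms(2,2)]]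
  show "pseudofunctor C (prod_two_cat C C) (linsert_pfun C J)"
    unfolding linsert_pfun_def
    by (intro pseudofunctor_strict_pfun two_category_prod assms category_functorI)
      (use J in \<open>auto simp: C.hom_category Hom_iff intro!: category_prod_cat\<close>)
  show "pseudofunctor C (prod_two_cat C C) (rinsert_pfun C J)"
    unfolding rinsert_pfun_def
    by (intro pseudofunctor_strict_pfun two_category_prod assms category_functorI)
      (use J in \<open>auto simp: C.hom_category Hom_iff intro!: category_prod_cat\<close>)
qed

section \<open>Closure of pseudofunctors under products and composition\<close>

context pseudofunctor
begin

lemma par1_cell: "X \<in> Cell0 C \<Longrightarrow> Y \<in> Cell0 C \<Longrightarrow> f \<in> Cell1 C X Y \<Longrightarrow>
    par1 P X Y f \<in> Cell1 D (pob P X) (pob P Y)"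
  using category_functor.fob_ob[OF phom_functor] by blast

lemma par2_cell: "X \<in> Cell0 C \<Longrightarrow> Y \<in> Cell0 C \<Longrightarrow> \<alpha> \<in> Cell2 C X Y f g \<Longrightarrow>
    par2 P X Y \<alpha> \<in> Cell2 D (pob P X) (pob P Y) (par1 P X Y f) (par1 P X Y g)"
  using category_functor.far_hom[OF phom_functor] by blast

lemma par2_id2: "X \<in> Cell0 C \<Longrightarrow> Y \<in> Cell0 C \<Longrightarrow> f \<in> Cell1 C X Y \<Longrightarrow>
    par2 P X Y (Id2 C X Y f) = Id2 D (pob P X) (pob P Y) (par1 P X Y f)"
  using category_functor.far_ide[OF phom_functor] by blast

lemma par2_vcomp: "X \<in> Cell0 C \<Longrightarrow> Y \<in> Cell0 C \<Longrightarrow> \<alpha> \<in> Cell2 C X Y f g \<Longrightarrow> \<beta> \<in> Cell2 C X Y g h \<Longrightarrow>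
    par2 P X Y (VComp C X Y \<alpha> \<beta>) = VComp D (pob P X) (pob P Y) (par2 P X Y \<alpha>) (par2 P X Y \<beta>)"
  using category_functor.far_cmp[OF phom_functor] by blast

lemma par2_iso: "X \<in> Cell0 C \<Longrightarrow> Y \<in> Cell0 C \<Longrightarrow> iso (HomC C X Y) \<alpha> \<Longrightarrow>
    iso (HomC D (pob P X) (pob P Y)) (par2 P X Y \<alpha>)"
  using category_functor.far_iso[OF phom_functor] by blast

end

lemma pseudofunctor_prod:
  assumes "pseudofunctor C D P" and "pseudofunctor C' D' Q"
  shows "pseudofunctor (prod_two_cat C C') (prod_two_cat D D') (prod_pfun P Q)"
proof -
  interpret P: pseudofunctor C D P by fact
  interpret Q: pseudofunctor C' D' Q by fact
  show ?thesis
    by (intro pseudofunctor.intro pseudofunctor_axioms.intro two_category_prod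
        P.C.two_category_axioms P.D.two_category_axioms Q.C.two_category_axioms Q.D.two_category_axioms)
      (auto simp: prod_pfun_def prod_funct_def P.pob_cell Q.pob_cell P.pcomp_cell Q.pcomp_cell
        P.punit_cell Q.punit_cell P.pcomp_natural Q.pcomp_natural P.pcomp_assoc Q.pcomp_assoc
        P.punit_pcomp Q.punit_pcomp P.pcomp_punit Q.pcomp_punit
        intro!: iso_prod_cat P.pcomp_iso Q.pcomp_iso P.punit_iso Q.punit_iso
          category_functor_prod[unfolded prod_funct_def] P.phom_functor Q.phom_functor)
qed

lemma comp_pfun_sel [simp]:
  "pob (comp_pfun E P Q) X = pob Q (pob P X)"
  "par1 (comp_pfun E P Q) X Y f = par1 Q (pob P X) (pob P Y) (par1 P X Y f)"
  "par2 (comp_pfun E P Q) X Y \<alpha> = par2 Q (pob P X) (pob P Y) (par2 P X Y \<alpha>)"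
  "pcomp (comp_pfun E P Q) X Y Z f g =
     VComp E (pob Q (pob P X)) (pob Q (pob P Z))
       (pcomp Q (pob P X) (pob P Y) (pob P Z) (par1 P X Y f) (par1 P Y Z g))
       (par2 Q (pob P X) (pob P Z) (pcomp P X Y Z f g))"
  "punit (comp_pfun E P Q) X =
     VComp E (pob Q (pob P X)) (pob Q (pob P X)) (punit Q (pob P X))
       (par2 Q (pob P X) (pob P X) (punit P X))"
  by (simp_all add: comp_pfun_def comp_funct_def)

text \<open>Each coherence axiom follows one pattern: split the whiskered composite 2-cell, slide
  the part coming from \<open>P\<close> past a comparison of \<open>Q\<close>, use the axiom of
  \<open>P\<close> inside the image of \<open>Q\<close>, and finally the axiom of
  \<open>Q\<close>.\<close>

lemma pseudofunctor_comp:
  assumes "pseudofunctor C D P" and "pseudofunctor D E Q"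
  shows "pseudofunctor C E (comp_pfun E P Q)"
proof -
  interpret P: pseudofunctor C D P by fact
  interpret Q: pseudofunctor D E Q by fact
  let ?R = "\<lambda>X. pob Q (pob P X)" and ?R1 = "\<lambda>X Y f. par1 Q (pob P X) (pob P Y) (par1 P X Y f)"
    and ?R2 = "\<lambda>X Y \<alpha>. par2 Q (pob P X) (pob P Y) (par2 P X Y \<alpha>)"
  let ?qcomp = "\<lambda>X Y Z. pcomp Q (pob P X) (pob P Y) (pob P Z)"
    and ?q2 = "\<lambda>X Y. par2 Q (pob P X) (pob P Y)"
  let ?V = "\<lambda>X Y. VComp E (?R X) (?R Y)" and ?H = "\<lambda>X Y Z. HComp2 E (?R X) (?R Y) (?R Z)"
  let ?H1 = "\<lambda>X Y Z. HComp1 E (?R X) (?R Y) (?R Z)" and ?I = "\<lambda>X Y. Id2 E (?R X) (?R Y)"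
  let ?VD = "\<lambda>X Y. VComp D (pob P X) (pob P Y)" and ?HD = "\<lambda>X Y Z. HComp2 D (pob P X) (pob P Y) (pob P Z)"
  let ?ID = "\<lambda>X Y. Id2 D (pob P X) (pob P Y)"
  note ob = P.pob_cell Q.pob_cell
  note cell1 = P.par1_cell Q.par1_cell P.C.hcomp1_cell P.D.hcomp1_cell Q.D.hcomp1_cell
    P.C.id1_cell P.D.id1_cell Q.D.id1_cell
  note cells = ob cell1
  have qcomp: "?qcomp X Y Z (par1 P X Y f) (par1 P Y Z g) \<in> Cell2 E (?R X) (?R Z)
      (?H1 X Y Z (?R1 X Y f) (?R1 Y Z g))
      (par1 Q (pob P X) (pob P Z) (HComp1 D (pob P X) (pob P Y) (pob P Z) (par1 P X Y f) (par1 P Y Z g)))"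
    and qpcomp: "?q2 X Z (pcomp P X Y Z f g) \<in> Cell2 E (?R X) (?R Z)
      (par1 Q (pob P X) (pob P Z) (HComp1 D (pob P X) (pob P Y) (pob P Z) (par1 P X Y f) (par1 P Y Z g)))
      (?R1 X Z (HComp1 C X Y Z f g))"
    if "X \<in> Cell0 C" "Y \<in> Cell0 C" "Z \<in> Cell0 C" "f \<in> Cell1 C X Y" "g \<in> Cell1 C Y Z" for X Y Z f g
    using that by (auto intro!: Q.pcomp_cell Q.par2_cell P.pcomp_cell cells)
  have qunit: "punit Q (pob P X) \<in> Cell2 E (?R X) (?R X) (Id1 E (?R X)) (par1 Q (pob P X) (pob P X) (Id1 D (pob P X)))"
    and qpunit: "?q2 X X (punit P X) \<in> Cell2 E (?R X) (?R X)
      (par1 Q (pob P X) (pob P X) (Id1 D (pob P X))) (?R1 X X (Id1 C X))"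
    if "X \<in> Cell0 C" for X
    using that by (auto intro!: Q.punit_cell Q.par2_cell P.punit_cell cells)
  \<comment> \<open>Functoriality of horizontal composition, with the identity 2-cell on
    \<open>h\<close> regarded as the vertical composite of itself with itself.\<close>
  have whisker_right: "?H X Y Z (?V X Y \<alpha> \<alpha>') (?I Y Z h) = ?V X Z (?H X Y Z \<alpha> (?I Y Z h)) (?H X Y Z \<alpha>' (?I Y Z h))"
    if "X \<in> Cell0 C" "Y \<in> Cell0 C" "Z \<in> Cell0 C" "\<alpha> \<in> Cell2 E (?R X) (?R Y) f f'"
      "\<alpha>' \<in> Cell2 E (?R X) (?R Y) f' f''" "h \<in> Cell1 E (?R Y) (?R Z)" for X Y Z f f' f'' h \<alpha> \<alpha>'
    using Q.D.hcomp2_vcomp[of "?R X" "?R Y" "?R Z" \<alpha> f f' \<alpha>' f'' "?I Y Z h" h h "?I Y Z h" h]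
      Q.D.vcomp_id2[of "?R Y" "?R Z" "?I Y Z h" h h] that by (simp add: cells Q.D.id2_cell)
  have whisker_left: "?H X Y Z (?I X Y h) (?V Y Z \<alpha> \<alpha>') = ?V X Z (?H X Y Z (?I X Y h) \<alpha>) (?H X Y Z (?I X Y h) \<alpha>')"
    if "X \<in> Cell0 C" "Y \<in> Cell0 C" "Z \<in> Cell0 C" "\<alpha> \<in> Cell2 E (?R Y) (?R Z) f f'"
      "\<alpha>' \<in> Cell2 E (?R Y) (?R Z) f' f''" "h \<in> Cell1 E (?R X) (?R Y)" for X Y Z f f' f'' h \<alpha> \<alpha>'
    using Q.D.hcomp2_vcomp[of "?R X" "?R Y" "?R Z" "?I X Y h" h h "?I X Y h" h \<alpha> f f' \<alpha>' f'']
      Q.D.vcomp_id2[of "?R X" "?R Y" "?I X Y h" h h] that by (simp add: cells Q.D.id2_cell)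
  \<comment> \<open>Naturality of the comparison of \<open>Q\<close>, stated for arbitrary 2-cells
    between 1-cells of \<open>D\<close> over the image of \<open>P\<close>.\<close>
  have slide: "?V X Z (?H X Y Z (?q2 X Y \<alpha>) (?q2 Y Z \<beta>)) (pcomp Q (pob P X) (pob P Y) (pob P Z) f' g') =
      ?V X Z (pcomp Q (pob P X) (pob P Y) (pob P Z) f g) (?q2 X Z (?HD X Y Z \<alpha> \<beta>))"
    if "X \<in> Cell0 C" "Y \<in> Cell0 C" "Z \<in> Cell0 C" "\<alpha> \<in> Cell2 D (pob P X) (pob P Y) f f'"
      "\<beta> \<in> Cell2 D (pob P Y) (pob P Z) g g'" for X Y Z f f' g g' \<alpha> \<beta>
    using Q.pcomp_natural that by (simp add: cells)
  show ?thesis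
  proof (intro pseudofunctor.intro pseudofunctor_axioms.intro P.C.two_category_axioms
      Q.D.two_category_axioms; (unfold comp_pfun_sel)?)
    fix X Y Z T f f' g g' h \<alpha> \<beta>
    assume X: "X \<in> Cell0 C"
    note PX = P.pob_cell[OF X] and RX = Q.pob_cell[OF P.pob_cell[OF X]]
    show "?R X \<in> Cell0 E"
      by (rule RX)
    show "?V X X (punit Q (pob P X)) (?q2 X X (punit P X)) \<in> Cell2 E (?R X) (?R X) (Id1 E (?R X)) (?R1 X X (Id1 C X))"
      using X qunit qpunit by (auto intro!: Q.D.vcomp_cell simp: cells)
    show "iso (HomC E (?R X) (?R X)) (?V X X (punit Q (pob P X)) (?q2 X X (punit P X)))"
      using X qunit[OF X] qpunit[OF X]
      by (auto intro!: category.iso_cmp[OF Q.D.hom_category] Q.punit_iso Q.par2_iso P.punit_iso simp: cells Hom_iff)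
    assume Y: "Y \<in> Cell0 C"
    note PY = P.pob_cell[OF Y] and RY = Q.pob_cell[OF P.pob_cell[OF Y]]
    show "category_functor (HomC C X Y) (HomC E (?R X) (?R Y)) (phom (comp_pfun E P Q) X Y)"
      unfolding comp_pfun_def using X Y by (auto intro!: category_functor_comp P.phom_functor Q.phom_functor cells)
    {
      assume f: "f \<in> Cell1 C X Y"
      interpret H: category "HomC E (?R X) (?R Y)"
        using X Y by (intro Q.D.hom_category ob)
      let ?f = "par1 P X Y f" and ?w = "?I X Y (?R1 X Y f)"
      have Pf: "?f \<in> Cell1 D (pob P X) (pob P Y)" and Rf: "?R1 X Y f \<in> Cell1 E (?R X) (?R Y)"
        using X Y f by (simp_all add: cells)
      \<comment> \<open>\<open>w'\<close> presents the whiskering identity as the image under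
        \<open>Q\<close> of an identity in \<open>D\<close>; only in this form does
        \<open>slide\<close> apply to a 2-cell whiskered by it.\<close>
      have w: "?w \<in> Cell2 E (?R X) (?R Y) (?R1 X Y f) (?R1 X Y f)"
        and w': "?w = ?q2 X Y (?ID X Y ?f)"
        and wD: "?ID X Y ?f \<in> Cell2 D (pob P X) (pob P Y) ?f ?f"
        using X Y f by (simp_all add: cells Q.D.id2_cell P.D.id2_cell Q.par2_id2)
      show "?V X Y (?H X X Y (?V X X (punit Q (pob P X)) (?q2 X X (punit P X))) (?I X Y (?R1 X Y f)))
          (?V X Y (?qcomp X X Y (par1 P X X (Id1 C X)) (par1 P X Y f)) (?q2 X Y (pcomp P X X Y (Id1 C X) f))) =
        ?I X Y (?R1 X Y f)"
      proof -
        let ?i = "Id1 C X" and ?j = "Id1 D (pob P X)"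
        let ?u = "punit Q (pob P X)" and ?pu = "?q2 X X (punit P X)"
          and ?q = "?qcomp X X Y (par1 P X X ?i) ?f" and ?p = "?q2 X Y (pcomp P X X Y ?i f)"
          and ?q' = "?qcomp X X Y ?j ?f" and ?pw = "?HD X X Y (punit P X) (?ID X Y ?f)"
        have eq: "?V X Y (?H X X Y ?pu ?w) ?q = ?V X Y ?q' (?q2 X Y ?pw)"
          unfolding w' by (rule slide) (use X Y wD P.punit_cell in auto)
        note hom = Q.D.hcomp2_cell[OF RX RX RY qunit[OF X] w] Q.D.hcomp2_cell[OF RX RX RY qpunit[OF X] w]
          qcomp[OF X X Y P.C.id1_cell[OF X] f] Q.pcomp_cell[OF PX PX PY P.D.id1_cell[OF PX] Pf]
          Q.par2_cell[OF PX PY P.D.hcomp2_cell[OF PX PX PY P.punit_cell[OF X] wD]]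
          qpcomp[OF X X Y P.C.id1_cell[OF X] f]
        note hom = hom[unfolded Hom_iff]
        have "?V X Y (?H X X Y (?V X X ?u ?pu) ?w) (?V X Y ?q ?p) =
            ?V X Y (?H X X Y ?u ?w) (?V X Y (?H X X Y ?pu ?w) (?V X Y ?q ?p))"
          using whisker_right[OF X X Y qunit[OF X] qpunit[OF X] Rf] hom by simp
        also have "\<dots> = ?V X Y (?H X X Y ?u ?w) (?V X Y ?q' (?V X Y (?q2 X Y ?pw) ?p))"
          using H.cmp_left_eq[OF eq, of ?p] hom by simp
        also have "?V X Y (?q2 X Y ?pw) ?p = ?q2 X Y (?ID X Y ?f)"
          using Q.par2_vcomp[OF _ _ P.D.hcomp2_cell[OF _ _ _ P.punit_cell[OF X] wD]
              P.pcomp_cell[OF X X Y P.C.id1_cell[OF X] f]] P.punit_pcomp[OF X Y f] X Y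
          by (simp add: cells)
        also have "\<dots> = ?w"
          by (simp add: w')
        finally have *: "?V X Y (?H X X Y (?V X X ?u ?pu) ?w) (?V X Y ?q ?p) =
          ?V X Y (?H X X Y ?u ?w) (?V X Y ?q' ?w)" .
        \<comment> \<open>Strict unitality of \<open>D\<close> makes the codomain of
          \<open>?q'\<close> the image of \<open>?f\<close> itself, so the trailing
          \<open>?w\<close> is the identity on it and drops out.\<close>
        have "HComp1 D (pob P X) (pob P X) (pob P Y) ?j ?f = ?f"
          using X Y Pf by (simp add: P.D.id1_hcomp1 cells)
        then have "?V X Y ?q' ?w = ?q'"
          using hom w by (simp add: Hom_iff)
        then show ?thesis
          unfolding * using Q.punit_pcomp[OF _ _ Pf] X Y by (simp add: cells)
      qed
      show "?V X Y (?H X Y Y (?I X Y (?R1 X Y f)) (?V Y Y (punit Q (pob P Y)) (?q2 Y Y (punit P Y))))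
          (?V X Y (?qcomp X Y Y (par1 P X Y f) (par1 P Y Y (Id1 C Y))) (?q2 X Y (pcomp P X Y Y f (Id1 C Y)))) =
        ?I X Y (?R1 X Y f)"
      proof -
        let ?i = "Id1 C Y" and ?j = "Id1 D (pob P Y)"
        let ?u = "punit Q (pob P Y)" and ?pu = "?q2 Y Y (punit P Y)"
          and ?q = "?qcomp X Y Y ?f (par1 P Y Y ?i)" and ?p = "?q2 X Y (pcomp P X Y Y f ?i)"
          and ?q' = "?qcomp X Y Y ?f ?j" and ?pw = "?HD X Y Y (?ID X Y ?f) (punit P Y)"
        have eq: "?V X Y (?H X Y Y ?w ?pu) ?q = ?V X Y ?q' (?q2 X Y ?pw)"
          unfolding w' by (rule slide) (use X Y wD P.punit_cell in auto)
        note hom = Q.D.hcomp2_cell[OF RX RY RY w qunit[OF Y]] Q.D.hcomp2_cell[OF RX RY RY w qpunit[OF Y]]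
          qcomp[OF X Y Y f P.C.id1_cell[OF Y]] Q.pcomp_cell[OF PX PY PY Pf P.D.id1_cell[OF PY]]
          Q.par2_cell[OF PX PY P.D.hcomp2_cell[OF PX PY PY wD P.punit_cell[OF Y]]]
          qpcomp[OF X Y Y f P.C.id1_cell[OF Y]]
        note hom = hom[unfolded Hom_iff]
        have "?V X Y (?H X Y Y ?w (?V Y Y ?u ?pu)) (?V X Y ?q ?p) =
            ?V X Y (?H X Y Y ?w ?u) (?V X Y (?H X Y Y ?w ?pu) (?V X Y ?q ?p))"
          using whisker_left[OF X Y Y qunit[OF Y] qpunit[OF Y] Rf] hom by simp
        also have "\<dots> = ?V X Y (?H X Y Y ?w ?u) (?V X Y ?q' (?V X Y (?q2 X Y ?pw) ?p))"
          using H.cmp_left_eq[OF eq, of ?p] hom by simp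
        also have "?V X Y (?q2 X Y ?pw) ?p = ?q2 X Y (?ID X Y ?f)"
          using Q.par2_vcomp[OF _ _ P.D.hcomp2_cell[OF _ _ _ wD P.punit_cell[OF Y]]
              P.pcomp_cell[OF X Y Y f P.C.id1_cell[OF Y]]] P.pcomp_punit[OF X Y f] X Y
          by (simp add: cells)
        also have "\<dots> = ?w"
          by (simp add: w')
        finally have *: "?V X Y (?H X Y Y ?w (?V Y Y ?u ?pu)) (?V X Y ?q ?p) =
          ?V X Y (?H X Y Y ?w ?u) (?V X Y ?q' ?w)" .
        have "HComp1 D (pob P X) (pob P Y) (pob P Y) ?f ?j = ?f"
          using X Y Pf by (simp add: P.D.hcomp1_id1 cells)
        then have "?V X Y ?q' ?w = ?q'"
          using hom w by (simp add: Hom_iff)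
        then show ?thesis
          unfolding * using Q.pcomp_punit[OF _ _ Pf] X Y by (simp add: cells)
      qed
    }
    assume Z: "Z \<in> Cell0 C"
    note PZ = P.pob_cell[OF Z] and RZ = Q.pob_cell[OF P.pob_cell[OF Z]]
    {
      assume f: "f \<in> Cell1 C X Y" and g: "g \<in> Cell1 C Y Z"
      show "?V X Z (?qcomp X Y Z (par1 P X Y f) (par1 P Y Z g)) (?q2 X Z (pcomp P X Y Z f g)) \<in>
          Cell2 E (?R X) (?R Z) (?H1 X Y Z (?R1 X Y f) (?R1 Y Z g)) (?R1 X Z (HComp1 C X Y Z f g))"
        using qcomp qpcomp X Y Z f g by (auto intro!: Q.D.vcomp_cell simp: cells)
      show "iso (HomC E (?R X) (?R Z)) (?V X Z (?qcomp X Y Z (par1 P X Y f) (par1 P Y Z g)) (?q2 X Z (pcomp P X Y Z f g)))"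
        using qcomp[OF X Y Z f g] qpcomp[OF X Y Z f g] X Y Z f g
        by (auto intro!: category.iso_cmp[OF Q.D.hom_category] Q.pcomp_iso Q.par2_iso P.pcomp_iso simp: cells Hom_iff)
      assume T: "T \<in> Cell0 C" and h: "h \<in> Cell1 C Z T"
      show "?V X T (?H X Z T (?V X Z (?qcomp X Y Z (par1 P X Y f) (par1 P Y Z g)) (?q2 X Z (pcomp P X Y Z f g)))
            (?I Z T (?R1 Z T h)))
          (?V X T (?qcomp X Z T (par1 P X Z (HComp1 C X Y Z f g)) (par1 P Z T h))
            (?q2 X T (pcomp P X Z T (HComp1 C X Y Z f g) h))) =
        ?V X T (?H X Y T (?I X Y (?R1 X Y f))
            (?V Y T (?qcomp Y Z T (par1 P Y Z g) (par1 P Z T h)) (?q2 Y T (pcomp P Y Z T g h))))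
          (?V X T (?qcomp X Y T (par1 P X Y f) (par1 P Y T (HComp1 C Y Z T g h)))
            (?q2 X T (pcomp P X Y T f (HComp1 C Y Z T g h))))"
      proof -
        interpret H: category "HomC E (?R X) (?R T)"
          using X T by (intro Q.D.hom_category ob)
        let ?f = "par1 P X Y f" and ?g = "par1 P Y Z g" and ?h = "par1 P Z T h"
        let ?fg = "HComp1 C X Y Z f g" and ?gh = "HComp1 C Y Z T g h"
          and ?FG = "HComp1 D (pob P X) (pob P Y) (pob P Z) ?f ?g"
          and ?GH = "HComp1 D (pob P Y) (pob P Z) (pob P T) ?g ?h"
        let ?wf = "?I X Y (?R1 X Y f)" and ?wh = "?I Z T (?R1 Z T h)"
        have P: "?f \<in> Cell1 D (pob P X) (pob P Y)" "?g \<in> Cell1 D (pob P Y) (pob P Z)"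
            "?h \<in> Cell1 D (pob P Z) (pob P T)"
          and R: "?R1 X Y f \<in> Cell1 E (?R X) (?R Y)" "?R1 Z T h \<in> Cell1 E (?R Z) (?R T)"
          and fgh: "?fg \<in> Cell1 C X Z" "?gh \<in> Cell1 C Y T"
          using X Y Z T f g h by (simp_all add: cells)
        have wf: "?wf \<in> Cell2 E (?R X) (?R Y) (?R1 X Y f) (?R1 X Y f)" "?wf = ?q2 X Y (?ID X Y ?f)"
            "?ID X Y ?f \<in> Cell2 D (pob P X) (pob P Y) ?f ?f"
          and wh: "?wh \<in> Cell2 E (?R Z) (?R T) (?R1 Z T h) (?R1 Z T h)" "?wh = ?q2 Z T (?ID Z T ?h)"
            "?ID Z T ?h \<in> Cell2 D (pob P Z) (pob P T) ?h ?h"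
          using X Y Z T f h by (simp_all add: cells Q.D.id2_cell P.D.id2_cell Q.par2_id2)
        let ?q1 = "?qcomp X Y Z ?f ?g" and ?p1 = "?q2 X Z (pcomp P X Y Z f g)"
          and ?q2' = "?qcomp X Z T (par1 P X Z ?fg) ?h" and ?p2 = "?q2 X T (pcomp P X Z T ?fg h)"
          and ?q3 = "?qcomp X Z T ?FG ?h" and ?pw = "?HD X Z T (pcomp P X Y Z f g) (?ID Z T ?h)"
        let ?q4 = "?qcomp Y Z T ?g ?h" and ?p4 = "?q2 Y T (pcomp P Y Z T g h)"
          and ?q5 = "?qcomp X Y T ?f (par1 P Y T ?gh)" and ?p5 = "?q2 X T (pcomp P X Y T f ?gh)"
          and ?q6 = "?qcomp X Y T ?f ?GH" and ?wp = "?HD X Y T (?ID X Y ?f) (pcomp P Y Z T g h)"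
        have eq: "?V X T (?H X Z T ?p1 ?wh) ?q2' = ?V X T ?q3 (?q2 X T ?pw)"
          unfolding wh(2) by (rule slide) (use X Y Z T f g wh P.pcomp_cell in auto)
        have eq': "?V X T (?H X Y T ?wf ?p4) ?q5 = ?V X T ?q6 (?q2 X T ?wp)"
          unfolding wf(2) by (rule slide) (use X Y Z T g h wf P.pcomp_cell in auto)
        note PT = P.pob_cell[OF T] and RT = Q.pob_cell[OF P.pob_cell[OF T]]
        note pw = P.D.hcomp2_cell[OF PX PZ PT P.pcomp_cell[OF X Y Z f g] wh(3)]
          and wp = P.D.hcomp2_cell[OF PX PY PT wf(3) P.pcomp_cell[OF Y Z T g h]]
        note hom = Q.D.hcomp2_cell[OF RX RZ RT qcomp[OF X Y Z f g] wh(1)]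
          Q.D.hcomp2_cell[OF RX RZ RT qpcomp[OF X Y Z f g] wh(1)]
          Q.D.hcomp2_cell[OF RX RY RT wf(1) qcomp[OF Y Z T g h]]
          Q.D.hcomp2_cell[OF RX RY RT wf(1) qpcomp[OF Y Z T g h]]
          qcomp[OF X Z T fgh(1) h] qpcomp[OF X Z T fgh(1) h] qcomp[OF X Y T f fgh(2)] qpcomp[OF X Y T f fgh(2)]
          Q.pcomp_cell[OF PX PZ PT P.D.hcomp1_cell[OF PX PY PZ P(1,2)] P(3)] Q.par2_cell[OF PX PT pw]
          Q.pcomp_cell[OF PX PY PT P(1) P.D.hcomp1_cell[OF PY PZ PT P(2,3)]] Q.par2_cell[OF PX PT wp]
        note hom = hom[unfolded Hom_iff]
        have "?V X T (?H X Z T (?V X Z ?q1 ?p1) ?wh) (?V X T ?q2' ?p2) =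
            ?V X T (?H X Z T ?q1 ?wh) (?V X T (?H X Z T ?p1 ?wh) (?V X T ?q2' ?p2))"
          using whisker_right[OF X Z T qcomp[OF X Y Z f g] qpcomp[OF X Y Z f g] R(2)] hom by simp
        also have "\<dots> = ?V X T (?H X Z T ?q1 ?wh) (?V X T ?q3 (?V X T (?q2 X T ?pw) ?p2))"
          using H.cmp_left_eq[OF eq, of ?p2] hom by simp
        also have "?V X T (?q2 X T ?pw) ?p2 = ?q2 X T (?VD X T ?pw (pcomp P X Z T ?fg h))"
          using Q.par2_vcomp[OF _ _ pw P.pcomp_cell[OF X Z T fgh(1) h]] X T by (simp add: ob)
        \<comment> \<open>The associativity axiom of \<open>P\<close> changes the bracketing inside
          the image of \<open>Q\<close>. The one of \<open>Q\<close>, with the tail already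
          rewritten, changes it outside.\<close>
        also have "?VD X T ?pw (pcomp P X Z T ?fg h) = ?VD X T ?wp (pcomp P X Y T f ?gh)"
          by (rule P.pcomp_assoc[OF X Y Z T f g h])
        also have "?q2 X T \<dots> = ?V X T (?q2 X T ?wp) ?p5"
          using Q.par2_vcomp[OF _ _ wp P.pcomp_cell[OF X Y T f fgh(2)]] X T by (simp add: ob)
        also have "?V X T (?H X Z T ?q1 ?wh) (?V X T ?q3 (?V X T (?q2 X T ?wp) ?p5)) =
            ?V X T (?H X Y T ?wf ?q4) (?V X T ?q6 (?V X T (?q2 X T ?wp) ?p5))"
          using hom P.D.hcomp1_assoc[OF _ _ _ _ P] X Y Z T
          by (intro H.cmp_left_eq Q.pcomp_assoc P) (simp_all add: ob)
        also have "\<dots> = ?V X T (?H X Y T ?wf ?q4) (?V X T (?H X Y T ?wf ?p4) (?V X T ?q5 ?p5))"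
          using H.cmp_left_eq[OF eq', of ?p5] hom by simp
        also have "\<dots> = ?V X T (?H X Y T ?wf (?V Y T ?q4 ?p4)) (?V X T ?q5 ?p5)"
          using whisker_left[OF X Y T qcomp[OF Y Z T g h] qpcomp[OF Y Z T g h] R(1)] hom by simp
        finally show ?thesis .
      qed
    next
      assume \<alpha>: "\<alpha> \<in> Cell2 C X Y f f'" and \<beta>: "\<beta> \<in> Cell2 C Y Z g g'"
      show "?V X Z (?H X Y Z (?R2 X Y \<alpha>) (?R2 Y Z \<beta>))
          (?V X Z (?qcomp X Y Z (par1 P X Y f') (par1 P Y Z g')) (?q2 X Z (pcomp P X Y Z f' g'))) =
        ?V X Z (?V X Z (?qcomp X Y Z (par1 P X Y f) (par1 P Y Z g)) (?q2 X Z (pcomp P X Y Z f g)))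
          (?R2 X Z (HComp2 C X Y Z \<alpha> \<beta>))"
      proof -
        interpret H: category "HomC E (?R X) (?R Z)"
          using X Z by (intro Q.D.hom_category ob)
        have cells': "f \<in> Cell1 C X Y" "f' \<in> Cell1 C X Y" "g \<in> Cell1 C Y Z" "g' \<in> Cell1 C Y Z"
          using P.C.cell2_cells[OF X Y \<alpha>] P.C.cell2_cells[OF Y Z \<beta>] by auto
        let ?q = "?qcomp X Y Z (par1 P X Y f) (par1 P Y Z g)" and ?p = "?q2 X Z (pcomp P X Y Z f g)"
          and ?q' = "?qcomp X Y Z (par1 P X Y f') (par1 P Y Z g')" and ?p' = "?q2 X Z (pcomp P X Y Z f' g')"
          and ?m = "?HD X Y Z (par2 P X Y \<alpha>) (par2 P Y Z \<beta>)" and ?a = "?H X Y Z (?R2 X Y \<alpha>) (?R2 Y Z \<beta>)"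
          and ?r = "par2 P X Z (HComp2 C X Y Z \<alpha> \<beta>)"
        note m = P.D.hcomp2_cell[OF PX PY PZ P.par2_cell[OF X Y \<alpha>] P.par2_cell[OF Y Z \<beta>]]
          and r = P.par2_cell[OF X Z P.C.hcomp2_cell[OF X Y Z \<alpha> \<beta>]]
        note hom = Q.par2_cell[OF PX PZ m] Q.par2_cell[OF PX PZ r]
          Q.D.hcomp2_cell[OF RX RY RZ Q.par2_cell[OF PX PY P.par2_cell[OF X Y \<alpha>]] Q.par2_cell[OF PY PZ P.par2_cell[OF Y Z \<beta>]]]
          qcomp[OF X Y Z cells'(1,3)] qpcomp[OF X Y Z cells'(1,3)] qcomp[OF X Y Z cells'(2,4)] qpcomp[OF X Y Z cells'(2,4)]
        note hom = hom[unfolded Hom_iff]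
        have eq: "?V X Z ?a ?q' = ?V X Z ?q (?q2 X Z ?m)"
          by (rule slide) (use X Y Z \<alpha> \<beta> P.par2_cell in auto)
        have eq': "?V X Z (?q2 X Z ?m) ?p' = ?V X Z ?p (?q2 X Z ?r)"
          using Q.par2_vcomp[OF _ _ m P.pcomp_cell[OF X Y Z cells'(2,4)]]
            Q.par2_vcomp[OF _ _ P.pcomp_cell[OF X Y Z cells'(1,3)] r] P.pcomp_natural[OF X Y Z \<alpha> \<beta>] X Z
          by (simp add: ob)
        show ?thesis
          using H.cmp_left_eq[OF eq, of ?p'] eq' hom by simp
      qed
    }
  qed
qed

section \<open>Evaluation of the auxiliary pseudofunctors\<close>

lemma prod_pfun_sel [simp]:
  "pob (prod_pfun P Q) (X, X') = (pob P X, pob Q X')"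
  "par1 (prod_pfun P Q) (X, X') (Y, Y') (f, f') = (par1 P X Y f, par1 Q X' Y' f')"
  "par2 (prod_pfun P Q) (X, X') (Y, Y') (\<alpha>, \<alpha>') = (par2 P X Y \<alpha>, par2 Q X' Y' \<alpha>')"
  "pcomp (prod_pfun P Q) (X, X') (Y, Y') (Z, Z') (f, f') (g, g') = (pcomp P X Y Z f g, pcomp Q X' Y' Z' f' g')"
  "punit (prod_pfun P Q) (X, X') = (punit P X, punit Q X')"
  by (simp_all add: prod_pfun_def prod_funct_def)

lemma id_pfun_sel [simp]:
  "pob (id_pfun C) X = X" "par1 (id_pfun C) X Y f = f" "par2 (id_pfun C) X Y \<alpha> = \<alpha>"
  "pcomp (id_pfun C) X Y Z f g = Id2 C X Z (HComp1 C X Y Z f g)"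
  "punit (id_pfun C) X = Id2 C X X (Id1 C X)"
  by (simp_all add: id_pfun_def strict_pfun_def id_funct_def)

lemma asc_pfun_sel [simp]:
  "pob (asc_pfun C) ((X, Y), Z) = (X, (Y, Z))"
  "par1 (asc_pfun C) S T ((f, g), h) = (f, (g, h))"
  "par2 (asc_pfun C) S T ((\<alpha>, \<beta>), \<gamma>) = (\<alpha>, (\<beta>, \<gamma>))"
  "pcomp (asc_pfun C) ((X1, X2), X3) ((Y1, Y2), Y3) ((Z1, Z2), Z3) ((f1, f2), f3) ((g1, g2), g3) =
     (Id2 C X1 Z1 (HComp1 C X1 Y1 Z1 f1 g1),
       (Id2 C X2 Z2 (HComp1 C X2 Y2 Z2 f2 g2), Id2 C X3 Z3 (HComp1 C X3 Y3 Z3 f3 g3)))"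
  "punit (asc_pfun C) ((X1, X2), X3) =
     (Id2 C X1 X1 (Id1 C X1), (Id2 C X2 X2 (Id1 C X2), Id2 C X3 X3 (Id1 C X3)))"
  by (simp_all add: asc_pfun_def strict_pfun_def)

lemma swap_pfun_sel [simp]:
  "pob (swap_pfun C) (X, Y) = (Y, X)"
  "par1 (swap_pfun C) S T (f, g) = (g, f)"
  "par2 (swap_pfun C) S T (\<alpha>, \<beta>) = (\<beta>, \<alpha>)"
  "pcomp (swap_pfun C) (X1, X2) (Y1, Y2) (Z1, Z2) (f1, f2) (g1, g2) =
     (Id2 C X2 Z2 (HComp1 C X2 Y2 Z2 f2 g2), Id2 C X1 Z1 (HComp1 C X1 Y1 Z1 f1 g1))"
  "punit (swap_pfun C) (X1, X2) = (Id2 C X2 X2 (Id1 C X2), Id2 C X1 X1 (Id1 C X1))"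
  by (simp_all add: swap_pfun_def strict_pfun_def)

lemma insert_pfun_sel [simp]:
  "pob (linsert_pfun C J) X = (J, X)"
  "par1 (linsert_pfun C J) X Y f = (Id1 C J, f)"
  "par2 (linsert_pfun C J) X Y \<alpha> = (Id2 C J J (Id1 C J), \<alpha>)"
  "pcomp (linsert_pfun C J) X Y Z f g =
     (Id2 C J J (Id1 C J), Id2 C X Z (HComp1 C X Y Z f g))"
  "punit (linsert_pfun C J) X = (Id2 C J J (Id1 C J), Id2 C X X (Id1 C X))"
  "pob (rinsert_pfun C J) X = (X, J)"
  "par1 (rinsert_pfun C J) X Y f = (f, Id1 C J)"
  "par2 (rinsert_pfun C J) X Y \<alpha> = (\<alpha>, Id2 C J J (Id1 C J))"
  "pcomp (rinsert_pfun C J) X Y Z f g =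
     (Id2 C X Z (HComp1 C X Y Z f g), Id2 C J J (Id1 C J))"
  "punit (rinsert_pfun C J) X = (Id2 C X X (Id1 C X), Id2 C J J (Id1 C J))"
  by (simp_all add: linsert_pfun_def rinsert_pfun_def strict_pfun_def)

section \<open>The 2-category of parametrized 1-cells\<close>

locale slice_enriched = slice_setting V K G U + C: enriched_category V C
  for V :: "('vo, 'va, 'y) smoncat_scheme" and K :: "('o, 'a, 'z) smoncat_scheme" (structure)
    and G :: "('vo, 'va, 'o, 'a, 'w) laxfun_scheme" and U and C :: "('x, 'vo, 'va) ecat"
begin

abbreviation "D \<equiv> change_of_base N C"

text \<open>
  \<open>hc\<close> is the horizontal composite on the level of generalized elements, that is, of 1-cells
  without their parameter objects; \<open>bc\<close> below is the corresponding monoidal product.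
\<close>

definition hc :: "'x \<Rightarrow> 'x \<Rightarrow> 'x \<Rightarrow> 'a \<Rightarrow> 'a \<Rightarrow> 'a" where
  "hc X Y Z f g = pair (EHom C X Y) (EHom C Y Z) f g \<Zsemi> far G (ECmp C X Y Z)"

lemma ecat_simps [simp]:
  assumes "X \<in> EOb C" and "Y \<in> EOb C"
  shows "EHom C X Y \<in> Ob V"
    and "Z \<in> EOb C \<Longrightarrow> ECmp C X Y Z \<in> Arr V"
    and "Z \<in> EOb C \<Longrightarrow> Dom V (ECmp C X Y Z) = EHom C X Y \<odot>\<^bsub>V\<^esub> EHom C Y Z"
    and "Z \<in> EOb C \<Longrightarrow> Cod V (ECmp C X Y Z) = EHom C X Z"
    and "EId C X \<in> Arr V" and "Dom V (EId C X) = Unt V" and "Cod V (EId C X) = EHom C X X"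
  using C.ehom_ob[of X Y] C.ecmp_hom[of X Y Z] C.eid_hom[of X] assms by (auto simp: Hom_iff)

lemma hc_simps [simp]:
  assumes "X \<in> EOb C" and "Y \<in> EOb C" and "Z \<in> EOb C" and "f \<in> Arr K" and "g \<in> Arr K"
    and "Cod K f = fob G (EHom C X Y)" and "Cod K g = fob G (EHom C Y Z)"
  shows "hc X Y Z f g \<in> Arr K" and "Dom K (hc X Y Z f g) = Dom K f \<odot> Dom K g"
    and "Cod K (hc X Y Z f g) = fob G (EHom C X Z)"
  using assms by (simp_all add: hc_def)

lemma D_sel:
  "Cell0 D = EOb C"
  "HomC D X Y = S (EHom C X Y)"
  "HComp1 D X Y Z a b = (fst a \<odot> fst b, hc X Y Z (snd a) (snd b))"
  "HComp2 D X Y Z \<alpha> \<beta> =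
     Arrow (HComp1 D X Y Z (Src \<alpha>) (Src \<beta>)) (Val \<alpha> \<otimes> Val \<beta>) (HComp1 D X Y Z (Tgt \<alpha>) (Tgt \<beta>))"
  "Id1 D X = (Unt K, eps G \<Zsemi> far G (EId C X))"
  by (simp_all add: change_of_base_def comp_funct_def hc_def)

lemma cell1_iff:
  "a \<in> Cell1 D X Y \<longleftrightarrow> fst a \<in> U \<and> snd a \<in> Arr K \<and> Dom K (snd a) = fst a \<and> Cod K (snd a) = fob G (EHom C X Y)"
  by (simp add: D_sel K.slice_ob_iff)

lemma cell2_iff:
  "\<alpha> \<in> Cell2 D X Y a b \<longleftrightarrow> a \<in> Cell1 D X Y \<and> b \<in> Cell1 D X Y \<and> Src \<alpha> = a \<and> Tgt \<alpha> = b \<and>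
     Val \<alpha> \<in> Arr K \<and> Dom K (Val \<alpha>) = fst a \<and> Cod K (Val \<alpha>) = fst b \<and> snd a = Val \<alpha> \<Zsemi> snd b"
  by (simp add: D_sel K.slice_hom_iff)

lemma cell2_eq:
  assumes "a \<in> Cell1 D X Y" and "b \<in> Cell1 D X Y"
  shows "Cell2 D X Y a b = {Arrow a \<phi> b | \<phi>. \<phi> \<in> Hom K (fst a) (fst b) \<and> snd a = \<phi> \<Zsemi> snd b}"
proof (rule set_eqI)
  show "\<alpha> \<in> Cell2 D X Y a b \<longleftrightarrow> \<alpha> \<in> {Arrow a \<phi> b | \<phi>. \<phi> \<in> Hom K (fst a) (fst b) \<and> snd a = \<phi> \<Zsemi> snd b}" for \<alpha>
    using assms by (cases \<alpha>) (simp add: cell2_iff Hom_iff[where C = K])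
qed

text \<open>
  This reduces the coherence axioms for 2-cells to equations between rearrangements of objects of \<open>U\<close>.
\<close>

lemma cell2_eqI: "\<alpha> \<in> Cell2 D X Y a b \<Longrightarrow> \<beta> \<in> Cell2 D X Y a b \<Longrightarrow> Val \<alpha> = Val \<beta> \<Longrightarrow> \<alpha> = \<beta>"
  by (simp add: cell2_iff arrow_eq_iff)

lemma cell2_iso: "\<alpha> \<in> Cell2 D X Y a b \<Longrightarrow> iso K (Val \<alpha>) \<Longrightarrow> iso (HomC D X Y) \<alpha>"
  by (auto simp: D_sel Hom_iff intro: K.slice_iso)

lemma val_sel [simp]:
  "Val (HComp2 D X Y Z \<alpha> \<beta>) = Val \<alpha> \<otimes> Val \<beta>"
  "Val (VComp D X Y \<alpha> \<beta>) = Val \<alpha> \<Zsemi> Val \<beta>"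
  "Val (Id2 D X Y a) = Ide K (fst a)"
  "fst (HComp1 D X Y Z a b) = fst a \<odot> fst b"
  "fst (Id1 D X) = Unt K"
  by (simp_all add: D_sel)

text \<open>Collects successive actions into one arrow of \<open>V\<close>, where the axioms of
  \<open>C\<close> can be applied. It opposes the right-nested normal form, so it is used with
  \<open>K.cmp_assoc_arr\<close> deleted.\<close>

lemma far_fold:
  assumes "h \<in> Arr V" and "k \<in> Arr V" and "Cod V h = Dom V k" and "x \<in> Arr K" and "Cod K x = fob G (Dom V h)"
  shows "(x \<Zsemi> far G h) \<Zsemi> far G k = x \<Zsemi> far G (h \<Zsemi>\<^bsub>V\<^esub> k)"
  using assms by (simp add: far_cmp_arr)

lemma pair_far_left:
  assumes "h \<in> Arr V" and "B \<in> Ob V" and "f \<in> Arr K" and "g \<in> Arr K"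
    and "Cod K f = fob G (Dom V h)" and "Cod K g = fob G B" and "Cod V h = A"
  shows "pair A B (f \<Zsemi> far G h) g = pair (Dom V h) B f g \<Zsemi> far G (h \<otimes>\<^bsub>V\<^esub> Ide V B)"
  using pair_far[of h "Ide V B" f g A B] assms by (simp add: far_ide)

lemma pair_far_right:
  assumes "h \<in> Arr V" and "A \<in> Ob V" and "f \<in> Arr K" and "g \<in> Arr K"
    and "Cod K g = fob G (Dom V h)" and "Cod K f = fob G A" and "Cod V h = B"
  shows "pair A B f (g \<Zsemi> far G h) = pair A (Dom V h) f g \<Zsemi> far G (Ide V A \<otimes>\<^bsub>V\<^esub> h)"
  using pair_far[of "Ide V A" h f g A B] assms by (simp add: far_ide)

text \<open>The solved form of \<open>pair_eps\<close>. It turns a unit paired into a generalized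
  element into an inverse unitor of \<open>V\<close>, which then matches the inverse unitors in
  \<open>V\<close>-naturality and in the underlying category.\<close>

lemma pair_eps_inverse:
  assumes "A \<in> Ob V" and "f \<in> Arr K" and "Cod K f = fob G A" and "Dom K f \<in> U"
  shows "pair (Unt V) A (eps G) f = f \<Zsemi> far G (inverse_of V (Lun V A))"
    and "pair A (Unt V) f (eps G) = f \<Zsemi> far G (inverse_of V (Run V A))"
  using far_cancel[OF V.structure_iso(2)[OF assms(1)] _ _ pair_eps(1)[OF assms]]
    far_cancel[OF V.structure_iso(3)[OF assms(1)] _ _ pair_eps(2)[OF assms]] assms by simp_all

text \<open>Composition in \<open>C\<close> is associative up to \<open>Asc V\<close>, and
  \<open>pair_asc\<close> absorbs that associator without changing the parameters. This makes
  horizontal composition strictly associative.\<close>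

lemma hc_assoc:
  assumes "X \<in> EOb C" and "Y \<in> EOb C" and "Z \<in> EOb C" and "T \<in> EOb C"
    and "f \<in> Arr K" and "Cod K f = fob G (EHom C X Y)" and "Dom K f \<in> U"
    and "g \<in> Arr K" and "Cod K g = fob G (EHom C Y Z)" and "Dom K g \<in> U"
    and "h \<in> Arr K" and "Cod K h = fob G (EHom C Z T)" and "Dom K h \<in> U"
  shows "hc X Z T (hc X Y Z f g) h = hc X Y T f (hc Y Z T g h)"
proof -
  have "hc X Z T (hc X Y Z f g) h =
      pair (EHom C X Y \<odot>\<^bsub>V\<^esub> EHom C Y Z) (EHom C Z T) (pair (EHom C X Y) (EHom C Y Z) f g) h \<Zsemi>
      far G ((ECmp C X Y Z \<otimes>\<^bsub>V\<^esub> Ide V (EHom C Z T)) \<Zsemi>\<^bsub>V\<^esub> ECmp C X Z T)"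
    using assms by (simp add: hc_def pair_far_left far_fold del: K.cmp_assoc_arr)
  also have "\<dots> = pair (EHom C X Y) (EHom C Y Z \<odot>\<^bsub>V\<^esub> EHom C Z T) f (pair (EHom C Y Z) (EHom C Z T) g h) \<Zsemi>
      far G ((Ide V (EHom C X Y) \<otimes>\<^bsub>V\<^esub> ECmp C Y Z T) \<Zsemi>\<^bsub>V\<^esub> ECmp C X Y T)"
    using assms by (simp add: C.ecmp_assoc far_fold[symmetric] pair_asc del: K.cmp_assoc_arr)
  also have "\<dots> = hc X Y T f (hc Y Z T g h)"
    using assms by (simp add: hc_def pair_far_right far_fold del: K.cmp_assoc_arr)
  finally show ?thesis .
qed

lemma hc_unit:
  assumes "X \<in> EOb C" and "Y \<in> EOb C" and "f \<in> Arr K" and "Cod K f = fob G (EHom C X Y)" and "Dom K f \<in> U"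
  shows "hc X X Y (eps G \<Zsemi> far G (EId C X)) f = f"
    and "hc X Y Y f (eps G \<Zsemi> far G (EId C Y)) = f"
  using assms by (simp_all add: hc_def pair_far_left pair_far_right far_fold C.eid_ecmp C.ecmp_eid
      pair_eps del: K.cmp_assoc_arr)

lemma two_category_D: "two_category D"
proof (rule two_category.intro)
  fix X Y Z T
  assume X: "X \<in> Cell0 D" and Y: "Y \<in> Cell0 D"
  show "category (HomC D X Y)"
    by (simp add: D_sel K.category_slice)
  show "Id1 D X \<in> Cell1 D X X"
    using X by (simp add: D_sel K.slice_ob_iff)
  {
    fix f assume "f \<in> Cell1 D X Y"
    then show "HComp1 D X X Y (Id1 D X) f = f" "HComp1 D X Y Y f (Id1 D Y) = f"
      using X Y by (simp_all add: D_sel(1,3,5) cell1_iff hc_unit prod_eq_iff)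
  next
    fix \<alpha> assume "\<alpha> \<in> Arr (HomC D X Y)"
    then show "HComp2 D X X Y (Id2 D X X (Id1 D X)) \<alpha> = \<alpha>"
      "HComp2 D X Y Y \<alpha> (Id2 D Y Y (Id1 D Y)) = \<alpha>"
      using X Y by (auto simp: D_sel K.slice_arr_iff K.slice_hom_iff K.slice_ob_iff hc_unit prod_eq_iff arrow_eq_iff)
  }
  assume Z: "Z \<in> Cell0 D"
  show "category_functor (prod_cat (HomC D X Y) (HomC D Y Z)) (HomC D X Z) (HComp D X Y Z)"
    using X Y Z ntld_functor[of "EHom C X Y" "EHom C Y Z"] nar_functor[of "ECmp C X Y Z"]
    by (auto simp: change_of_base_def Hom_iff[where C = V] intro!: category_functor_comp)
  assume T: "T \<in> Cell0 D"
  {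
    fix f g h assume "f \<in> Cell1 D X Y" "g \<in> Cell1 D Y Z" "h \<in> Cell1 D Z T"
    then show "HComp1 D X Z T (HComp1 D X Y Z f g) h = HComp1 D X Y T f (HComp1 D Y Z T g h)"
      using X Y Z T by (simp add: D_sel(1,3) cell1_iff hc_assoc)
  next
    fix \<alpha> \<beta> \<gamma> assume "\<alpha> \<in> Arr (HomC D X Y)" "\<beta> \<in> Arr (HomC D Y Z)" "\<gamma> \<in> Arr (HomC D Z T)"
    then show "HComp2 D X Z T (HComp2 D X Y Z \<alpha> \<beta>) \<gamma> = HComp2 D X Y T \<alpha> (HComp2 D Y Z T \<beta> \<gamma>)"
      using X Y Z T
      by (auto simp: D_sel K.slice_arr_iff K.slice_hom_iff K.slice_ob_iff hc_assoc arrow_eq_iff simp del: K.cmp_simps)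
  }
qed

section \<open>Criteria for pseudofunctors and pseudonatural transformations with values in
  \<open>D\<close>\<close>

sublocale D: two_category D
  by (rule two_category_D)

text \<open>By \<open>cell2_eqI\<close> every coherence axiom reduces to an equation in
  \<open>K\<close> between \<open>Val\<close> components, once both sides have the same boundary;
  the boundaries agree by strict associativity and unitality of \<open>D\<close>. As
  \<open>punit\<close> has the identity on \<open>Unt K\<close> as value, whiskering it contributes
  nothing.\<close>

lemma pseudofunctor_sliceI:
  assumes "two_category A"
    and pob: "\<And>X. X \<in> Cell0 A \<Longrightarrow> pob P X \<in> Cell0 D"
    and phom: "\<And>X Y. X \<in> Cell0 A \<Longrightarrow> Y \<in> Cell0 A \<Longrightarrow>
      category_functor (HomC A X Y) (HomC D (pob P X) (pob P Y)) (phom P X Y)"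
    and pcomp: "\<And>X Y Z f g. X \<in> Cell0 A \<Longrightarrow> Y \<in> Cell0 A \<Longrightarrow> Z \<in> Cell0 A \<Longrightarrow>
      f \<in> Cell1 A X Y \<Longrightarrow> g \<in> Cell1 A Y Z \<Longrightarrow>
      pcomp P X Y Z f g \<in> Cell2 D (pob P X) (pob P Z)
        (HComp1 D (pob P X) (pob P Y) (pob P Z) (par1 P X Y f) (par1 P Y Z g))
        (par1 P X Z (HComp1 A X Y Z f g)) \<and> iso K (Val (pcomp P X Y Z f g))"
    and punit: "\<And>X. X \<in> Cell0 A \<Longrightarrow>
      punit P X \<in> Cell2 D (pob P X) (pob P X) (Id1 D (pob P X)) (par1 P X X (Id1 A X)) \<and>
      Val (punit P X) = Ide K (Unt K)"
    and natural: "\<And>X Y Z f g f' g' \<alpha> \<beta>. X \<in> Cell0 A \<Longrightarrow> Y \<in> Cell0 A \<Longrightarrow> Z \<in> Cell0 A \<Longrightarrow>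
      \<alpha> \<in> Cell2 A X Y f f' \<Longrightarrow> \<beta> \<in> Cell2 A Y Z g g' \<Longrightarrow>
      (Val (par2 P X Y \<alpha>) \<otimes> Val (par2 P Y Z \<beta>)) \<Zsemi> Val (pcomp P X Y Z f' g') =
      Val (pcomp P X Y Z f g) \<Zsemi> Val (par2 P X Z (HComp2 A X Y Z \<alpha> \<beta>))"
    and assoc: "\<And>X Y Z T f g h. X \<in> Cell0 A \<Longrightarrow> Y \<in> Cell0 A \<Longrightarrow> Z \<in> Cell0 A \<Longrightarrow> T \<in> Cell0 A \<Longrightarrow>
      f \<in> Cell1 A X Y \<Longrightarrow> g \<in> Cell1 A Y Z \<Longrightarrow> h \<in> Cell1 A Z T \<Longrightarrow>
      (Val (pcomp P X Y Z f g) \<otimes> Ide K (fst (par1 P Z T h))) \<Zsemi> Val (pcomp P X Z T (HComp1 A X Y Z f g) h) =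
      (Ide K (fst (par1 P X Y f)) \<otimes> Val (pcomp P Y Z T g h)) \<Zsemi> Val (pcomp P X Y T f (HComp1 A Y Z T g h))"
    and unit: "\<And>X Y f. X \<in> Cell0 A \<Longrightarrow> Y \<in> Cell0 A \<Longrightarrow> f \<in> Cell1 A X Y \<Longrightarrow>
      Val (pcomp P X X Y (Id1 A X) f) = Ide K (fst (par1 P X Y f)) \<and>
      Val (pcomp P X Y Y f (Id1 A Y)) = Ide K (fst (par1 P X Y f))"
  shows "pseudofunctor A D P"
proof (intro pseudofunctor.intro pseudofunctor_axioms.intro assms(1) two_category_D pob phom)
  interpret A: two_category A by fact
  let ?p = "pob P" and ?p1 = "par1 P"
  note pcell = pcomp[THEN conjunct1] and ucell = punit[THEN conjunct1] and uval = punit[THEN conjunct2]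
  have p1: "?p1 X Y f \<in> Cell1 D (?p X) (?p Y)" if "X \<in> Cell0 A" "Y \<in> Cell0 A" "f \<in> Cell1 A X Y" for X Y f
    using category_functor.fob_ob[OF phom] that by blast
  have p2: "par2 P X Y \<alpha> \<in> Cell2 D (?p X) (?p Y) (?p1 X Y f) (?p1 X Y g)"
    if "X \<in> Cell0 A" "Y \<in> Cell0 A" "\<alpha> \<in> Cell2 A X Y f g" for X Y f g \<alpha>
    using category_functor.far_hom[OF phom] that by blast
  fix X Y Z T f g h f' g' \<alpha> \<beta>
  assume X: "X \<in> Cell0 A"
  note X' = pob[OF X]
  show "punit P X \<in> Cell2 D (?p X) (?p X) (Id1 D (?p X)) (?p1 X X (Id1 A X))"
    by (rule ucell[OF X])
  show "iso (HomC D (?p X) (?p X)) (punit P X)"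
    by (rule cell2_iso[OF ucell[OF X]]) (simp add: uval X)
  assume Y: "Y \<in> Cell0 A"
  note Y' = pob[OF Y]
  {
    assume f: "f \<in> Cell1 A X Y"
    note f' = p1[OF X Y f] and i = D.id2_cell[OF X' Y' p1[OF X Y f]]
    have U: "fst (?p1 X Y f) \<in> U"
      using f' by (simp add: cell1_iff)
    show "VComp D (?p X) (?p Y)
        (HComp2 D (?p X) (?p X) (?p Y) (punit P X) (Id2 D (?p X) (?p Y) (?p1 X Y f)))
        (pcomp P X X Y (Id1 A X) f) = Id2 D (?p X) (?p Y) (?p1 X Y f)"
      using D.vcomp_cell[OF X' Y' D.hcomp2_cell[OF X' X' Y' ucell[OF X] i] pcell[OF X X Y A.id1_cell[OF X] f]]
        unit[OF X Y f] U
      by (intro cell2_eqI[OF _ i]) (simp_all add: A.id1_hcomp1[OF X Y f] D.id1_hcomp1[OF X' Y' f'] uval X)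
    show "VComp D (?p X) (?p Y)
        (HComp2 D (?p X) (?p Y) (?p Y) (Id2 D (?p X) (?p Y) (?p1 X Y f)) (punit P Y))
        (pcomp P X Y Y f (Id1 A Y)) = Id2 D (?p X) (?p Y) (?p1 X Y f)"
      using D.vcomp_cell[OF X' Y' D.hcomp2_cell[OF X' Y' Y' i ucell[OF Y]] pcell[OF X Y Y f A.id1_cell[OF Y]]]
        unit[OF X Y f] U
      by (intro cell2_eqI[OF _ i]) (simp_all add: A.hcomp1_id1[OF X Y f] D.hcomp1_id1[OF X' Y' f'] uval Y)
  }
  assume Z: "Z \<in> Cell0 A"
  note Z' = pob[OF Z]
  {
    assume f: "f \<in> Cell1 A X Y" and g: "g \<in> Cell1 A Y Z"
    show "pcomp P X Y Z f g \<in> Cell2 D (?p X) (?p Z)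
        (HComp1 D (?p X) (?p Y) (?p Z) (?p1 X Y f) (?p1 Y Z g)) (?p1 X Z (HComp1 A X Y Z f g))"
      by (rule pcell[OF X Y Z f g])
    show "iso (HomC D (?p X) (?p Z)) (pcomp P X Y Z f g)"
      using cell2_iso pcomp[OF X Y Z f g] by blast
    assume T: "T \<in> Cell0 A" and h: "h \<in> Cell1 A Z T"
    note T' = pob[OF T]
    let ?fg = "HComp1 A X Y Z f g" and ?gh = "HComp1 A Y Z T g h"
    note fg = A.hcomp1_cell[OF X Y Z f g] and gh = A.hcomp1_cell[OF Y Z T g h]
    let ?src = "HComp1 D (?p X) (?p Z) (?p T) (HComp1 D (?p X) (?p Y) (?p Z) (?p1 X Y f) (?p1 Y Z g)) (?p1 Z T h)"
    show "VComp D (?p X) (?p T)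
        (HComp2 D (?p X) (?p Z) (?p T) (pcomp P X Y Z f g) (Id2 D (?p Z) (?p T) (?p1 Z T h)))
        (pcomp P X Z T ?fg h) =
      VComp D (?p X) (?p T)
        (HComp2 D (?p X) (?p Y) (?p T) (Id2 D (?p X) (?p Y) (?p1 X Y f)) (pcomp P Y Z T g h))
        (pcomp P X Y T f ?gh)" (is "?l = ?r")
    proof (rule cell2_eqI)
      show "?l \<in> Cell2 D (?p X) (?p T) ?src (?p1 X T (HComp1 A X Z T ?fg h))"
        by (rule D.vcomp_cell[OF X' T' D.hcomp2_cell[OF X' Z' T' pcell[OF X Y Z f g] D.id2_cell[OF Z' T' p1[OF Z T h]]]
              pcell[OF X Z T fg h]])
      show "?r \<in> Cell2 D (?p X) (?p T) ?src (?p1 X T (HComp1 A X Z T ?fg h))"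
        using D.vcomp_cell[OF X' T' D.hcomp2_cell[OF X' Y' T' D.id2_cell[OF X' Y' p1[OF X Y f]] pcell[OF Y Z T g h]]
              pcell[OF X Y T f gh]]
        by (simp add: A.hcomp1_assoc[OF X Y Z T f g h]
            D.hcomp1_assoc[OF X' Y' Z' T' p1[OF X Y f] p1[OF Y Z g] p1[OF Z T h]])
      show "Val ?l = Val ?r"
        using assoc[OF X Y Z T f g h] by simp
    qed
  next
    assume \<alpha>: "\<alpha> \<in> Cell2 A X Y f f'" and \<beta>: "\<beta> \<in> Cell2 A Y Z g g'"
    note f = A.cell2_cells[OF X Y \<alpha>] and g = A.cell2_cells[OF Y Z \<beta>]
    show "VComp D (?p X) (?p Z) (HComp2 D (?p X) (?p Y) (?p Z) (par2 P X Y \<alpha>) (par2 P Y Z \<beta>)) (pcomp P X Y Z f' g') =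
      VComp D (?p X) (?p Z) (pcomp P X Y Z f g) (par2 P X Z (HComp2 A X Y Z \<alpha> \<beta>))"
      using natural[OF X Y Z \<alpha> \<beta>]
      by (intro cell2_eqI[OF D.vcomp_cell[OF X' Z' D.hcomp2_cell[OF X' Y' Z' p2[OF X Y \<alpha>] p2[OF Y Z \<beta>]]
              pcell[OF X Y Z f(2) g(2)]]
            D.vcomp_cell[OF X' Z' pcell[OF X Y Z f(1) g(1)] p2[OF X Z A.hcomp2_cell[OF X Y Z \<alpha> \<beta>]]]]) simp
  }
qed

text \<open>The 1-cell components have parameter \<open>Unt K\<close>. Whiskering a 2-cell by such a
  component tensors its value with the identity on the strict unit and leaves it unchanged, so the
  component whiskerings vanish from the axioms.\<close>

lemma pseudonatural_sliceI:
  assumes "pseudofunctor A D P" and "pseudofunctor A D Q"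
    and n1: "\<And>X. X \<in> Cell0 A \<Longrightarrow> pn1 n X \<in> Cell1 D (pob P X) (pob Q X) \<and> fst (pn1 n X) = Unt K"
    and n2: "\<And>X Y f. X \<in> Cell0 A \<Longrightarrow> Y \<in> Cell0 A \<Longrightarrow> f \<in> Cell1 A X Y \<Longrightarrow>
      pn2 n X Y f \<in> Cell2 D (pob P X) (pob Q Y)
        (HComp1 D (pob P X) (pob P Y) (pob Q Y) (par1 P X Y f) (pn1 n Y))
        (HComp1 D (pob P X) (pob Q X) (pob Q Y) (pn1 n X) (par1 Q X Y f)) \<and> iso K (Val (pn2 n X Y f))"
    and natural: "\<And>X Y f g \<alpha>. X \<in> Cell0 A \<Longrightarrow> Y \<in> Cell0 A \<Longrightarrow> \<alpha> \<in> Cell2 A X Y f g \<Longrightarrow>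
      Val (par2 P X Y \<alpha>) \<Zsemi> Val (pn2 n X Y g) = Val (pn2 n X Y f) \<Zsemi> Val (par2 Q X Y \<alpha>)"
    and unit: "\<And>X. X \<in> Cell0 A \<Longrightarrow> Val (punit P X) \<Zsemi> Val (pn2 n X X (Id1 A X)) = Val (punit Q X)"
    and comp: "\<And>X Y Z f g. X \<in> Cell0 A \<Longrightarrow> Y \<in> Cell0 A \<Longrightarrow> Z \<in> Cell0 A \<Longrightarrow>
      f \<in> Cell1 A X Y \<Longrightarrow> g \<in> Cell1 A Y Z \<Longrightarrow>
      Val (pcomp P X Y Z f g) \<Zsemi> Val (pn2 n X Z (HComp1 A X Y Z f g)) =
      ((Ide K (fst (par1 P X Y f)) \<otimes> Val (pn2 n Y Z g)) \<Zsemi>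
        (Val (pn2 n X Y f) \<otimes> Ide K (fst (par1 Q Y Z g)))) \<Zsemi> Val (pcomp Q X Y Z f g)"
  shows "pseudonatural A D P Q n"
proof -
  interpret P: pseudofunctor A D P by fact
  interpret Q: pseudofunctor A D Q by fact
  let ?p = "pob P" and ?q = "pob Q" and ?p1 = "par1 P" and ?q1 = "par1 Q"
  note ob = P.pob_cell Q.pob_cell
  note n1_cell = n1[THEN conjunct1] and fst_n1 = n1[THEN conjunct2]
  note n2_cell = n2[THEN conjunct1]
  have id: "Id2 D (?p X) (?q X) (pn1 n X) \<in> Cell2 D (?p X) (?q X) (pn1 n X) (pn1 n X)" if "X \<in> Cell0 A" for X
    using that by (simp add: ob n1_cell D.id2_cell)
  have val: "Val \<alpha> \<otimes> Ide K (Unt K) = Val \<alpha>" "Ide K (Unt K) \<otimes> Val \<alpha> = Val \<alpha>"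
    if "\<alpha> \<in> Cell2 D X Y f g" for X Y f g \<alpha>
    using that by (simp_all add: cell2_iff cell1_iff)
  show ?thesis
  proof (intro pseudonatural.intro pseudonatural_axioms.intro assms(1,2))
    fix X Y Z f g \<alpha>
    assume X: "X \<in> Cell0 A"
    note X' = P.pob_cell[OF X] Q.pob_cell[OF X]
    show "pn1 n X \<in> Cell1 D (?p X) (?q X)"
      by (rule n1_cell[OF X])
    show "VComp D (?p X) (?q X)
        (HComp2 D (?p X) (?p X) (?q X) (punit P X) (Id2 D (?p X) (?q X) (pn1 n X)))
        (pn2 n X X (Id1 A X)) =
      HComp2 D (?p X) (?q X) (?q X) (Id2 D (?p X) (?q X) (pn1 n X)) (punit Q X)" (is "?l = ?r")
    proof (rule cell2_eqI)
      show "?l \<in> Cell2 D (?p X) (?q X) (HComp1 D (?p X) (?p X) (?q X) (Id1 D (?p X)) (pn1 n X))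
          (HComp1 D (?p X) (?q X) (?q X) (pn1 n X) (?q1 X X (Id1 A X)))"
        by (rule D.vcomp_cell[OF X' D.hcomp2_cell[OF X'(1) X' P.punit_cell[OF X] id[OF X]]
              n2_cell[OF X X P.C.id1_cell[OF X]]])
      show "?r \<in> Cell2 D (?p X) (?q X) (HComp1 D (?p X) (?p X) (?q X) (Id1 D (?p X)) (pn1 n X))
          (HComp1 D (?p X) (?q X) (?q X) (pn1 n X) (?q1 X X (Id1 A X)))"
        using D.hcomp2_cell[OF X' X'(2) id[OF X] Q.punit_cell[OF X]]
        by (simp add: X X' n1_cell D.id1_hcomp1 D.hcomp1_id1)
      show "Val ?l = Val ?r"
        using val[OF P.punit_cell[OF X]] val[OF Q.punit_cell[OF X]] X by (simp add: unit fst_n1)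
    qed
    assume Y: "Y \<in> Cell0 A"
    note Y' = P.pob_cell[OF Y] Q.pob_cell[OF Y]
    {
      assume f: "f \<in> Cell1 A X Y"
      show "pn2 n X Y f \<in> Cell2 D (?p X) (?q Y)
          (HComp1 D (?p X) (?p Y) (?q Y) (?p1 X Y f) (pn1 n Y)) (HComp1 D (?p X) (?q X) (?q Y) (pn1 n X) (?q1 X Y f))"
        by (rule n2_cell[OF X Y f])
      show "iso (HomC D (?p X) (?q Y)) (pn2 n X Y f)"
        using cell2_iso n2[OF X Y f] by blast
      fix Z g
      assume Z: "Z \<in> Cell0 A" and g: "g \<in> Cell1 A Y Z"
      note Z' = P.pob_cell[OF Z] Q.pob_cell[OF Z] and fg = P.C.hcomp1_cell[OF X Y Z f g]
      note cells = P.par1_cell[OF X Y f] P.par1_cell[OF Y Z g] Q.par1_cell[OF X Y f] Q.par1_cell[OF Y Z g]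
        n1_cell[OF X] n1_cell[OF Y] n1_cell[OF Z]
      let ?fg = "HComp1 A X Y Z f g"
        and ?src = "HComp1 D (?p X) (?p Z) (?q Z) (HComp1 D (?p X) (?p Y) (?p Z) (?p1 X Y f) (?p1 Y Z g)) (pn1 n Z)"
      let ?tgt = "HComp1 D (?p X) (?q X) (?q Z) (pn1 n X) (?q1 X Z ?fg)"
      show "VComp D (?p X) (?q Z)
          (HComp2 D (?p X) (?p Z) (?q Z) (pcomp P X Y Z f g) (Id2 D (?p Z) (?q Z) (pn1 n Z)))
          (pn2 n X Z ?fg) =
        VComp D (?p X) (?q Z)
          (VComp D (?p X) (?q Z)
            (HComp2 D (?p X) (?p Y) (?q Z) (Id2 D (?p X) (?p Y) (?p1 X Y f)) (pn2 n Y Z g))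
            (HComp2 D (?p X) (?q Y) (?q Z) (pn2 n X Y f) (Id2 D (?q Y) (?q Z) (?q1 Y Z g))))
          (HComp2 D (?p X) (?q X) (?q Z) (Id2 D (?p X) (?q X) (pn1 n X)) (pcomp Q X Y Z f g))" (is "?l = ?r")
      proof (rule cell2_eqI)
        show "?l \<in> Cell2 D (?p X) (?q Z) ?src ?tgt"
          by (rule D.vcomp_cell[OF X'(1) Z'(2) D.hcomp2_cell[OF X'(1) Z' P.pcomp_cell[OF X Y Z f g] id[OF Z]]
                n2_cell[OF X Z fg]])
        \<comment> \<open>Strict associativity of 1-cells makes the boundaries of the three
          whiskered 2-cells literally match, so that they compose without inserted
          associators.\<close>
        have e: "HComp1 D (?p X) (?p Y) (?q Z) (?p1 X Y f) (HComp1 D (?p Y) (?p Z) (?q Z) (?p1 Y Z g) (pn1 n Z)) = ?src"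
          "HComp1 D (?p X) (?p Y) (?q Z) (?p1 X Y f) (HComp1 D (?p Y) (?q Y) (?q Z) (pn1 n Y) (?q1 Y Z g)) =
            HComp1 D (?p X) (?q Y) (?q Z) (HComp1 D (?p X) (?p Y) (?q Y) (?p1 X Y f) (pn1 n Y)) (?q1 Y Z g)"
          "HComp1 D (?p X) (?q Y) (?q Z) (HComp1 D (?p X) (?q X) (?q Y) (pn1 n X) (?q1 X Y f)) (?q1 Y Z g) =
            HComp1 D (?p X) (?q X) (?q Z) (pn1 n X) (HComp1 D (?q X) (?q Y) (?q Z) (?q1 X Y f) (?q1 Y Z g))"
          using X' Y' Z' cells by (simp_all add: D.hcomp1_assoc)
        show "?r \<in> Cell2 D (?p X) (?q Z) ?src ?tgt"
          by (rule D.vcomp_cell[OF X'(1) Z'(2) D.vcomp_cell[OF X'(1) Z'(2)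
                D.hcomp2_cell[OF X'(1) Y'(1) Z'(2) D.id2_cell[OF X'(1) Y'(1) cells(1)] n2_cell[OF Y Z g], unfolded e(1,2)]
                D.hcomp2_cell[OF X'(1) Y'(2) Z'(2) n2_cell[OF X Y f] D.id2_cell[OF Y'(2) Z'(2) cells(4)], unfolded e(3)]]
                D.hcomp2_cell[OF X' Z'(2) id[OF X] Q.pcomp_cell[OF X Y Z f g]]])
        show "Val ?l = Val ?r"
          using val(1)[OF P.pcomp_cell[OF X Y Z f g]] val(2)[OF Q.pcomp_cell[OF X Y Z f g]] comp[OF X Y Z f g] X Z
          by (simp add: fst_n1)
      qed
    next
      fix f g
      assume \<alpha>: "\<alpha> \<in> Cell2 A X Y f g"
      note f = P.C.cell2_cells[OF X Y \<alpha>]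
      show "VComp D (?p X) (?q Y)
          (HComp2 D (?p X) (?p Y) (?q Y) (par2 P X Y \<alpha>) (Id2 D (?p Y) (?q Y) (pn1 n Y))) (pn2 n X Y g) =
        VComp D (?p X) (?q Y) (pn2 n X Y f)
          (HComp2 D (?p X) (?q X) (?q Y) (Id2 D (?p X) (?q X) (pn1 n X)) (par2 Q X Y \<alpha>))" (is "?l = ?r")
      proof (rule cell2_eqI)
        show "?l \<in> Cell2 D (?p X) (?q Y) (HComp1 D (?p X) (?p Y) (?q Y) (?p1 X Y f) (pn1 n Y))
            (HComp1 D (?p X) (?q X) (?q Y) (pn1 n X) (?q1 X Y g))"
          by (rule D.vcomp_cell[OF X'(1) Y'(2) D.hcomp2_cell[OF X'(1) Y' P.par2_cell[OF X Y \<alpha>] id[OF Y]]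
                n2_cell[OF X Y f(2)]])
        show "?r \<in> Cell2 D (?p X) (?q Y) (HComp1 D (?p X) (?p Y) (?q Y) (?p1 X Y f) (pn1 n Y))
            (HComp1 D (?p X) (?q X) (?q Y) (pn1 n X) (?q1 X Y g))"
          by (rule D.vcomp_cell[OF X'(1) Y'(2) n2_cell[OF X Y f(1)]
                D.hcomp2_cell[OF X' Y'(2) id[OF X] Q.par2_cell[OF X Y \<alpha>]]])
        show "Val ?l = Val ?r"
          using val(1)[OF P.par2_cell[OF X Y \<alpha>]] val(2)[OF Q.par2_cell[OF X Y \<alpha>]] natural[OF X Y \<alpha>] X Y
          by (simp add: fst_n1)
      qed
    }
  qed
qed

text \<open>With identity structure 2-cells, every 2-cell axiom says that \<open>P\<close> and
  \<open>Q\<close> have the same \<open>Val\<close> on 2-cells and on structure 2-cells. The genuine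
  naturality is the equation \<open>nat1\<close> of 1-cells.\<close>

lemma strictly_natural_sliceI:
  assumes P: "pseudofunctor A D P" and Q: "pseudofunctor A D Q"
    and t: "\<And>X. X \<in> Cell0 A \<Longrightarrow> t X \<in> Cell1 D (pob P X) (pob Q X) \<and> fst (t X) = Unt K"
    and nat1: "\<And>X Y f. X \<in> Cell0 A \<Longrightarrow> Y \<in> Cell0 A \<Longrightarrow> f \<in> Cell1 A X Y \<Longrightarrow>
      HComp1 D (pob P X) (pob P Y) (pob Q Y) (par1 P X Y f) (t Y) =
      HComp1 D (pob P X) (pob Q X) (pob Q Y) (t X) (par1 Q X Y f)"
    and val2: "\<And>X Y f g \<alpha>. X \<in> Cell0 A \<Longrightarrow> Y \<in> Cell0 A \<Longrightarrow> \<alpha> \<in> Cell2 A X Y f g \<Longrightarrow>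
      Val (par2 P X Y \<alpha>) = Val (par2 Q X Y \<alpha>)"
    and unit: "\<And>X. X \<in> Cell0 A \<Longrightarrow> Val (punit P X) = Val (punit Q X)"
    and comp: "\<And>X Y Z f g. X \<in> Cell0 A \<Longrightarrow> Y \<in> Cell0 A \<Longrightarrow> Z \<in> Cell0 A \<Longrightarrow>
      f \<in> Cell1 A X Y \<Longrightarrow> g \<in> Cell1 A Y Z \<Longrightarrow> Val (pcomp P X Y Z f g) = Val (pcomp Q X Y Z f g)"
  shows "strictly_natural A D P Q t"
proof -
  interpret P: pseudofunctor A D P by fact
  interpret Q: pseudofunctor A D Q by fact
  note ob = P.pob_cell Q.pob_cell
  \<comment> \<open>The parameter objects of the two sides of \<open>nat1\<close> are those of
    \<open>P\<close> and of \<open>Q\<close>, each tensored with the strict unit on one side, so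
    they coincide.\<close>
  have fst_eq: "fst (par1 P X Y f) = fst (par1 Q X Y f)" "fst (par1 P X Y f) \<in> U"
    if "X \<in> Cell0 A" "Y \<in> Cell0 A" "f \<in> Cell1 A X Y" for X Y f
    using arg_cong[OF nat1[OF that], of fst] P.par1_cell[OF that] Q.par1_cell[OF that] t that
    by (simp_all add: cell1_iff)
  have val: "Val \<alpha> \<in> Arr K" "Dom K (Val \<alpha>) = fst f" "Cod K (Val \<alpha>) = fst g"
    if "\<alpha> \<in> Cell2 D X Y f g" for X Y f g \<alpha>
    using that by (simp_all add: cell2_iff)
  let ?l = "\<lambda>X Y f. HComp1 D (pob P X) (pob P Y) (pob Q Y) (par1 P X Y f) (t Y)"
  have "pseudonatural A D P Q \<lparr>pn1 = t, pn2 = (\<lambda>X Y f. Id2 D (pob P X) (pob Q Y) (?l X Y f))\<rparr>"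
  proof (rule pseudonatural_sliceI[OF P Q]; unfold pnat.select_convs val_sel)
    fix X Y Z f g \<alpha>
    assume X: "X \<in> Cell0 A"
    show "t X \<in> Cell1 D (pob P X) (pob Q X) \<and> fst (t X) = Unt K"
      by (rule t[OF X])
    show "Val (punit P X) \<Zsemi> Ide K (fst (par1 P X X (Id1 A X)) \<odot> fst (t X)) = Val (punit Q X)"
      using X val[OF P.punit_cell[OF X]] t fst_eq[OF X X P.C.id1_cell[OF X]] by (simp add: unit)
    assume Y: "Y \<in> Cell0 A"
    {
      assume f: "f \<in> Cell1 A X Y"
      have "?l X Y f \<in> Cell1 D (pob P X) (pob Q Y)"
        using X Y f t by (simp add: ob P.par1_cell D.hcomp1_cell)
      then show "Id2 D (pob P X) (pob Q Y) (?l X Y f) \<in> Cell2 D (pob P X) (pob Q Y) (?l X Y f)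
          (HComp1 D (pob P X) (pob Q X) (pob Q Y) (t X) (par1 Q X Y f)) \<and>
        iso K (Ide K (fst (par1 P X Y f) \<odot> fst (t Y)))"
        using X Y t fst_eq[OF X Y f] by (simp add: ob D.id2_cell flip: nat1[OF X Y f])
      fix Z g
      assume Z: "Z \<in> Cell0 A" and g: "g \<in> Cell1 A Y Z"
      have "par1 P X Z (HComp1 A X Y Z f g) \<in> Cell1 D (pob P X) (pob P Z)"
        using X Y Z f g by (simp add: P.par1_cell P.C.hcomp1_cell)
      then show "Val (pcomp P X Y Z f g) \<Zsemi> Ide K (fst (par1 P X Z (HComp1 A X Y Z f g)) \<odot> fst (t Z)) =
        ((Ide K (fst (par1 P X Y f)) \<otimes> Ide K (fst (par1 P Y Z g) \<odot> fst (t Z))) \<Zsemi>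
          (Ide K (fst (par1 P X Y f) \<odot> fst (t Y)) \<otimes> Ide K (fst (par1 Q Y Z g)))) \<Zsemi> Val (pcomp Q X Y Z f g)"
        using val[OF P.pcomp_cell[OF X Y Z f g]] fst_eq[OF X Y f] fst_eq[OF Y Z g] t Y Z comp[OF X Y Z f g]
        by (simp add: cell1_iff)
    next
      fix f g
      assume \<alpha>: "\<alpha> \<in> Cell2 A X Y f g"
      note f = P.C.cell2_cells[OF X Y \<alpha>]
      show "Val (par2 P X Y \<alpha>) \<Zsemi> Ide K (fst (par1 P X Y g) \<odot> fst (t Y)) =
          Ide K (fst (par1 P X Y f) \<odot> fst (t Y)) \<Zsemi> Val (par2 Q X Y \<alpha>)"
        using val[OF P.par2_cell[OF X Y \<alpha>]] fst_eq[OF X Y f(1)] fst_eq[OF X Y f(2)] t Y val2[OF X Y \<alpha>] by simp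
    }
  qed
  then show ?thesis
    by (simp add: strictly_natural_def nat1)
qed

text \<open>
  The unitors in the definition of \<open>V\<close>-naturality disappear because pairing with \<open>eps G\<close> is inverse
  to the action of a unitor.
\<close>

lemma hc_natural:
  assumes "enriched_natural V A C E H \<tau>" and "X \<in> EOb A" and "Y \<in> EOb A"
    and "x \<in> Arr K" and "Cod K x = fob G (EHom A X Y)" and "Dom K x \<in> U"
  shows "hc (eob E X) (eob E Y) (eob H Y) (x \<Zsemi> far G (ear E X Y)) (eps G \<Zsemi> far G (\<tau> Y)) =
    hc (eob E X) (eob H X) (eob H Y) (eps G \<Zsemi> far G (\<tau> X)) (x \<Zsemi> far G (ear H X Y))"
proof -
  interpret N: enriched_natural V A C E H \<tau> by fact
  have 1: "EHom A X Y \<in> Ob V" "eob E X \<in> EOb C" "eob E Y \<in> EOb C" "eob H X \<in> EOb C" "eob H Y \<in> EOb C"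
    using assms N.F.C.ehom_ob N.F.eob_ob N.G.eob_ob by auto
  have 2: "ear E X Y \<in> Arr V" "Dom V (ear E X Y) = EHom A X Y" "Cod V (ear E X Y) = EHom C (eob E X) (eob E Y)"
    "ear H X Y \<in> Arr V" "Dom V (ear H X Y) = EHom A X Y" "Cod V (ear H X Y) = EHom C (eob H X) (eob H Y)"
    "\<tau> X \<in> Arr V" "Dom V (\<tau> X) = Unt V" "Cod V (\<tau> X) = EHom C (eob E X) (eob H X)"
    "\<tau> Y \<in> Arr V" "Dom V (\<tau> Y) = Unt V" "Cod V (\<tau> Y) = EHom C (eob E Y) (eob H Y)"
    using assms N.F.ear_hom[of X Y] N.G.ear_hom[of X Y] N.ecomponent_hom by (auto simp: Hom_iff)
  show ?thesis
    using assms 1 2 N.enaturality[of X Y]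
    by (simp add: hc_def pair_far pair_eps_inverse far_fold del: K.cmp_assoc_arr)
qed

end

section \<open>The monoidal product\<close>

locale slice_monoidal = slice_enriched V K G U C + B: monoidal_enriched_category V C B
  for V :: "('vo, 'va, 'y) smoncat_scheme" and K :: "('o, 'a, 'z) smoncat_scheme" (structure)
    and G :: "('vo, 'va, 'o, 'a, 'w) laxfun_scheme" and U and C :: "('x, 'vo, 'va) ecat"
    and B :: "('x, 'va) emon"
begin

abbreviation bx :: "'x \<Rightarrow> 'x \<Rightarrow> 'x" where
  "bx X Y \<equiv> eob (EBox B) (X, Y)"

abbreviation be :: "'x \<Rightarrow> 'x \<Rightarrow> 'x \<Rightarrow> 'x \<Rightarrow> 'va" where
  "be X1 X2 Y1 Y2 \<equiv> ear (EBox B) (X1, X2) (Y1, Y2)"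

definition bc :: "'x \<Rightarrow> 'x \<Rightarrow> 'x \<Rightarrow> 'x \<Rightarrow> 'a \<Rightarrow> 'a \<Rightarrow> 'a" where
  "bc X1 X2 Y1 Y2 f g = pair (EHom C X1 Y1) (EHom C X2 Y2) f g \<Zsemi> far G (be X1 X2 Y1 Y2)"

lemma bx_ob [simp]: "X \<in> EOb C \<Longrightarrow> Y \<in> EOb C \<Longrightarrow> bx X Y \<in> EOb C"
  using enriched_functor.eob_ob[OF B.box_functor, of "(X, Y)"] by (simp add: tensor_ecat_def)

lemma be_simps [simp]:
  assumes "X1 \<in> EOb C" and "X2 \<in> EOb C" and "Y1 \<in> EOb C" and "Y2 \<in> EOb C"
  shows "be X1 X2 Y1 Y2 \<in> Arr V" and "Dom V (be X1 X2 Y1 Y2) = EHom C X1 Y1 \<odot>\<^bsub>V\<^esub> EHom C X2 Y2"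
    and "Cod V (be X1 X2 Y1 Y2) = EHom C (bx X1 X2) (bx Y1 Y2)"
  using enriched_functor.ear_hom[OF B.box_functor, of "(X1, X2)" "(Y1, Y2)"] assms
  by (simp_all add: tensor_ecat_def Hom_iff)

lemma be_cmp:
  assumes "X1 \<in> EOb C" and "X2 \<in> EOb C" and "Y1 \<in> EOb C" and "Y2 \<in> EOb C" and "Z1 \<in> EOb C" and "Z2 \<in> EOb C"
  shows "(be X1 X2 Y1 Y2 \<otimes>\<^bsub>V\<^esub> be Y1 Y2 Z1 Z2) \<Zsemi>\<^bsub>V\<^esub> ECmp C (bx X1 X2) (bx Y1 Y2) (bx Z1 Z2) =
    middle_swap V (EHom C X1 Y1) (EHom C X2 Y2) (EHom C Y1 Z1) (EHom C Y2 Z2) \<Zsemi>\<^bsub>V\<^esub>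
      ((ECmp C X1 Y1 Z1 \<otimes>\<^bsub>V\<^esub> ECmp C X2 Y2 Z2) \<Zsemi>\<^bsub>V\<^esub> be X1 X2 Z1 Z2)"
  using enriched_functor.ear_cmp[OF B.box_functor, of "(X1, X2)" "(Y1, Y2)" "(Z1, Z2)"] assms
  by (simp add: tensor_ecat_def)

lemma be_id:
  assumes "X1 \<in> EOb C" and "X2 \<in> EOb C"
  shows "inverse_of V (Lun V (Unt V)) \<Zsemi>\<^bsub>V\<^esub> ((EId C X1 \<otimes>\<^bsub>V\<^esub> EId C X2) \<Zsemi>\<^bsub>V\<^esub> be X1 X2 X1 X2) = EId C (bx X1 X2)"
  using enriched_functor.ear_id[OF B.box_functor, of "(X1, X2)"] assms
  by (simp add: tensor_ecat_def)

lemma bc_simps [simp]: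
  assumes "X1 \<in> EOb C" and "X2 \<in> EOb C" and "Y1 \<in> EOb C" and "Y2 \<in> EOb C"
    and "f \<in> Arr K" and "g \<in> Arr K" and "Cod K f = fob G (EHom C X1 Y1)" and "Cod K g = fob G (EHom C X2 Y2)"
  shows "bc X1 X2 Y1 Y2 f g \<in> Arr K" and "Dom K (bc X1 X2 Y1 Y2 f g) = Dom K f \<odot> Dom K g"
    and "Cod K (bc X1 X2 Y1 Y2 f g) = fob G (EHom C (bx X1 X2) (bx Y1 Y2))"
  using assms by (simp_all add: bc_def)

text \<open>This is the origin of the tensorator. Functoriality of the product of \<open>C\<close>
  contains the middle swap of hom-objects from the composition of \<open>C \<otimes> C\<close>;
  \<open>pair_middle_swap\<close> converts it into the middle swap of parameters.\<close>

lemma hc_bc: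
  assumes "X1 \<in> EOb C" and "X2 \<in> EOb C" and "Y1 \<in> EOb C" and "Y2 \<in> EOb C" and "Z1 \<in> EOb C" and "Z2 \<in> EOb C"
    and "f1 \<in> Arr K" and "Cod K f1 = fob G (EHom C X1 Y1)" and "Dom K f1 \<in> U"
    and "f2 \<in> Arr K" and "Cod K f2 = fob G (EHom C X2 Y2)" and "Dom K f2 \<in> U"
    and "g1 \<in> Arr K" and "Cod K g1 = fob G (EHom C Y1 Z1)" and "Dom K g1 \<in> U"
    and "g2 \<in> Arr K" and "Cod K g2 = fob G (EHom C Y2 Z2)" and "Dom K g2 \<in> U"
  shows "hc (bx X1 X2) (bx Y1 Y2) (bx Z1 Z2) (bc X1 X2 Y1 Y2 f1 f2) (bc Y1 Y2 Z1 Z2 g1 g2) =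
    middle_swap K (Dom K f1) (Dom K f2) (Dom K g1) (Dom K g2) \<Zsemi>
      bc X1 X2 Z1 Z2 (hc X1 Y1 Z1 f1 g1) (hc X2 Y2 Z2 f2 g2)"
proof -
  let ?A = "EHom C X1 Y1" and ?B = "EHom C X2 Y2" and ?D = "EHom C Y1 Z1" and ?E = "EHom C Y2 Z2"
  let ?m = "middle_swap V ?A ?B ?D ?E"
    and ?mK = "middle_swap K (Dom K f1) (Dom K f2) (Dom K g1) (Dom K g2)"
  let ?p = "pair (?A \<odot>\<^bsub>V\<^esub> ?B) (?D \<odot>\<^bsub>V\<^esub> ?E) (pair ?A ?B f1 f2) (pair ?D ?E g1 g2)"
    and ?q = "pair (?A \<odot>\<^bsub>V\<^esub> ?D) (?B \<odot>\<^bsub>V\<^esub> ?E) (pair ?A ?D f1 g1) (pair ?B ?E f2 g2)"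
  let ?c = "(ECmp C X1 Y1 Z1 \<otimes>\<^bsub>V\<^esub> ECmp C X2 Y2 Z2) \<Zsemi>\<^bsub>V\<^esub> be X1 X2 Z1 Z2"
  have "hc (bx X1 X2) (bx Y1 Y2) (bx Z1 Z2) (bc X1 X2 Y1 Y2 f1 f2) (bc Y1 Y2 Z1 Z2 g1 g2) =
      ?p \<Zsemi> far G (?m \<Zsemi>\<^bsub>V\<^esub> ?c)"
    using assms by (simp add: hc_def bc_def pair_far far_fold be_cmp del: K.cmp_assoc_arr)
  also have "\<dots> = (?p \<Zsemi> far G ?m) \<Zsemi> far G ?c"
    using assms by (simp add: far_fold del: K.cmp_assoc_arr)
  also have "?p \<Zsemi> far G ?m = ?mK \<Zsemi> ?q"
    using assms by (intro pair_middle_swap) (auto simp: Hom_iff)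
  also have "(?mK \<Zsemi> ?q) \<Zsemi> far G ?c = ?mK \<Zsemi> ((?q \<Zsemi> far G (ECmp C X1 Y1 Z1 \<otimes>\<^bsub>V\<^esub> ECmp C X2 Y2 Z2)) \<Zsemi>
      far G (be X1 X2 Z1 Z2))"
    using assms by (simp add: far_cmp_arr)
  also have "\<dots> = ?mK \<Zsemi> bc X1 X2 Z1 Z2 (hc X1 Y1 Z1 f1 g1) (hc X2 Y2 Z2 f2 g2)"
    using assms by (simp add: hc_def bc_def pair_far del: K.cmp_assoc_arr)
  finally show ?thesis .
qed

text \<open>The unit law of \<open>EBox B\<close> involves an inverse unitor but no symmetry, and
  \<open>pair_eps_inverse\<close> absorbs it. Hence identities are preserved strictly and
  \<open>punit\<close> can be an identity 2-cell.\<close>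

lemma bc_unit:
  assumes "X1 \<in> EOb C" and "X2 \<in> EOb C"
  shows "bc X1 X2 X1 X2 (eps G \<Zsemi> far G (EId C X1)) (eps G \<Zsemi> far G (EId C X2)) =
    eps G \<Zsemi> far G (EId C (bx X1 X2))"
  using assms by (simp add: bc_def pair_far pair_eps_inverse(1) far_fold be_id del: K.cmp_assoc_arr)

text \<open>The two recorded endpoints of \<open>pcomp\<close> are the two sides of interchange;
  that the middle swap really is a 2-cell between them is \<open>hc_bc\<close>, used in
  \<open>box_pcomp_cell\<close>.\<close>

definition box_pfun ::
    "('x \<times> 'x, ('o \<times> 'a) \<times> ('o \<times> 'a), ('o \<times> 'a, 'a) arrow \<times> ('o \<times> 'a, 'a) arrow, 'x, 'o \<times> 'a, ('o \<times> 'a, 'a) arrow) pfun" where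
  "box_pfun =
     \<lparr>pob = eob (EBox B),
      phom = (\<lambda>(X1, X2) (Y1, Y2).
        comp_funct (ntld N (EHom C X1 Y1) (EHom C X2 Y2)) (nar N (be X1 X2 Y1 Y2))),
      pcomp = (\<lambda>(X1, X2) (Y1, Y2) (Z1, Z2) (f1, f2) (g1, g2).
        Arrow
          ((fst f1 \<odot> fst f2) \<odot> (fst g1 \<odot> fst g2),
           hc (bx X1 X2) (bx Y1 Y2) (bx Z1 Z2)
             (bc X1 X2 Y1 Y2 (snd f1) (snd f2)) (bc Y1 Y2 Z1 Z2 (snd g1) (snd g2)))
          (middle_swap K (fst f1) (fst f2) (fst g1) (fst g2))
          ((fst f1 \<odot> fst g1) \<odot> (fst f2 \<odot> fst g2),
           bc X1 X2 Z1 Z2 (hc X1 Y1 Z1 (snd f1) (snd g1)) (hc X2 Y2 Z2 (snd f2) (snd g2)))),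
      punit = (\<lambda>(X1, X2). Id2 D (bx X1 X2) (bx X1 X2) (Id1 D (bx X1 X2)))\<rparr>"

lemma box_pfun_sel:
  "pob box_pfun = eob (EBox B)"
  "phom box_pfun (X1, X2) (Y1, Y2) =
     comp_funct (ntld N (EHom C X1 Y1) (EHom C X2 Y2)) (nar N (be X1 X2 Y1 Y2))"
  "par1 box_pfun (X1, X2) (Y1, Y2) (a, b) = (fst a \<odot> fst b, bc X1 X2 Y1 Y2 (snd a) (snd b))"
  "par2 box_pfun (X1, X2) (Y1, Y2) (\<alpha>, \<beta>) =
     Arrow (par1 box_pfun (X1, X2) (Y1, Y2) (Src \<alpha>, Src \<beta>)) (Val \<alpha> \<otimes> Val \<beta>)
       (par1 box_pfun (X1, X2) (Y1, Y2) (Tgt \<alpha>, Tgt \<beta>))"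
  "pcomp box_pfun (X1, X2) (Y1, Y2) (Z1, Z2) (a1, a2) (b1, b2) =
     Arrow
       (HComp1 D (bx X1 X2) (bx Y1 Y2) (bx Z1 Z2)
         (par1 box_pfun (X1, X2) (Y1, Y2) (a1, a2)) (par1 box_pfun (Y1, Y2) (Z1, Z2) (b1, b2)))
       (middle_swap K (fst a1) (fst a2) (fst b1) (fst b2))
       (par1 box_pfun (X1, X2) (Z1, Z2) (HComp1 D X1 Y1 Z1 a1 b1, HComp1 D X2 Y2 Z2 a2 b2))"
  "punit box_pfun (X1, X2) = Id2 D (bx X1 X2) (bx X1 X2) (Id1 D (bx X1 X2))"
  by (simp_all add: box_pfun_def D_sel comp_funct_def bc_def)

lemma box_pfun_val [simp]:
  "Val (par2 box_pfun (X1, X2) (Y1, Y2) (\<alpha>, \<beta>)) = Val \<alpha> \<otimes> Val \<beta>"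
  "Val (pcomp box_pfun (X1, X2) (Y1, Y2) (Z1, Z2) (a1, a2) (b1, b2)) =
     middle_swap K (fst a1) (fst a2) (fst b1) (fst b2)"
  "Val (punit box_pfun (X1, X2)) = Ide K (Unt K)"
  "fst (par1 box_pfun (X1, X2) (Y1, Y2) (a, b)) = fst a \<odot> fst b"
  by (simp_all add: box_pfun_sel(3-6))

lemma box_par1_cell:
  "X1 \<in> EOb C \<Longrightarrow> X2 \<in> EOb C \<Longrightarrow> Y1 \<in> EOb C \<Longrightarrow> Y2 \<in> EOb C \<Longrightarrow>
     a \<in> Cell1 D X1 Y1 \<Longrightarrow> b \<in> Cell1 D X2 Y2 \<Longrightarrow>
     par1 box_pfun (X1, X2) (Y1, Y2) (a, b) \<in> Cell1 D (bx X1 X2) (bx Y1 Y2)"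
  by (simp add: cell1_iff box_pfun_sel(3))

lemma box_phom_functor:
  assumes "X1 \<in> EOb C" and "X2 \<in> EOb C" and "Y1 \<in> EOb C" and "Y2 \<in> EOb C"
  shows "category_functor (prod_cat (HomC D X1 Y1) (HomC D X2 Y2)) (HomC D (bx X1 X2) (bx Y1 Y2))
    (phom box_pfun (X1, X2) (Y1, Y2))"
  unfolding box_pfun_sel D_sel
  by (rule category_functor_comp[OF ntld_functor nar_functor]) (use assms in \<open>auto simp: Hom_iff[where C = V]\<close>)

lemma box_pcomp_cell:
  assumes "X1 \<in> EOb C" and "X2 \<in> EOb C" and "Y1 \<in> EOb C" and "Y2 \<in> EOb C" and "Z1 \<in> EOb C" and "Z2 \<in> EOb C"
    and "a1 \<in> Cell1 D X1 Y1" and "a2 \<in> Cell1 D X2 Y2" and "b1 \<in> Cell1 D Y1 Z1" and "b2 \<in> Cell1 D Y2 Z2"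
  shows "pcomp box_pfun (X1, X2) (Y1, Y2) (Z1, Z2) (a1, a2) (b1, b2) \<in> Cell2 D (bx X1 X2) (bx Z1 Z2)
    (HComp1 D (bx X1 X2) (bx Y1 Y2) (bx Z1 Z2)
      (par1 box_pfun (X1, X2) (Y1, Y2) (a1, a2)) (par1 box_pfun (Y1, Y2) (Z1, Z2) (b1, b2)))
    (par1 box_pfun (X1, X2) (Z1, Z2) (HComp1 D X1 Y1 Z1 a1 b1, HComp1 D X2 Y2 Z2 a2 b2))"
    (is "_ \<in> Cell2 D ?X ?Z ?l ?r")
proof -
  have "?l \<in> Cell1 D ?X ?Z" "?r \<in> Cell1 D ?X ?Z"
    using assms by (auto intro!: D.hcomp1_cell box_par1_cell simp: D_sel(1))
  moreover have "snd ?l = middle_swap K (fst a1) (fst a2) (fst b1) (fst b2) \<Zsemi> snd ?r"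
    using assms by (simp add: box_pfun_sel(3) D_sel(3) hc_bc cell1_iff)
  moreover have "middle_swap K (fst a1) (fst a2) (fst b1) (fst b2) \<in> Arr K"
      "Dom K (middle_swap K (fst a1) (fst a2) (fst b1) (fst b2)) = fst ?l"
      "Cod K (middle_swap K (fst a1) (fst a2) (fst b1) (fst b2)) = fst ?r"
    using assms by (simp_all add: cell1_iff)
  ultimately show ?thesis
    by (simp add: cell2_iff box_pfun_sel(5))
qed

lemma box_id1:
  "X1 \<in> EOb C \<Longrightarrow> X2 \<in> EOb C \<Longrightarrow>
     par1 box_pfun (X1, X2) (X1, X2) (Id1 D X1, Id1 D X2) = Id1 D (bx X1 X2)"
  by (simp add: box_pfun_sel(3) D_sel(5) bc_unit)

lemma pseudofunctor_box: "pseudofunctor (prod_two_cat D D) D box_pfun"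
proof (rule pseudofunctor_sliceI[OF two_category_prod[OF two_category_D two_category_D]])
  let ?A = "prod_two_cat D D"
  have fst: "fst a \<in> U" if "a \<in> Cell1 D X Y" for X Y a
    using that by (simp add: cell1_iff)
  fix X Y Z T f g h f' g' \<alpha> \<beta>
  assume "X \<in> Cell0 ?A"
  then obtain X1 X2 where X: "X = (X1, X2)" "X1 \<in> EOb C" "X2 \<in> EOb C"
    by (auto simp: D_sel(1))
  then have bx: "bx X1 X2 \<in> Cell0 D"
    by (simp add: D_sel(1))
  then show "pob box_pfun X \<in> Cell0 D"
    by (simp add: X box_pfun_sel(1))
  show "punit box_pfun X \<in> Cell2 D (pob box_pfun X) (pob box_pfun X) (Id1 D (pob box_pfun X))
      (par1 box_pfun X X (Id1 ?A X)) \<and> Val (punit box_pfun X) = Ide K (Unt K)"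
    using X bx by (simp add: box_pfun_sel(1,6) box_id1 D.id1_cell D.id2_cell)
  assume "Y \<in> Cell0 ?A"
  then obtain Y1 Y2 where Y: "Y = (Y1, Y2)" "Y1 \<in> EOb C" "Y2 \<in> EOb C"
    by (auto simp: D_sel(1))
  show "category_functor (HomC ?A X Y) (HomC D (pob box_pfun X) (pob box_pfun Y)) (phom box_pfun X Y)"
    using X Y box_phom_functor by (simp add: box_pfun_sel(1))
  {
    assume "f \<in> Cell1 ?A X Y"
    then obtain f1 f2 where f: "f = (f1, f2)" "f1 \<in> Cell1 D X1 Y1" "f2 \<in> Cell1 D X2 Y2"
      by (cases f) (simp add: X Y)
    show "Val (pcomp box_pfun X X Y (Id1 ?A X) f) = Ide K (fst (par1 box_pfun X Y f)) \<and>
        Val (pcomp box_pfun X Y Y f (Id1 ?A Y)) = Ide K (fst (par1 box_pfun X Y f))"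
      using fst[OF f(2)] fst[OF f(3)] by (simp add: X Y f)
    assume "Z \<in> Cell0 ?A" "g \<in> Cell1 ?A Y Z"
    then obtain Z1 Z2 g1 g2 where Z: "Z = (Z1, Z2)" "Z1 \<in> EOb C" "Z2 \<in> EOb C"
      and g: "g = (g1, g2)" "g1 \<in> Cell1 D Y1 Z1" "g2 \<in> Cell1 D Y2 Z2"
      by (cases Z; cases g) (simp add: Y D_sel(1))
    note fg = fst[OF f(2)] fst[OF f(3)] fst[OF g(2)] fst[OF g(3)]
    show "pcomp box_pfun X Y Z f g \<in> Cell2 D (pob box_pfun X) (pob box_pfun Z)
        (HComp1 D (pob box_pfun X) (pob box_pfun Y) (pob box_pfun Z) (par1 box_pfun X Y f) (par1 box_pfun Y Z g))
        (par1 box_pfun X Z (HComp1 ?A X Y Z f g)) \<and> iso K (Val (pcomp box_pfun X Y Z f g))"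
      using box_pcomp_cell[OF X(2,3) Y(2,3) Z(2,3) f(2,3) g(2,3)] fg
      by (simp add: X Y Z f g box_pfun_sel(1) K.middle_swap_iso_hom(1))
    assume "h \<in> Cell1 ?A Z T"
    then obtain T1 T2 h1 h2 where T: "T = (T1, T2)"
      and h: "h = (h1, h2)" "h1 \<in> Cell1 D Z1 T1" "h2 \<in> Cell1 D Z2 T2"
      by (cases T; cases h) (simp add: Z)
    show "(Val (pcomp box_pfun X Y Z f g) \<otimes> Ide K (fst (par1 box_pfun Z T h))) \<Zsemi>
        Val (pcomp box_pfun X Z T (HComp1 ?A X Y Z f g) h) =
      (Ide K (fst (par1 box_pfun X Y f)) \<otimes> Val (pcomp box_pfun Y Z T g h)) \<Zsemi>
        Val (pcomp box_pfun X Y T f (HComp1 ?A Y Z T g h))"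
      using K.middle_swap_assoc[of "fst f1" "fst f2" "fst g1" "fst g2" "fst h1" "fst h2"] fg
        fst[OF h(2)] fst[OF h(3)] by (simp add: X Y Z T f g h)
  next
    assume "\<alpha> \<in> Cell2 ?A X Y f f'" "\<beta> \<in> Cell2 ?A Y Z g g'"
    moreover obtain Z1 Z2 f1 f2 g1 g2 f1' f2' g1' g2' \<alpha>1 \<alpha>2 \<beta>1 \<beta>2
      where f: "Z = (Z1, Z2)" "f = (f1, f2)" "g = (g1, g2)" "f' = (f1', f2')" "g' = (g1', g2')"
        "\<alpha> = (\<alpha>1, \<alpha>2)" "\<beta> = (\<beta>1, \<beta>2)"
      by (metis surj_pair)
    ultimately show "(Val (par2 box_pfun X Y \<alpha>) \<otimes> Val (par2 box_pfun Y Z \<beta>)) \<Zsemi> Val (pcomp box_pfun X Y Z f' g') =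
      Val (pcomp box_pfun X Y Z f g) \<Zsemi> Val (par2 box_pfun X Z (HComp2 ?A X Y Z \<alpha> \<beta>))"
      using K.middle_swap_natural[of "Val \<alpha>1" "fst f1" "fst f1'" "Val \<alpha>2" "fst f2" "fst f2'"
          "Val \<beta>1" "fst g1" "fst g1'" "Val \<beta>2" "fst g2" "fst g2'"]
      by (simp add: X Y f cell2_iff cell1_iff Hom_iff[where C = K])
  }
qed

section \<open>Transport of coherence from the underlying monoidal category\<close>

abbreviation "UC \<equiv> underlying_moncat V C B"

text \<open>A generalized element with trivial parameter. On arrows of the underlying category this
  is strictly functorial and compatible with the monoidal product, by \<open>lift1_cmp\<close>,
  \<open>lift1_tens\<close> and \<open>lift1_ide\<close>, so equations and inverses transfer to
  1-cells.\<close>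

abbreviation lift1 :: "'va \<Rightarrow> 'o \<times> 'a" where
  "lift1 x \<equiv> (Unt K, eps G \<Zsemi> far G x)"

lemma UC_sel:
  "Ob UC = EOb C" "Dom UC = Src" "Cod UC = Tgt"
  "a \<in> Arr UC \<longleftrightarrow> Src a \<in> EOb C \<and> Tgt a \<in> EOb C \<and> Val a \<in> Hom V (Unt V) (EHom C (Src a) (Tgt a))"
  "Tens0 UC X Y = bx X Y" "Unt UC = EUnt B"
  by (cases a; auto simp: underlying_moncat_def underlying_category_def cat.defs moncat.defs Let_def)+

lemma UC_Val:
  "Val (Ide UC X) = EId C X"
  "Val (Asc UC X Y Z) = EAsc B X Y Z" "Val (Lun UC X) = ELun B X" "Val (Run UC X) = ERun B X"
  "Val (a \<Zsemi>\<^bsub>UC\<^esub> b) = inverse_of V (Lun V (Unt V)) \<Zsemi>\<^bsub>V\<^esub> (Val a \<otimes>\<^bsub>V\<^esub> Val b) \<Zsemi>\<^bsub>V\<^esub> ECmp C (Src a) (Tgt a) (Tgt b)"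
  "Val (a \<otimes>\<^bsub>UC\<^esub> b) = inverse_of V (Lun V (Unt V)) \<Zsemi>\<^bsub>V\<^esub> (Val a \<otimes>\<^bsub>V\<^esub> Val b) \<Zsemi>\<^bsub>V\<^esub> be (Src a) (Src b) (Tgt a) (Tgt b)"
  by (auto simp: underlying_moncat_def underlying_category_def cat.defs moncat.defs Let_def)

sublocale UC: monoidal_category UC
  by (rule B.underlying_monoidal)

lemma lift1_cell1:
  assumes "a \<in> Arr UC"
  shows "lift1 (Val a) \<in> Cell1 D (Dom UC a) (Cod UC a)"
  using assms by (simp add: UC_sel cell1_iff Hom_iff)

lemma lift1_cmp:
  assumes "a \<in> Arr UC" and "b \<in> Arr UC" and "Cod UC a = Dom UC b"
  shows "lift1 (Val (a \<Zsemi>\<^bsub>UC\<^esub> b)) =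
    HComp1 D (Dom UC a) (Cod UC a) (Cod UC b) (lift1 (Val a)) (lift1 (Val b))"
  using assms unfolding UC_Val
  by (simp add: UC_sel Hom_iff D_sel(3) hc_def pair_far pair_eps_inverse(1) far_fold del: K.cmp_assoc_arr)

lemma lift1_tens:
  assumes "a \<in> Arr UC" and "b \<in> Arr UC"
  shows "lift1 (Val (a \<otimes>\<^bsub>UC\<^esub> b)) =
    par1 box_pfun (Dom UC a, Dom UC b) (Cod UC a, Cod UC b) (lift1 (Val a), lift1 (Val b))"
  using assms unfolding UC_Val
  by (simp add: UC_sel Hom_iff box_pfun_sel(3) bc_def pair_far pair_eps_inverse(1) far_fold del: K.cmp_assoc_arr)

lemma lift1_ide: "lift1 (Val (Ide UC X)) = Id1 D X"
  by (simp add: UC_Val D_sel)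

lemma lift1_invertible:
  assumes "iso UC a"
  shows "invertible_1cell D (Dom UC a) (Cod UC a) (lift1 (Val a))"
proof -
  let ?b = "inverse_of UC a"
  have "HComp1 D (Dom UC a) (Cod UC a) (Dom UC a) (lift1 (Val a)) (lift1 (Val ?b)) = Id1 D (Dom UC a)"
    "HComp1 D (Cod UC a) (Dom UC a) (Cod UC a) (lift1 (Val ?b)) (lift1 (Val a)) = Id1 D (Cod UC a)"
    using lift1_cmp[of a ?b] lift1_cmp[of ?b a] assms lift1_ide by simp_all
  then show ?thesis
    unfolding invertible_1cell_def using lift1_cell1[of a] lift1_cell1[of ?b] assms by auto
qed

lemma eunt_ob [simp]: "EUnt B \<in> EOb C"
  by (rule B.eunt_ob)

lemma lift1_structure_cell1:
  assumes "X \<in> EOb C"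
  shows "Y \<in> EOb C \<Longrightarrow> Z \<in> EOb C \<Longrightarrow> lift1 (EAsc B X Y Z) \<in> Cell1 D (bx (bx X Y) Z) (bx X (bx Y Z))"
    and "lift1 (ELun B X) \<in> Cell1 D (bx (EUnt B) X) X"
    and "lift1 (ERun B X) \<in> Cell1 D (bx X (EUnt B)) X"
  using lift1_cell1[of "Asc UC X Y Z"] lift1_cell1[of "Lun UC X"] lift1_cell1[of "Run UC X"] assms
    UC.structure_iso UC.structure_simps
  by (simp_all add: UC_Val UC_sel(1,5,6))

lemma emon_simps [simp]:
  assumes "X \<in> EOb C"
  shows "Y \<in> EOb C \<Longrightarrow> Z \<in> EOb C \<Longrightarrow> EAsc B X Y Z \<in> Arr V"
    and "Y \<in> EOb C \<Longrightarrow> Z \<in> EOb C \<Longrightarrow> Dom V (EAsc B X Y Z) = Unt V"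
    and "ELun B X \<in> Arr V" and "Dom V (ELun B X) = Unt V"
    and "ERun B X \<in> Arr V" and "Dom V (ERun B X) = Unt V"
  using UC.iso_simps(1)[OF UC.structure_iso(1), of X Y Z] UC.iso_simps(1)[OF UC.structure_iso(2), of X]
    UC.iso_simps(1)[OF UC.structure_iso(3), of X] assms
  by (auto simp: UC_sel(1,4) UC_Val Hom_iff)

section \<open>Strict naturality of the associator and the unitors\<close>

lemma pseudofunctor_asc_left:
  "pseudofunctor (prod_two_cat (prod_two_cat D D) D) D (comp_pfun D (prod_pfun box_pfun (id_pfun D)) box_pfun)"
  using pseudofunctor_comp[OF pseudofunctor_prod[OF pseudofunctor_box pseudofunctor_id] pseudofunctor_box]
    two_category_D by blast

lemma pseudofunctor_asc_right:
  "pseudofunctor (prod_two_cat (prod_two_cat D D) D) D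
     (comp_pfun D (asc_pfun D) (comp_pfun D (prod_pfun (id_pfun D) box_pfun) box_pfun))"
  using pseudofunctor_comp[OF pseudofunctor_asc pseudofunctor_comp[OF
        pseudofunctor_prod[OF pseudofunctor_id pseudofunctor_box] pseudofunctor_box]] two_category_D by blast

lemma asc_strictly_natural:
  "strictly_natural (prod_two_cat (prod_two_cat D D) D) D
     (comp_pfun D (prod_pfun box_pfun (id_pfun D)) box_pfun)
     (comp_pfun D (asc_pfun D) (comp_pfun D (prod_pfun (id_pfun D) box_pfun) box_pfun))
     (\<lambda>((X, Y), Z). lift1 (EAsc B X Y Z))"
proof (rule strictly_natural_sliceI[OF pseudofunctor_asc_left pseudofunctor_asc_right])
  let ?A = "prod_two_cat (prod_two_cat D D) D" and ?t = "\<lambda>((X, Y), Z). lift1 (EAsc B X Y Z)"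
    and ?P = "comp_pfun D (prod_pfun box_pfun (id_pfun D)) box_pfun"
    and ?Q = "comp_pfun D (asc_pfun D) (comp_pfun D (prod_pfun (id_pfun D) box_pfun) box_pfun)"
  have fst: "fst a \<in> U" if "a \<in> Cell1 D X Y" for X Y a
    using that by (simp add: cell1_iff)
  have val: "Val \<alpha> \<in> Arr K" "Dom K (Val \<alpha>) \<in> U" "Cod K (Val \<alpha>) \<in> U"
    if "\<alpha> \<in> Cell2 D X Y a b" for X Y \<alpha> a b
    using that by (auto simp: cell2_iff cell1_iff)
  fix X Y Z f g \<alpha>
  assume "X \<in> Cell0 ?A"
  then obtain X1 X2 X3 where X: "X = ((X1, X2), X3)" "X1 \<in> EOb C" "X2 \<in> EOb C" "X3 \<in> EOb C"
    by (auto simp: D_sel(1))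
  show "?t X \<in> Cell1 D (pob ?P X) (pob ?Q X) \<and> fst (?t X) = Unt K"
    using X lift1_structure_cell1(1) by (simp add: box_pfun_sel(1))
  show "Val (punit ?P X) =
      Val (punit ?Q X)"
    using X by (simp add: box_pfun_sel(1))
  assume "Y \<in> Cell0 ?A"
  then obtain Y1 Y2 Y3 where Y: "Y = ((Y1, Y2), Y3)" "Y1 \<in> EOb C" "Y2 \<in> EOb C" "Y3 \<in> EOb C"
    by (auto simp: D_sel(1))
  {
    assume "f \<in> Cell1 ?A X Y"
    then obtain f1 f2 f3 where f: "f = ((f1, f2), f3)" "f1 \<in> Cell1 D X1 Y1" "f2 \<in> Cell1 D X2 Y2" "f3 \<in> Cell1 D X3 Y3"
      by (cases f) (auto simp: X Y simp del: split_paired_All)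
    note c = f(2-4)[unfolded cell1_iff]
    \<comment> \<open>The three 1-cells combined into one generalized element of the hom-object of
      \<open>(C \<otimes> C) \<otimes> C\<close>, at which the \<open>V\<close>-naturality of the
      associator is evaluated.\<close>
    let ?x = "pair (EHom C X1 Y1 \<odot>\<^bsub>V\<^esub> EHom C X2 Y2) (EHom C X3 Y3)
        (pair (EHom C X1 Y1) (EHom C X2 Y2) (snd f1) (snd f2)) (snd f3)"
    have "hc (bx (bx X1 X2) X3) (bx (bx Y1 Y2) Y3) (bx Y1 (bx Y2 Y3))
        (?x \<Zsemi> far G ((be X1 X2 Y1 Y2 \<otimes>\<^bsub>V\<^esub> Ide V (EHom C X3 Y3)) \<Zsemi>\<^bsub>V\<^esub> be (bx X1 X2) X3 (bx Y1 Y2) Y3))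
        (eps G \<Zsemi> far G (EAsc B Y1 Y2 Y3)) =
      hc (bx (bx X1 X2) X3) (bx X1 (bx X2 X3)) (bx Y1 (bx Y2 Y3))
        (eps G \<Zsemi> far G (EAsc B X1 X2 X3))
        (?x \<Zsemi> far G (Asc V (EHom C X1 Y1) (EHom C X2 Y2) (EHom C X3 Y3) \<Zsemi>\<^bsub>V\<^esub>
          ((Ide V (EHom C X1 Y1) \<otimes>\<^bsub>V\<^esub> be X2 X3 Y2 Y3) \<Zsemi>\<^bsub>V\<^esub> be X1 (bx X2 X3) Y1 (bx Y2 Y3))))"
      using hc_natural[OF B.easc_natural, of "((X1, X2), X3)" "((Y1, Y2), Y3)" ?x] X Y c
      by (simp add: tensor_ecat_def tensor_efun_def comp_efun_def asc_efun_def id_efun_def)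
    also have "?x \<Zsemi> far G ((be X1 X2 Y1 Y2 \<otimes>\<^bsub>V\<^esub> Ide V (EHom C X3 Y3)) \<Zsemi>\<^bsub>V\<^esub> be (bx X1 X2) X3 (bx Y1 Y2) Y3) =
        bc (bx X1 X2) X3 (bx Y1 Y2) Y3 (bc X1 X2 Y1 Y2 (snd f1) (snd f2)) (snd f3)"
      using X Y c by (simp add: bc_def pair_far_left far_fold del: K.cmp_assoc_arr)
    \<comment> \<open>Here \<open>Asc V\<close> from the reassociation functor acts on
      \<open>?x\<close>; \<open>pair_asc\<close> rebrackets the pairing and leaves the parameter
      object alone, which is why naturality is strict.\<close>
    also have "?x \<Zsemi> far G (Asc V (EHom C X1 Y1) (EHom C X2 Y2) (EHom C X3 Y3) \<Zsemi>\<^bsub>V\<^esub>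
          ((Ide V (EHom C X1 Y1) \<otimes>\<^bsub>V\<^esub> be X2 X3 Y2 Y3) \<Zsemi>\<^bsub>V\<^esub> be X1 (bx X2 X3) Y1 (bx Y2 Y3))) =
        bc X1 (bx X2 X3) Y1 (bx Y2 Y3) (snd f1) (bc X2 X3 Y2 Y3 (snd f2) (snd f3))"
      using X Y c by (simp add: bc_def pair_far_right far_fold[symmetric] pair_asc del: K.cmp_assoc_arr)
    finally show "HComp1 D (pob ?P X) (pob ?P Y) (pob ?Q Y) (par1 ?P X Y f) (?t Y) =
      HComp1 D (pob ?P X) (pob ?Q X) (pob ?Q Y) (?t X) (par1 ?Q X Y f)"
      using c by (simp add: X Y f box_pfun_sel(1,3) D_sel(3))
    fix g
    assume "Z \<in> Cell0 ?A" "g \<in> Cell1 ?A Y Z"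
    moreover obtain Z1 Z2 Z3 g1 g2 g3 where Z: "Z = ((Z1, Z2), Z3)" "g = ((g1, g2), g3)"
      by (metis surj_pair)
    ultimately have g: "g1 \<in> Cell1 D Y1 Z1" "g2 \<in> Cell1 D Y2 Z2" "g3 \<in> Cell1 D Y3 Z3"
      by (simp_all add: Y)
    show "Val (pcomp ?P X Y Z f g) =
      Val (pcomp ?Q X Y Z f g)"
      using K.middle_swap_asc[of "fst f1" "fst f2" "fst f3" "fst g1" "fst g2" "fst g3"]
        fst[OF f(2)] fst[OF f(3)] fst[OF f(4)] fst[OF g(1)] fst[OF g(2)] fst[OF g(3)]
      by (simp add: X Y Z f box_pfun_sel(1))
  next
    fix f g
    assume "\<alpha> \<in> Cell2 ?A X Y f g"
    moreover obtain f1 f2 f3 g1 g2 g3 \<alpha>1 \<alpha>2 \<alpha>3 where "f = ((f1, f2), f3)" "g = ((g1, g2), g3)"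
      and \<alpha>: "\<alpha> = ((\<alpha>1, \<alpha>2), \<alpha>3)"
      by (metis surj_pair)
    ultimately have "\<alpha>1 \<in> Cell2 D X1 Y1 f1 g1" "\<alpha>2 \<in> Cell2 D X2 Y2 f2 g2" "\<alpha>3 \<in> Cell2 D X3 Y3 f3 g3"
      by (simp_all add: X Y)
    note v = this[THEN val(1)] this[THEN val(2)] this[THEN val(3)]
    show "Val (par2 ?P X Y \<alpha>) =
      Val (par2 ?Q X Y \<alpha>)"
      using v by (simp add: X Y \<alpha> box_pfun_sel(1))
  }
qed

lemma run_strictly_natural:
  "strictly_natural D D (comp_pfun D (rinsert_pfun D (EUnt B)) box_pfun) (id_pfun D) (\<lambda>X. lift1 (ERun B X))"
proof (rule strictly_natural_sliceI)
  let ?J = "EUnt B" and ?I = "id_pfun D"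
  let ?P = "comp_pfun D (rinsert_pfun D ?J) box_pfun"
  have J: "?J \<in> Cell0 D"
    by (simp add: D_sel(1))
  show "pseudofunctor D D ?P"
    by (rule pseudofunctor_comp[OF pseudofunctor_insert(2)[OF two_category_D J] pseudofunctor_box])
  show "pseudofunctor D D ?I"
    by (rule pseudofunctor_id[OF two_category_D])
  fix X Y Z f g \<alpha>
  assume X: "X \<in> Cell0 D"
  show "lift1 (ERun B X) \<in> Cell1 D (pob ?P X) (pob ?I X) \<and> fst (lift1 (ERun B X)) = Unt K"
    using X lift1_structure_cell1(3) by (simp add: box_pfun_sel(1) D_sel(1))
  show "Val (punit ?P X) = Val (punit ?I X)"
    by (simp add: box_pfun_sel(1))
  assume Y: "Y \<in> Cell0 D"
  {
    assume "f \<in> Cell1 D X Y"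
    note f = this[unfolded cell1_iff]
    then show "HComp1 D (pob ?P X)
        (pob ?P Y) (pob ?I Y)
        (par1 ?P X Y f) (lift1 (ERun B Y)) =
      HComp1 D (pob ?P X) (pob ?I X) (pob ?I Y)
        (lift1 (ERun B X)) (par1 ?I X Y f)"
      using hc_natural[OF B.erun_natural, of X Y "snd f"] X Y
      by (simp add: box_pfun_sel(1,3) D_sel(1,3,5) rinsert_efun_def comp_efun_def id_efun_def far_ide
          bc_def pair_far_right pair_eps_inverse far_fold del: K.cmp_assoc_arr)
    assume "Z \<in> Cell0 D" "g \<in> Cell1 D Y Z"
    \<comment> \<open>The second and fourth parameters of this tensorator are the unit, so its
      middle swap is an identity by \<open>middle_swap_unt\<close>.\<close>
    then show "Val (pcomp ?P X Y Z f g) = Val (pcomp ?I X Y Z f g)"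
      using f by (simp add: box_pfun_sel(1) cell1_iff)
  next
    fix f g
    assume "\<alpha> \<in> Cell2 D X Y f g"
    then show "Val (par2 ?P X Y \<alpha>) = Val (par2 ?I X Y \<alpha>)"
      by (simp add: cell2_iff cell1_iff)
  }
qed

lemma lun_strictly_natural:
  "strictly_natural D D (comp_pfun D (linsert_pfun D (EUnt B)) box_pfun) (id_pfun D) (\<lambda>X. lift1 (ELun B X))"
proof (rule strictly_natural_sliceI)
  let ?J = "EUnt B" and ?I = "id_pfun D"
  let ?P = "comp_pfun D (linsert_pfun D ?J) box_pfun"
  have J: "?J \<in> Cell0 D"
    by (simp add: D_sel(1))
  show "pseudofunctor D D ?P"
    by (rule pseudofunctor_comp[OF pseudofunctor_insert(1)[OF two_category_D J] pseudofunctor_box])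
  show "pseudofunctor D D ?I"
    by (rule pseudofunctor_id[OF two_category_D])
  fix X Y Z f g \<alpha>
  assume X: "X \<in> Cell0 D"
  show "lift1 (ELun B X) \<in> Cell1 D (pob ?P X) (pob ?I X) \<and> fst (lift1 (ELun B X)) = Unt K"
    using X lift1_structure_cell1(2) by (simp add: box_pfun_sel(1) D_sel(1))
  show "Val (punit ?P X) = Val (punit ?I X)"
    by (simp add: box_pfun_sel(1))
  assume Y: "Y \<in> Cell0 D"
  {
    assume "f \<in> Cell1 D X Y"
    note f = this[unfolded cell1_iff]
    then show "HComp1 D (pob ?P X)
        (pob ?P Y) (pob ?I Y)
        (par1 ?P X Y f) (lift1 (ELun B Y)) =
      HComp1 D (pob ?P X) (pob ?I X) (pob ?I Y)
        (lift1 (ELun B X)) (par1 ?I X Y f)"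
      using hc_natural[OF B.elun_natural, of X Y "snd f"] X Y
      by (simp add: box_pfun_sel(1,3) D_sel(1,3,5) linsert_efun_def comp_efun_def id_efun_def far_ide
          bc_def pair_far_left pair_eps_inverse far_fold del: K.cmp_assoc_arr)
    assume "Z \<in> Cell0 D" "g \<in> Cell1 D Y Z"
    then show "Val (pcomp ?P X Y Z f g) = Val (pcomp ?I X Y Z f g)"
      using f by (simp add: box_pfun_sel(1) cell1_iff)
  next
    fix f g
    assume "\<alpha> \<in> Cell2 D X Y f g"
    then show "Val (par2 ?P X Y \<alpha>) = Val (par2 ?I X Y \<alpha>)"
      by (simp add: cell2_iff cell1_iff)
  }
qed

definition slice_nsmon ::
    "('x, 'o \<times> 'a, ('o \<times> 'a, 'a) arrow) nsmon" where
  "slice_nsmon =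
     \<lparr>Box = box_pfun, BUnt = EUnt B, BAsc = (\<lambda>X Y Z. lift1 (EAsc B X Y Z)),
      BRun = (\<lambda>X. lift1 (ERun B X)), BLun = (\<lambda>X. lift1 (ELun B X))\<rparr>"

lemma slice_nsmon_sel [simp]:
  "Box slice_nsmon = box_pfun" "BUnt slice_nsmon = EUnt B" "BAsc slice_nsmon X Y Z = lift1 (EAsc B X Y Z)"
  "BRun slice_nsmon X = lift1 (ERun B X)" "BLun slice_nsmon X = lift1 (ELun B X)"
  by (simp_all add: slice_nsmon_def)

lemma nearly_strict_monoidal: "nearly_strict_monoidal_two_category D slice_nsmon"
proof (intro nearly_strict_monoidal_two_category.intro nearly_strict_monoidal_two_category_axioms.intro
    two_category_D; (unfold slice_nsmon_sel box_pfun_sel(1))?;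
    (rule pseudofunctor_box asc_strictly_natural run_strictly_natural lun_strictly_natural)?)
  show "EUnt B \<in> Cell0 D"
    by (simp add: D_sel(1))
  note iso = UC.structure_iso[unfolded UC_sel(1,5)] and arr = UC.iso_simps(1)[OF UC.structure_iso(1), unfolded UC_sel(1)]
    UC.iso_simps(1)[OF UC.structure_iso(2), unfolded UC_sel(1)] UC.iso_simps(1)[OF UC.structure_iso(3), unfolded UC_sel(1)]
    and hom = UC.structure_simps[unfolded UC_sel(1,5,6)] and ide = UC.ide_simps[unfolded UC_sel(1)]
  fix W X Y Z
  assume "X \<in> Cell0 D"
  then have X: "X \<in> EOb C"
    by (simp add: D_sel(1))
  show "invertible_1cell D (bx X (EUnt B)) X (lift1 (ERun B X))"
    using lift1_invertible[of "Run UC X"] X iso hom by (simp add: UC_Val)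
  show "invertible_1cell D (bx (EUnt B) X) X (lift1 (ELun B X))"
    using lift1_invertible[of "Lun UC X"] X iso hom by (simp add: UC_Val)
  assume "Y \<in> Cell0 D"
  then have Y: "Y \<in> EOb C"
    by (simp add: D_sel(1))
  \<comment> \<open>The triangle of the underlying category under \<open>lift1\<close>. As
    \<open>lift1\<close> abbreviates a pair, \<open>prod.inject\<close> is deleted below; otherwise
    the equation would be split before the transport rules apply.\<close>
  have "lift1 (Val (Asc UC X (Unt UC) Y \<Zsemi>\<^bsub>UC\<^esub> (Ide UC X \<otimes>\<^bsub>UC\<^esub> Lun UC Y))) =
      lift1 (Val (Run UC X \<otimes>\<^bsub>UC\<^esub> Ide UC Y))"
    using UC.triangle[of X Y] X Y by (simp add: UC_sel(1))
  then show "HComp1 D (bx (bx X (EUnt B)) Y) (bx X (bx (EUnt B) Y)) (bx X Y)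
        (lift1 (EAsc B X (EUnt B) Y))
        (par1 box_pfun (X, bx (EUnt B) Y) (X, Y) (Id1 D X, lift1 (ELun B Y))) =
      par1 box_pfun (bx X (EUnt B), Y) (X, Y) (lift1 (ERun B X), Id1 D Y)"
    using X Y arr hom ide
    by (simp add: lift1_cmp lift1_tens lift1_ide UC_sel(1,5,6) UC_Val(2-4) del: prod.inject)
  assume "Z \<in> Cell0 D"
  then have Z: "Z \<in> EOb C"
    by (simp add: D_sel(1))
  show "invertible_1cell D (bx (bx X Y) Z) (bx X (bx Y Z)) (lift1 (EAsc B X Y Z))"
    using lift1_invertible[of "Asc UC X Y Z"] X Y Z iso hom by (simp add: UC_Val)
  assume "W \<in> Cell0 D"
  then have W: "W \<in> EOb C"
    by (simp add: D_sel(1))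
  have "lift1 (Val (Asc UC (bx W X) Y Z \<Zsemi>\<^bsub>UC\<^esub> Asc UC W X (bx Y Z))) =
      lift1 (Val ((Asc UC W X Y \<otimes>\<^bsub>UC\<^esub> Ide UC Z) \<Zsemi>\<^bsub>UC\<^esub> Asc UC W (bx X Y) Z \<Zsemi>\<^bsub>UC\<^esub> (Ide UC W \<otimes>\<^bsub>UC\<^esub> Asc UC X Y Z)))"
    using UC.pentagon[of W X Y Z] X Y Z W by (simp only: UC_sel(1,5))
  then show "HComp1 D (bx (bx (bx W X) Y) Z) (bx (bx W X) (bx Y Z)) (bx W (bx X (bx Y Z)))
        (lift1 (EAsc B (bx W X) Y Z)) (lift1 (EAsc B W X (bx Y Z))) =
      HComp1 D (bx (bx (bx W X) Y) Z) (bx W (bx (bx X Y) Z)) (bx W (bx X (bx Y Z)))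
        (HComp1 D (bx (bx (bx W X) Y) Z) (bx (bx W (bx X Y)) Z) (bx W (bx (bx X Y) Z))
          (par1 box_pfun (bx (bx W X) Y, Z) (bx W (bx X Y), Z) (lift1 (EAsc B W X Y), Id1 D Z))
          (lift1 (EAsc B W (bx X Y) Z)))
        (par1 box_pfun (W, bx (bx X Y) Z) (W, bx X (bx Y Z)) (Id1 D W, lift1 (EAsc B X Y Z)))"
    using X Y Z W arr hom ide
    by (simp add: lift1_cmp lift1_tens lift1_ide UC_sel(1,5,6) UC_Val(2-4) del: prod.inject UC.cmp_assoc_arr)
qed

end

section \<open>The symmetry\<close>

locale slice_symmetric = slice_monoidal V K G U C B + S: symmetric_monoidal_enriched_category V C B s
  for V :: "('vo, 'va, 'y) smoncat_scheme" and K :: "('o, 'a, 'z) smoncat_scheme" (structure)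
    and G :: "('vo, 'va, 'o, 'a, 'w) laxfun_scheme" and U and C :: "('x, 'vo, 'va) ecat"
    and B :: "('x, 'va) emon" and s :: "'x \<Rightarrow> 'x \<Rightarrow> 'va"
begin

definition sym_pnat ::
    "('x \<times> 'x, ('o \<times> 'a) \<times> ('o \<times> 'a), 'o \<times> 'a, ('o \<times> 'a, 'a) arrow) pnat" where
  "sym_pnat =
     \<lparr>pn1 = (\<lambda>(X, Y). lift1 (s X Y)),
      pn2 = (\<lambda>(X1, X2) (Y1, Y2) (a1, a2). Arrow
        (HComp1 D (bx X1 X2) (bx Y1 Y2) (bx Y2 Y1)
          (par1 box_pfun (X1, X2) (Y1, Y2) (a1, a2)) (lift1 (s Y1 Y2)))
        (Sym K (fst a1) (fst a2))
        (HComp1 D (bx X1 X2) (bx X2 X1) (bx Y2 Y1)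
          (lift1 (s X1 X2)) (par1 box_pfun (X2, X1) (Y2, Y1) (a2, a1))))\<rparr>"

lemma sym_pnat_sel:
  "pn1 sym_pnat (X, Y) = lift1 (s X Y)"
  "pn2 sym_pnat (X1, X2) (Y1, Y2) (a1, a2) = Arrow
     (HComp1 D (bx X1 X2) (bx Y1 Y2) (bx Y2 Y1)
       (par1 box_pfun (X1, X2) (Y1, Y2) (a1, a2)) (lift1 (s Y1 Y2)))
     (Sym K (fst a1) (fst a2))
     (HComp1 D (bx X1 X2) (bx X2 X1) (bx Y2 Y1)
       (lift1 (s X1 X2)) (par1 box_pfun (X2, X1) (Y2, Y1) (a2, a1)))"
  "Val (pn2 sym_pnat (X1, X2) (Y1, Y2) (a1, a2)) = Sym K (fst a1) (fst a2)"
  by (simp_all add: sym_pnat_def)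

abbreviation us :: "'x \<Rightarrow> 'x \<Rightarrow> ('x, 'va) arrow" where
  "us X Y \<equiv> Arrow (bx X Y) (s X Y) (bx Y X)"

sublocale US: symmetry UC us
  by (rule S.underlying_symmetric)

lemma sym_cell1: "X \<in> EOb C \<Longrightarrow> Y \<in> EOb C \<Longrightarrow> lift1 (s X Y) \<in> Cell1 D (bx X Y) (bx Y X)"
  using lift1_cell1[of "us X Y"] US.sym_simps[of X Y] by (simp add: UC_sel(1,2,3,5))

lemma sym_simps [simp]:
  assumes "X \<in> EOb C" and "Y \<in> EOb C"
  shows "s X Y \<in> Arr V" and "Dom V (s X Y) = Unt V" and "Cod V (s X Y) = EHom C (bx X Y) (bx Y X)"
  using US.sym_simps(1)[of X Y] assms by (simp_all add: UC_sel(1,4) Hom_iff)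

text \<open>The \<open>V\<close>-naturality of the symmetry contains \<open>Sym V\<close> from the
  swap functor, and \<open>pair_sym\<close> turns it into the braiding of the parameters. That
  braiding then has to be brought out of the horizontal composite.\<close>

lemma hc_sym:
  assumes "X1 \<in> EOb C" and "X2 \<in> EOb C" and "Y1 \<in> EOb C" and "Y2 \<in> EOb C"
    and "f \<in> Arr K" and "Cod K f = fob G (EHom C X1 Y1)" and "Dom K f \<in> U"
    and "g \<in> Arr K" and "Cod K g = fob G (EHom C X2 Y2)" and "Dom K g \<in> U"
  shows "hc (bx X1 X2) (bx Y1 Y2) (bx Y2 Y1) (bc X1 X2 Y1 Y2 f g) (eps G \<Zsemi> far G (s Y1 Y2)) =
    Sym K (Dom K f) (Dom K g) \<Zsemi>
      hc (bx X1 X2) (bx X2 X1) (bx Y2 Y1) (eps G \<Zsemi> far G (s X1 X2)) (bc X2 X1 Y2 Y1 g f)"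
proof -
  let ?A = "EHom C X1 Y1" and ?B = "EHom C X2 Y2"
  let ?x = "pair ?A ?B f g" and ?s = "Sym K (Dom K f) (Dom K g)"
  have "hc (bx X1 X2) (bx Y1 Y2) (bx Y2 Y1) (?x \<Zsemi> far G (be X1 X2 Y1 Y2)) (eps G \<Zsemi> far G (s Y1 Y2)) =
      hc (bx X1 X2) (bx X2 X1) (bx Y2 Y1) (eps G \<Zsemi> far G (s X1 X2))
        (?x \<Zsemi> far G (Sym V ?A ?B \<Zsemi>\<^bsub>V\<^esub> be X2 X1 Y2 Y1))"
    using hc_natural[OF S.esym_natural, of "(X1, X2)" "(Y1, Y2)" ?x] assms
    by (simp add: tensor_ecat_def comp_efun_def swap_efun_def)
  also have "?x \<Zsemi> far G (Sym V ?A ?B \<Zsemi>\<^bsub>V\<^esub> be X2 X1 Y2 Y1) = ?s \<Zsemi> bc X2 X1 Y2 Y1 g f"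
  proof -
    have "?x \<Zsemi> far G (Sym V ?A ?B \<Zsemi>\<^bsub>V\<^esub> be X2 X1 Y2 Y1) =
        (?x \<Zsemi> far G (Sym V ?A ?B)) \<Zsemi> far G (be X2 X1 Y2 Y1)"
      using assms by (simp add: far_fold del: K.cmp_assoc_arr)
    also have "\<dots> = (?s \<Zsemi> pair ?B ?A g f) \<Zsemi> far G (be X2 X1 Y2 Y1)"
      using assms by (simp add: pair_sym del: K.cmp_assoc_arr)
    also have "\<dots> = ?s \<Zsemi> bc X2 X1 Y2 Y1 g f"
      using assms by (simp add: bc_def)
    finally show ?thesis .
  qed
  also have "hc (bx X1 X2) (bx X2 X1) (bx Y2 Y1) (eps G \<Zsemi> far G (s X1 X2)) (?s \<Zsemi> bc X2 X1 Y2 Y1 g f) =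
      ?s \<Zsemi> hc (bx X1 X2) (bx X2 X1) (bx Y2 Y1) (eps G \<Zsemi> far G (s X1 X2)) (bc X2 X1 Y2 Y1 g f)"
  proof -
    \<comment> \<open>The 1-cell composed in front has parameter \<open>Unt K\<close>, so extracting
      the braiding only tensors it with the identity on the unit.\<close>
    have "pair (EHom C (bx X1 X2) (bx X2 X1)) (EHom C (bx X2 X1) (bx Y2 Y1))
          (eps G \<Zsemi> far G (s X1 X2)) (?s \<Zsemi> bc X2 X1 Y2 Y1 g f) =
        (Ide K (Unt K) \<otimes> ?s) \<Zsemi> pair (EHom C (bx X1 X2) (bx X2 X1)) (EHom C (bx X2 X1) (bx Y2 Y1))
          (eps G \<Zsemi> far G (s X1 X2)) (bc X2 X1 Y2 Y1 g f)"
      using assms by (subst pair_cmp[symmetric]) simp_all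
    then show ?thesis
      using assms by (simp add: hc_def)
  qed
  finally show ?thesis
    using assms by (simp add: bc_def)
qed

lemma sym_pn2_cell:
  assumes "X1 \<in> EOb C" and "X2 \<in> EOb C" and "Y1 \<in> EOb C" and "Y2 \<in> EOb C"
    and "a1 \<in> Cell1 D X1 Y1" and "a2 \<in> Cell1 D X2 Y2"
  shows "pn2 sym_pnat (X1, X2) (Y1, Y2) (a1, a2) \<in> Cell2 D (bx X1 X2) (bx Y2 Y1)
    (HComp1 D (bx X1 X2) (bx Y1 Y2) (bx Y2 Y1)
      (par1 box_pfun (X1, X2) (Y1, Y2) (a1, a2)) (lift1 (s Y1 Y2)))
    (HComp1 D (bx X1 X2) (bx X2 X1) (bx Y2 Y1)
      (lift1 (s X1 X2)) (par1 box_pfun (X2, X1) (Y2, Y1) (a2, a1)))"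
    (is "_ \<in> Cell2 D ?X ?Y ?l ?r")
proof -
  have "?l \<in> Cell1 D ?X ?Y" "?r \<in> Cell1 D ?X ?Y"
    using assms by (auto intro!: D.hcomp1_cell box_par1_cell sym_cell1 simp: D_sel(1))
  moreover have "snd ?l = Sym K (fst a1) (fst a2) \<Zsemi> snd ?r"
    using assms by (simp add: box_pfun_sel(3) D_sel(3) hc_sym cell1_iff)
  moreover have "Sym K (fst a1) (fst a2) \<in> Arr K" "Dom K (Sym K (fst a1) (fst a2)) = fst ?l"
      "Cod K (Sym K (fst a1) (fst a2)) = fst ?r"
    using assms by (simp_all add: cell1_iff)
  ultimately show ?thesis
    by (simp add: cell2_iff sym_pnat_sel(2))
qed

text \<open>Naturality in 2-cells is naturality of the braiding in \<open>K\<close>, the unit axiom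
  uses that braiding with the unit is trivial, and the composition axiom is
  \<open>middle_swap_sym\<close>.\<close>

lemma sym_pseudonatural:
  "pseudonatural (prod_two_cat D D) D box_pfun (comp_pfun D (swap_pfun D) box_pfun) sym_pnat"
proof (rule pseudonatural_sliceI[OF pseudofunctor_box
      pseudofunctor_comp[OF pseudofunctor_swap[OF two_category_D] pseudofunctor_box]])
  let ?A = "prod_two_cat D D" and ?Q = "comp_pfun D (swap_pfun D) box_pfun"
  have fst: "fst a \<in> U" if "a \<in> Cell1 D X Y" for X Y a
    using that by (simp add: cell1_iff)
  fix X Y Z f g \<alpha>
  assume "X \<in> Cell0 ?A"
  then obtain X1 X2 where X: "X = (X1, X2)" "X1 \<in> EOb C" "X2 \<in> EOb C"
    by (auto simp: D_sel(1))
  show "pn1 sym_pnat X \<in> Cell1 D (pob box_pfun X) (pob ?Q X) \<and> fst (pn1 sym_pnat X) = Unt K"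
    using X sym_cell1 by (simp add: sym_pnat_sel(1) box_pfun_sel(1))
  show "Val (punit box_pfun X) \<Zsemi> Val (pn2 sym_pnat X X (Id1 ?A X)) = Val (punit ?Q X)"
    by (simp add: X sym_pnat_sel(3) box_pfun_sel(1))
  assume "Y \<in> Cell0 ?A"
  then obtain Y1 Y2 where Y: "Y = (Y1, Y2)" "Y1 \<in> EOb C" "Y2 \<in> EOb C"
    by (auto simp: D_sel(1))
  {
    assume "f \<in> Cell1 ?A X Y"
    then obtain f1 f2 where f: "f = (f1, f2)" "f1 \<in> Cell1 D X1 Y1" "f2 \<in> Cell1 D X2 Y2"
      by (cases f) (simp add: X Y)
    note U = fst[OF f(2)] fst[OF f(3)]
    show "pn2 sym_pnat X Y f \<in> Cell2 D (pob box_pfun X) (pob ?Q Y)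
        (HComp1 D (pob box_pfun X) (pob box_pfun Y) (pob ?Q Y) (par1 box_pfun X Y f) (pn1 sym_pnat Y))
        (HComp1 D (pob box_pfun X) (pob ?Q X) (pob ?Q Y) (pn1 sym_pnat X) (par1 ?Q X Y f)) \<and>
      iso K (Val (pn2 sym_pnat X Y f))"
      using sym_pn2_cell[OF X(2,3) Y(2,3) f(2,3)] U by (simp add: X Y f sym_pnat_sel(1,3) box_pfun_sel(1))
    fix Z g
    assume "Z \<in> Cell0 ?A" "g \<in> Cell1 ?A Y Z"
    then obtain Z1 Z2 g1 g2 where Z: "Z = (Z1, Z2)"
      and g: "g = (g1, g2)" "g1 \<in> Cell1 D Y1 Z1" "g2 \<in> Cell1 D Y2 Z2"
      by (cases Z; cases g) (simp add: Y)
    show "Val (pcomp box_pfun X Y Z f g) \<Zsemi> Val (pn2 sym_pnat X Z (HComp1 ?A X Y Z f g)) =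
      ((Ide K (fst (par1 box_pfun X Y f)) \<otimes> Val (pn2 sym_pnat Y Z g)) \<Zsemi>
        (Val (pn2 sym_pnat X Y f) \<otimes> Ide K (fst (par1 ?Q Y Z g)))) \<Zsemi> Val (pcomp ?Q X Y Z f g)"
      using U fst[OF g(2)] fst[OF g(3)] K.middle_swap_sym[of "fst f1" "fst f2" "fst g1" "fst g2"]
      by (simp add: X Y Z f g sym_pnat_sel(3) box_pfun_sel(1))
  next
    fix f g
    assume "\<alpha> \<in> Cell2 ?A X Y f g"
    moreover obtain f1 f2 g1 g2 \<alpha>1 \<alpha>2 where f: "f = (f1, f2)" "g = (g1, g2)" "\<alpha> = (\<alpha>1, \<alpha>2)"
      by (metis surj_pair)
    ultimately have "\<alpha>1 \<in> Cell2 D X1 Y1 f1 g1" "\<alpha>2 \<in> Cell2 D X2 Y2 f2 g2"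
      by (simp_all add: X Y)
    then show "Val (par2 box_pfun X Y \<alpha>) \<Zsemi> Val (pn2 sym_pnat X Y g) =
        Val (pn2 sym_pnat X Y f) \<Zsemi> Val (par2 ?Q X Y \<alpha>)"
      using K.sym_natural_arr[of "Val \<alpha>1" "Val \<alpha>2"] by (simp add: X Y f sym_pnat_sel(3) cell2_iff)
  }
qed

lemma nearly_strict_symmetric_monoidal:
  "nearly_strict_symmetric_monoidal_two_category D slice_nsmon sym_pnat"
proof (intro nearly_strict_symmetric_monoidal_two_category.intro nearly_strict_monoidal
    nearly_strict_symmetric_monoidal_two_category_axioms.intro;
    (unfold slice_nsmon_sel box_pfun_sel(1) sym_pnat_sel(1))?)
  show "pseudonatural (prod_two_cat D D) D box_pfun (comp_pfun D (swap_pfun D) box_pfun) sym_pnat"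
    by (rule sym_pseudonatural)
  note arr = UC.iso_simps(1)[OF UC.structure_iso(1), unfolded UC_sel(1)]
    UC.iso_simps(1)[OF UC.structure_iso(2), unfolded UC_sel(1)] UC.iso_simps(1)[OF UC.structure_iso(3), unfolded UC_sel(1)]
    and hom = UC.structure_simps[unfolded UC_sel(1,5,6)] and ide = UC.ide_simps[unfolded UC_sel(1)]
    and us = US.sym_simps[unfolded UC_sel(1,5)]
  have us_val: "s X Y = Val (us X Y)" for X Y
    by simp
  fix X Y Z
  assume "X \<in> Cell0 D"
  then have X: "X \<in> EOb C"
    by (simp add: D_sel(1))
  have "lift1 (Val (us X (Unt UC) \<Zsemi>\<^bsub>UC\<^esub> Lun UC X)) = lift1 (Val (Run UC X))"
    using US.sym_unit[of X] X by (simp only: UC_sel(1))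
  then show "HComp1 D (bx X (EUnt B)) (bx (EUnt B) X) X (lift1 (s X (EUnt B))) (lift1 (ELun B X)) = lift1 (ERun B X)"
    using X arr hom us by (simp add: lift1_cmp UC_sel(1,5,6) UC_Val(2-4) del: prod.inject)
  assume "Y \<in> Cell0 D"
  then have Y: "Y \<in> EOb C"
    by (simp add: D_sel(1))
  have "lift1 (Val (us X Y \<Zsemi>\<^bsub>UC\<^esub> us Y X)) = lift1 (Val (Ide UC (bx X Y)))"
    using US.sym_sym[of X Y] X Y by (simp only: UC_sel(1,5))
  then show "HComp1 D (bx X Y) (bx Y X) (bx X Y) (lift1 (s X Y)) (lift1 (s Y X)) = Id1 D (bx X Y)"
    using X Y us by (simp add: lift1_cmp lift1_ide del: prod.inject)
  assume "Z \<in> Cell0 D"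
  then have Z: "Z \<in> EOb C"
    by (simp add: D_sel(1))
  have "lift1 (Val (Asc UC X Y Z \<Zsemi>\<^bsub>UC\<^esub> us X (bx Y Z) \<Zsemi>\<^bsub>UC\<^esub> Asc UC Y Z X)) =
      lift1 (Val ((us X Y \<otimes>\<^bsub>UC\<^esub> Ide UC Z) \<Zsemi>\<^bsub>UC\<^esub> Asc UC Y X Z \<Zsemi>\<^bsub>UC\<^esub> (Ide UC Y \<otimes>\<^bsub>UC\<^esub> us X Z)))"
    using US.hexagon[of X Y Z] X Y Z by (simp only: UC_sel(1,5))
  then show "HComp1 D (bx (bx X Y) Z) (bx (bx Y Z) X) (bx Y (bx Z X))
        (HComp1 D (bx (bx X Y) Z) (bx X (bx Y Z)) (bx (bx Y Z) X) (lift1 (EAsc B X Y Z)) (lift1 (s X (bx Y Z))))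
        (lift1 (EAsc B Y Z X)) =
      HComp1 D (bx (bx X Y) Z) (bx Y (bx X Z)) (bx Y (bx Z X))
        (HComp1 D (bx (bx X Y) Z) (bx (bx Y X) Z) (bx Y (bx X Z))
          (par1 box_pfun (bx X Y, Z) (bx Y X, Z) (lift1 (s X Y), Id1 D Z))
          (lift1 (EAsc B Y X Z)))
        (par1 box_pfun (Y, bx X Z) (Y, bx Z X) (Id1 D Y, lift1 (s X Z)))"
    using X Y Z arr hom ide us
    by (simp add: lift1_cmp lift1_tens lift1_ide UC_sel(1,5,6) UC_Val(2-4) del: prod.inject UC.cmp_assoc_arr)
qed

end

section \<open>The structure along \<open>U/MF\<close>, expressed through \<open>F\<close>,
  \<open>W\<close> and the Kleisli lift\<close>

theorem theorem3p13:
  fixes V :: "('vo, 'va) smoncat"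
    and W :: "('wo, 'wa) smoncat"
    and M :: "('wo, 'wa) monmonad"
    and F :: "('vo, 'va, 'wo, 'wa) laxfun"
    and U :: "'wo set"
    and C :: "('x, 'vo, 'va) ecat"
  assumes "symmetric_monoidal_category V"
    and "symmetric_monoidal_category W"
    and "symmetric_monoidal_monad W M"
    and "lax_symmetric_monoidal_functor V W F"
    and "full_strict_monoidal_subcategory W U"
    and "enriched_category V C"
  defines "K \<equiv> kleisli W M"
    and "L \<equiv> kleisli_lift W M"
    and "D \<equiv> change_of_base (slice_base W U M F) C"
  shows
    "lax_monoidal_cat_functor V (slice_base W U M F) \<and>
     two_category D \<and>
     Cell0 D = EOb C \<and>
     (\<forall>X\<in>EOb C. \<forall>Y\<in>EOb C.
        Cell1 D X Y = {(u, f). u \<in> U \<and> f \<in> Hom K u (fob F (EHom C X Y))} \<and>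
        (\<forall>(u, f)\<in>Cell1 D X Y. \<forall>(v, g)\<in>Cell1 D X Y.
           Cell2 D X Y (u, f) (v, g) =
             {Arrow (u, f) \<phi> (v, g) | \<phi>. \<phi> \<in> Hom K u v \<and> f = \<phi> \<Zsemi>\<^bsub>K\<^esub> g}) \<and>
        (\<forall>a\<in>Cell1 D X Y. \<forall>b\<in>Cell1 D X Y. \<forall>c\<in>Cell1 D X Y. \<forall>\<alpha>\<in>Cell2 D X Y a b. \<forall>\<beta>\<in>Cell2 D X Y b c.
           VComp D X Y \<alpha> \<beta> = Arrow a (Val \<alpha> \<Zsemi>\<^bsub>K\<^esub> Val \<beta>) c) \<and>
        (\<forall>(u, f)\<in>Cell1 D X Y. Id2 D X Y (u, f) = Arrow (u, f) (Ide K u) (u, f))) \<and>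
     (\<forall>X\<in>EOb C. \<forall>Y\<in>EOb C. \<forall>Z\<in>EOb C.
        (\<forall>(u1, f1)\<in>Cell1 D X Y. \<forall>(u2, f2)\<in>Cell1 D Y Z.
           HComp1 D X Y Z (u1, f1) (u2, f2) =
             (u1 \<odot>\<^bsub>W\<^esub> u2,
              (f1 \<otimes>\<^bsub>K\<^esub> f2) \<Zsemi>\<^bsub>K\<^esub> L (tld F (EHom C X Y) (EHom C Y Z) \<Zsemi>\<^bsub>W\<^esub> far F (ECmp C X Y Z)))) \<and>
        (\<forall>\<alpha>1\<in>Arr (HomC D X Y). \<forall>\<alpha>2\<in>Arr (HomC D Y Z).
           Val (HComp2 D X Y Z \<alpha>1 \<alpha>2) = Val \<alpha>1 \<otimes>\<^bsub>K\<^esub> Val \<alpha>2)) \<and>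
     (\<forall>X\<in>EOb C. Id1 D X = (Unt W, L (eps F \<Zsemi>\<^bsub>W\<^esub> far F (EId C X)))) \<and>
     (\<forall>B. monoidal_enriched_category V C B \<longrightarrow>
       (\<exists>T. nearly_strict_monoidal_two_category D T \<and>
          (\<forall>X\<in>EOb C. \<forall>Y\<in>EOb C. box0 T X Y = eob (EBox B) (X, Y)) \<and>
          (\<forall>X1\<in>EOb C. \<forall>X2\<in>EOb C. \<forall>Y1\<in>EOb C. \<forall>Y2\<in>EOb C.
             (\<forall>(u1, f1)\<in>Cell1 D X1 Y1. \<forall>(u2, f2)\<in>Cell1 D X2 Y2.
                box1 T X1 X2 Y1 Y2 (u1, f1) (u2, f2) =
                  (u1 \<odot>\<^bsub>W\<^esub> u2,
                   (f1 \<otimes>\<^bsub>K\<^esub> f2) \<Zsemi>\<^bsub>K\<^esub>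
                   L (tld F (EHom C X1 Y1) (EHom C X2 Y2) \<Zsemi>\<^bsub>W\<^esub> far F (ear (EBox B) (X1, X2) (Y1, Y2))))) \<and>
             (\<forall>\<alpha>1\<in>Arr (HomC D X1 Y1). \<forall>\<alpha>2\<in>Arr (HomC D X2 Y2).
                Val (box2 T X1 X2 Y1 Y2 \<alpha>1 \<alpha>2) = Val \<alpha>1 \<otimes>\<^bsub>K\<^esub> Val \<alpha>2)) \<and>
          BUnt T = EUnt B \<and>
          (\<forall>X1\<in>EOb C. \<forall>X2\<in>EOb C. \<forall>Y1\<in>EOb C. \<forall>Y2\<in>EOb C. \<forall>Z1\<in>EOb C. \<forall>Z2\<in>EOb C.
             \<forall>(u1, f1)\<in>Cell1 D X1 Y1. \<forall>(u2, f2)\<in>Cell1 D X2 Y2.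
             \<forall>(v1, g1)\<in>Cell1 D Y1 Z1. \<forall>(v2, g2)\<in>Cell1 D Y2 Z2.
               Val (tensorator T X1 X2 Y1 Y2 Z1 Z2 (u1, f1) (u2, f2) (v1, g1) (v2, g2)) =
                 L (middle_swap W u1 u2 v1 v2)) \<and>
          (\<forall>X\<in>EOb C. \<forall>Y\<in>EOb C. \<forall>Z\<in>EOb C.
             BAsc T X Y Z = (Unt W, L (eps F \<Zsemi>\<^bsub>W\<^esub> far F (EAsc B X Y Z)))) \<and>
          (\<forall>X\<in>EOb C. BRun T X = (Unt W, L (eps F \<Zsemi>\<^bsub>W\<^esub> far F (ERun B X)))) \<and>
          (\<forall>X\<in>EOb C. BLun T X = (Unt W, L (eps F \<Zsemi>\<^bsub>W\<^esub> far F (ELun B X)))) \<and>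
          (\<forall>s. symmetric_monoidal_enriched_category V C B s \<longrightarrow>
            (\<exists>S. nearly_strict_symmetric_monoidal_two_category D T S \<and>
               (\<forall>X\<in>EOb C. \<forall>Y\<in>EOb C.
                  pn1 S (X, Y) = (Unt W, L (eps F \<Zsemi>\<^bsub>W\<^esub> far F (s X Y)))) \<and>
               (\<forall>X1\<in>EOb C. \<forall>X2\<in>EOb C. \<forall>Y1\<in>EOb C. \<forall>Y2\<in>EOb C.
                  \<forall>(u1, f1)\<in>Cell1 D X1 Y1. \<forall>(u2, f2)\<in>Cell1 D X2 Y2.
                    Val (pn2 S (X1, X2) (Y1, Y2) ((u1, f1), (u2, f2))) = L (Sym W u1 u2))))))"
proof -
  interpret M: symmetric_monoidal_monad W M
    by fact
  interpret F: lax_symmetric_monoidal_functor V W F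
    by fact
  interpret UW: full_strict_monoidal_subcategory W U
    by fact
  define G where "G = comp_laxfun K F (kleisli_incl W M)"
  have slice: "slice_setting V K G U"
    unfolding slice_setting_def strict_subcategory_def G_def K_def
    using assms(1) M.symmetric_monoidal_category_kleisli
      M.full_strict_monoidal_subcategory_kleisli[OF assms(5)] M.lax_symmetric_monoidal_functor_kleisli[OF assms(4)]
    by blast
  interpret S: slice_enriched V K G U C
    by (intro slice_enriched.intro slice assms(6))
  have N: "slice_base W U M F = S.N"
    by (simp add: slice_base_def G_def K_def)
  have D: "D = S.D"
    by (simp add: D_def N)
  have fob: "fob G A = fob F A" and far: "far G h = L (far F h)" for A h
    by (simp_all add: G_def comp_laxfun_def kleisli_incl_def L_def)
  \<comment> \<open>The comparisons of the Kleisli inclusion are identities of \<open>K\<close>, so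
    here and for \<open>tld\<close> only the lift of the comparison of \<open>F\<close>
    remains.\<close>
  have eps: "eps G = L (eps F)"
    using S.K.ide_cmp_arr[of "L (eps F)" "Unt W"] M.lift_arr[of "eps F"]
    by (simp add: G_def comp_laxfun_def kleisli_incl_def L_def K_def del: M.kleisli_sel(4,5))
  have tld: "tld G A B = L (tld F A B)" if "A \<in> Ob V" "B \<in> Ob V" for A B
    using S.K.ide_cmp_arr[of "L (tld F A B)" "fob F A \<odot>\<^bsub>W\<^esub> fob F B"] M.lift_arr[of "tld F A B"] that
    by (simp add: G_def comp_laxfun_def kleisli_incl_def L_def K_def del: M.kleisli_sel(4,5))
  have lift1: "eps G \<Zsemi>\<^bsub>K\<^esub> far G x = L (eps F \<Zsemi>\<^bsub>W\<^esub> far F x)" if "x \<in> Arr V" "Dom V x = Unt V" for x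
    using that by (simp add: eps far M.lift_cmp L_def K_def del: M.kleisli_sel(5))
  \<comment> \<open>The comparison and the action of \<open>h\<close> are both pure and merge into
    one lifted arrow of \<open>W\<close>. Horizontal composition and the monoidal product are both
    instances.\<close>
  have pair: "S.pair A B f g \<Zsemi>\<^bsub>K\<^esub> far G h = (f \<otimes>\<^bsub>K\<^esub> g) \<Zsemi>\<^bsub>K\<^esub> L (tld F A B \<Zsemi>\<^bsub>W\<^esub> far F h)"
    if "A \<in> Ob V" "B \<in> Ob V" "h \<in> Arr V" "Dom V h = A \<odot>\<^bsub>V\<^esub> B" "f \<in> Arr K" "g \<in> Arr K"
      "Cod K f = fob G A" "Cod K g = fob G B" for A B f g h
  proof -
    have "S.pair A B f g \<Zsemi>\<^bsub>K\<^esub> far G h = (f \<otimes>\<^bsub>K\<^esub> g) \<Zsemi>\<^bsub>K\<^esub> (tld G A B \<Zsemi>\<^bsub>K\<^esub> far G h)"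
      using that by (simp add: S.pair_def)
    also have "tld G A B \<Zsemi>\<^bsub>K\<^esub> far G h = L (tld F A B \<Zsemi>\<^bsub>W\<^esub> far F h)"
      using that by (simp add: tld far M.lift_cmp L_def K_def del: M.kleisli_sel(5))
    finally show ?thesis .
  qed
  have K_sel: "A \<odot>\<^bsub>K\<^esub> B = A \<odot>\<^bsub>W\<^esub> B" "Unt K = Unt W" "Sym K A B = L (Sym W A B)" for A B
    by (simp_all add: K_def L_def)
  have middle_swap: "middle_swap K A B A' B' = L (middle_swap W A B A' B')"
    if "A \<in> Ob W" "B \<in> Ob W" "A' \<in> Ob W" "B' \<in> Ob W" for A B A' B'
    unfolding K_def L_def using that by (rule M.kleisli_middle_swap)
  have cell1: "a \<in> Cell1 D X Y \<longleftrightarrow> fst a \<in> U \<and> snd a \<in> Hom K (fst a) (fob F (EHom C X Y))" for a X Y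
    by (auto simp: D S.cell1_iff Hom_iff fob)
  have UOb: "u \<in> Ob W" if "u \<in> U" for u
    using UW.sub_ob that by auto
  have hcomp1: "HComp1 D X Y Z (u1, f1) (u2, f2) =
      (u1 \<odot>\<^bsub>W\<^esub> u2, (f1 \<otimes>\<^bsub>K\<^esub> f2) \<Zsemi>\<^bsub>K\<^esub> L (tld F (EHom C X Y) (EHom C Y Z) \<Zsemi>\<^bsub>W\<^esub> far F (ECmp C X Y Z)))"
    if "X \<in> EOb C" "Y \<in> EOb C" "Z \<in> EOb C" "(u1, f1) \<in> Cell1 D X Y" "(u2, f2) \<in> Cell1 D Y Z" for X Y Z u1 u2 f1 f2
    using that by (simp add: D S.D_sel(3) S.hc_def pair K_sel S.cell1_iff)
  \<comment> \<open>Matching against the goal names its monoidal conjunct as a function of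
    \<open>B\<close>, so that it can be stated again inside the interpretation for a given
    \<open>B\<close>.\<close>
  let "_ \<and> _ \<and> _ \<and> _ \<and> _ \<and> _ \<and> (\<forall>B. _ \<longrightarrow> ?monoidal B)" = ?thesis
  show ?thesis
  proof (intro conjI ballI allI impI)
    show "lax_monoidal_cat_functor V (slice_base W U M F)"
      unfolding N by (rule S.lax_monoidal_cat_functor_slice)
    show "two_category D"
      unfolding D by (rule S.two_category_D)
    show "Cell0 D = EOb C"
      by (simp add: D S.D_sel)
    fix X Y assume X: "X \<in> EOb C" and Y: "Y \<in> EOb C"
    show "Cell1 D X Y = {(u, f). u \<in> U \<and> f \<in> Hom K u (fob F (EHom C X Y))}"
      using cell1 by auto
    show "case a of (u, f) \<Rightarrow> \<forall>(v, g)\<in>Cell1 D X Y. Cell2 D X Y (u, f) (v, g) =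
        {Arrow (u, f) \<phi> (v, g) | \<phi>. \<phi> \<in> Hom K u v \<and> f = \<phi> \<Zsemi>\<^bsub>K\<^esub> g}" if "a \<in> Cell1 D X Y" for a
      using that S.cell2_eq[of _ X Y] by (cases a) (auto simp: D)
    show "VComp D X Y \<alpha> \<beta> = Arrow a (Val \<alpha> \<Zsemi>\<^bsub>K\<^esub> Val \<beta>) c"
      if "\<alpha> \<in> Cell2 D X Y a b" "\<beta> \<in> Cell2 D X Y b c" for a b c \<alpha> \<beta>
      using that by (simp add: D S.cell2_iff) (simp add: S.D_sel)
    show "case a of (u, f) \<Rightarrow> Id2 D X Y (u, f) = Arrow (u, f) (Ide K u) (u, f)" for a
      by (cases a) (simp add: D S.D_sel)
    fix Z assume Z: "Z \<in> EOb C"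
    show "case a of (u1, f1) \<Rightarrow> \<forall>(u2, f2)\<in>Cell1 D Y Z. HComp1 D X Y Z (u1, f1) (u2, f2) =
        (u1 \<odot>\<^bsub>W\<^esub> u2, (f1 \<otimes>\<^bsub>K\<^esub> f2) \<Zsemi>\<^bsub>K\<^esub> L (tld F (EHom C X Y) (EHom C Y Z) \<Zsemi>\<^bsub>W\<^esub> far F (ECmp C X Y Z)))"
      if "a \<in> Cell1 D X Y" for a
      using that hcomp1[OF X Y Z] by (cases a) auto
    show "Val (HComp2 D X Y Z \<alpha> \<beta>) = Val \<alpha> \<otimes>\<^bsub>K\<^esub> Val \<beta>" for \<alpha> \<beta>
      by (simp add: D)
  next
    fix X assume "X \<in> EOb C"
    then show "Id1 D X = (Unt W, L (eps F \<Zsemi>\<^bsub>W\<^esub> far F (EId C X)))"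
      by (simp add: D S.D_sel lift1 K_sel)
  next
    fix B assume B: "monoidal_enriched_category V C B"
    interpret B: slice_monoidal V K G U C B
      by (intro slice_monoidal.intro S.slice_enriched_axioms B)
    \<comment> \<open>The statement chooses \<open>T\<close> before \<open>s\<close>, so one witness
      must serve every symmetry; \<open>slice_nsmon\<close> depends only on \<open>B\<close>, and
      \<open>s\<close> enters through \<open>sym_pnat\<close> alone.\<close>
    let ?T = B.slice_nsmon
    let "\<exists>T. _ \<and> _ \<and> _ \<and> _ \<and> _ \<and> _ \<and> _ \<and> _ \<and> (\<forall>s. _ \<longrightarrow> ?symmetric T s)" = "?monoidal B"
    show "?monoidal B"
    proof (intro exI[of _ ?T] conjI allI impI)
      show "nearly_strict_monoidal_two_category D ?T"
        unfolding D by (rule B.nearly_strict_monoidal)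
      fix s assume s: "symmetric_monoidal_enriched_category V C B s"
      interpret s: slice_symmetric V K G U C B s
        by (intro slice_symmetric.intro B.slice_monoidal_axioms s)
      show "?symmetric ?T s"
        using s.nearly_strict_symmetric_monoidal
        by (intro exI[of _ s.sym_pnat]) (auto simp: D s.sym_pnat_sel lift1 K_sel)
    qed (auto simp: B.box_pfun_sel(1,3) B.bc_def pair K_sel lift1 middle_swap UOb D S.cell1_iff)
  qed
qed

end
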